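(* Let $H=(H^1,\dots,H^m)\in C^2(\mathbb R^d;\mathbb R^m)$, let $B=(B_1,\dots,B_m)\in C([0,\infty);\mathbb R^m)$ with $B(0)=0$, and let $F:\mathcal S^d\times\mathbb R^d\to\mathbb R$ be continuous and degenerate elliptic. Let $u,v\in BUC(\mathbb R^d\times[0,\infty))$ be respectively a pathwise subsolution and a pathwise supersolution of $$du=F(D^2u,Du)\,dt+\sum_{i=1}^mH^i(Du)\cdot dB_i\quad\text{in }\mathbb R^d\times(0,\infty).$$ Then, for all $t\ge0$, $$\sup_{x\in\mathbb R^d}(u-v)(x,t)\le\sup_{x\in\mathbb R^d}(u-v)(x,0).$$
   Context: $BUC$ denotes bounded uniformly continuous functions; $\mathcal S^d$ is the space of symmetric $d\times d$ matrices; $F$ is degenerate elliptic if $X\le Y$ implies $F(X,p)\le F(Y,p)$. Smooth solutions of $d\Phi=\sum_iH^i(D\Phi)\cdot dB_i$ for a merely continuous path $B$: given $t_0>0$, $h>0$ and $\phi\in C^2(\mathbb R^d)$, put $X(x,t)=x-\sum_iDH^i(D\phi(x))(B_i(t)-B_i(t_0))$ and $U(x,t)=\phi(x)+\sum_i\big[H^i(D\phi(x))-\langle DH^i(D\phi(x)),D\phi(x)\rangle\big](B_i(t)-B_i(t_0))$. If $x\mapsto X(x,t)$ is a $C^1$-diffeomorphism of $\mathbb R^d$ for every $t\in(t_0-h,t_0+h)$, then $\Phi(X(x,t),t)=U(x,t)$ defines the smooth (i.e. $C^2$ in $x$) solution in $\mathbb R^d\times(t_0-h,t_0+h)$ with $\Phi(\cdot,t_0)=\phi$.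 Pathwise sub/supersolution: $u\in BUC(\mathbb R^d\times[0,\infty))$ is a pathwise subsolution (resp. supersolution) of the equation if, whenever $\psi\in C^1((0,\infty))$, $\Phi$ is a smooth solution of $d\Phi=\sum_iH^i(D\Phi)\cdot dB_i$ in $\mathbb R^d\times(t_0-h,t_0+h)$ for some $h>0$, and $u-\Phi-\psi$ has a local maximum (resp. minimum) at $(x_0,t_0)\in\mathbb R^d\times(0,\infty)$, then $\psi'(t_0)\le F(D^2\Phi(x_0,t_0),D\Phi(x_0,t_0))$ (resp. $\ge$). *)

theory Defs imports "HOL-Analysis.Analysis" begin

definition C1_fun :: "('a::real_normed_vector \<Rightarrow> 'b::real_normed_vector) \<Rightarrow> bool" where
  "C1_fun f \<longleftrightarrow> (\<exists>f' :: 'a \<Rightarrow> 'a \<Rightarrow>\<^sub>L 'b.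
     (\<forall>x. (f has_derivative blinfun_apply (f' x)) (at x)) \<and> continuous_on UNIV f')"

definition C2_fun :: "('a::real_normed_vector \<Rightarrow> 'b::real_normed_vector) \<Rightarrow> bool" where
  "C2_fun f \<longleftrightarrow> (\<exists>f' :: 'a \<Rightarrow> 'a \<Rightarrow>\<^sub>L 'b.
     (\<forall>x. (f has_derivative blinfun_apply (f' x)) (at x)) \<and> C1_fun f')"

definition C1_diffeomorphism :: "('a::real_normed_vector \<Rightarrow> 'a) \<Rightarrow> bool" where
  "C1_diffeomorphism f \<longleftrightarrow> bij f \<and> C1_fun f \<and> C1_fun (inv f)"

definition grad :: "(real^'d \<Rightarrow> real) \<Rightarrow> real^'d \<Rightarrow> real^'d" where
  "grad f x = (\<chi> i. frechet_derivative f (at x) (axis i 1))"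

definition hess :: "(real^'d \<Rightarrow> real) \<Rightarrow> real^'d \<Rightarrow> real^'d^'d" where
  "hess f x = jacobian (grad f) (at x)"

definition BUC :: "'a::metric_space set \<Rightarrow> ('a \<Rightarrow> real) \<Rightarrow> bool" where
  "BUC S f \<longleftrightarrow> bounded (f ` S) \<and> uniformly_continuous_on S f"

definition sym_matrices :: "(real^'d^'d) set" where
  "sym_matrices = {A. transpose A = A}"

definition loewner_le :: "real^'d^'d \<Rightarrow> real^'d^'d \<Rightarrow> bool" where
  "loewner_le A C \<longleftrightarrow> (\<forall>\<xi>. \<xi> \<bullet> (A *v \<xi>) \<le> \<xi> \<bullet> (C *v \<xi>))"

definition degenerate_elliptic :: "(real^'d^'d \<Rightarrow> real^'d \<Rightarrow> real) \<Rightarrow> bool" where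
  "degenerate_elliptic F \<longleftrightarrow>
     (\<forall>A\<in>sym_matrices. \<forall>C\<in>sym_matrices. \<forall>p. loewner_le A C \<longrightarrow> F A p \<le> F C p)"

text \<open>The characteristics of \<open>d\<Phi> = \<Sum>\<^sub>i H\<^sup>i(D\<Phi>) \<cdot> dB\<^sub>i\<close> started from \<open>\<phi>\<close> at time
  \<open>t0\<close>, and the values of the solution transported along them.\<close>

definition char_X ::
  "(real^'d \<Rightarrow> real^'m) \<Rightarrow> (real \<Rightarrow> real^'m) \<Rightarrow> real \<Rightarrow> (real^'d \<Rightarrow> real) \<Rightarrow> real^'d \<Rightarrow> real \<Rightarrow> real^'d"
where
  "char_X H B t0 \<phi> x t =
     x - (\<Sum>i\<in>UNIV. (B t $ i - B t0 $ i) *\<^sub>R grad (\<lambda>p. H p $ i) (grad \<phi> x))"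

definition char_U ::
  "(real^'d \<Rightarrow> real^'m) \<Rightarrow> (real \<Rightarrow> real^'m) \<Rightarrow> real \<Rightarrow> (real^'d \<Rightarrow> real) \<Rightarrow> real^'d \<Rightarrow> real \<Rightarrow> real"
where
  "char_U H B t0 \<phi> x t =
     \<phi> x + (\<Sum>i\<in>UNIV.
        (H (grad \<phi> x) $ i - grad (\<lambda>p. H p $ i) (grad \<phi> x) \<bullet> grad \<phi> x) * (B t $ i - B t0 $ i))"

text \<open>The condition \<open>h \<le> t0\<close> keeps the time interval inside the domain \<open>[0,\<infinity>)\<close> of \<open>B\<close>. It does
  not affect the notions of sub- and supersolution below, because a smooth solution restricts to
  one with a smaller \<open>h\<close>. The values of \<open>\<Phi>\<close> outside the interval are irrelevant. That
  \<open>\<Phi>(\<cdot>,t)\<close> is of class \<open>C\<^sup>2\<close> is a consequence: its gradient at \<open>X(x,t)\<close> is \<open>D\<phi>(x)\<close>.\<close>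

definition smooth_solution ::
  "(real^'d \<Rightarrow> real^'m) \<Rightarrow> (real \<Rightarrow> real^'m) \<Rightarrow> real \<Rightarrow> real \<Rightarrow> ((real^'d) \<times> real \<Rightarrow> real) \<Rightarrow> bool"
where
  "smooth_solution H B t0 h \<Phi> \<longleftrightarrow> 0 < h \<and> h \<le> t0 \<and>
     (\<exists>\<phi>. C2_fun \<phi> \<and>
        (\<forall>t\<in>{t0-h<..<t0+h}.
           C1_diffeomorphism (\<lambda>x. char_X H B t0 \<phi> x t) \<and>
           (\<forall>x. \<Phi> (char_X H B t0 \<phi> x t, t) = char_U H B t0 \<phi> x t)))"

definition local_max_at :: "('a::topological_space \<Rightarrow> real) \<Rightarrow> 'a \<Rightarrow> bool" where
  "local_max_at f z \<longleftrightarrow> (\<forall>\<^sub>F y in nhds z. f y \<le> f z)"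

definition local_min_at :: "('a::topological_space \<Rightarrow> real) \<Rightarrow> 'a \<Rightarrow> bool" where
  "local_min_at f z \<longleftrightarrow> (\<forall>\<^sub>F y in nhds z. f z \<le> f y)"

definition pathwise_subsolution ::
  "(real^'d^'d \<Rightarrow> real^'d \<Rightarrow> real) \<Rightarrow> (real^'d \<Rightarrow> real^'m) \<Rightarrow> (real \<Rightarrow> real^'m)
     \<Rightarrow> ((real^'d) \<times> real \<Rightarrow> real) \<Rightarrow> bool"
where
  "pathwise_subsolution F H B u \<longleftrightarrow> BUC (UNIV \<times> {0..}) u \<and>
     (\<forall>\<psi> \<Phi> h x0 t0.
        \<psi> C1_differentiable_on {0<..} \<and> t0 > 0 \<and> smooth_solution H B t0 h \<Phi> \<and>
        local_max_at (\<lambda>(x, t). u (x, t) - \<Phi> (x, t) - \<psi> t) (x0, t0)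
        \<longrightarrow> deriv \<psi> t0 \<le> F (hess (\<lambda>x. \<Phi> (x, t0)) x0) (grad (\<lambda>x. \<Phi> (x, t0)) x0))"

definition pathwise_supersolution ::
  "(real^'d^'d \<Rightarrow> real^'d \<Rightarrow> real) \<Rightarrow> (real^'d \<Rightarrow> real^'m) \<Rightarrow> (real \<Rightarrow> real^'m)
     \<Rightarrow> ((real^'d) \<times> real \<Rightarrow> real) \<Rightarrow> bool"
where
  "pathwise_supersolution F H B v \<longleftrightarrow> BUC (UNIV \<times> {0..}) v \<and>
     (\<forall>\<psi> \<Phi> h x0 t0.
        \<psi> C1_differentiable_on {0<..} \<and> t0 > 0 \<and> smooth_solution H B t0 h \<Phi> \<and>
        local_min_at (\<lambda>(x, t). v (x, t) - \<Phi> (x, t) - \<psi> t) (x0, t0)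
        \<longrightarrow> deriv \<psi> t0 \<ge> F (hess (\<lambda>x. \<Phi> (x, t0)) x0) (grad (\<lambda>x. \<Phi> (x, t0)) x0))"

end

theory Submission imports Defs begin

text \<open>Take a near-maximum point of \<open>u(x,t) - v(y,t) - \<theta>(x - y) - \<mu> t\<close>, where \<open>\<theta>\<close> is quadratic near \<open>0\<close>. Near its
  time \<open>t0\<close> regularise \<open>u\<close> and \<open>- v\<close> by sup-convolutions in space and time whose spatial kernels
  \<open>\<Phi>(x - \<xi>, s)\<close> are themselves solutions of the noisy first-order equation, given by Legendre transforms of
  \<open>|p|\<^sup>2 / 2\<Lambda> - H(p) \<bullet> (B s - B t0)\<close> on a ball. The noise then cancels exactly between the two kernels, so that the sum
  of the regularised functions still has an approximate maximum, and both are semiconvex. Jensen's argument with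
  Rademacher's theorem provides a nearby point where both have second-order expansions, with almost
  opposite gradients and with Hessians of almost nonpositive sum. There the expansions give smooth solutions touching \<open>u\<close> and \<open>v\<close>;
  the two viscosity inequalities and the ellipticity and continuity of \<open>F\<close> contradict \<open>\<mu> > 0\<close>.\<close>

section \<open>Rademacher's theorem\<close>

text \<open>The obstacle is that \<open>B\<close> has no regularity in time: a penalisation of x - y
  cannot be differentiated in t, and smooth solutions last only while the increment of
  \<open>B\<close> is small. Both sup-convolutions are therefore taken at one common base point
  (\<xi>, t), the doubled variables x and y surviving only as convolution variables, and
  \<open>B\<close> is read at the time being convolved, so that the base time enters through a
  quadratic penalty alone. Restricting momenta to a ball replaces growth conditions on
  \<open>H\<close>. The order of the constants closes the argument: \<Lambda>, the momentum bound
  \<open>R\<close>, the time window \<open>h\<close> and the Jensen radius precede the error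
  \<kappa>, and the time penalty \<epsilon> comes last. This is consistent because Jensen's bounds
  do not see the semiconvexity constant, which contains 1 / \<epsilon>, and because the spatial
  Hessians are bounded below by - 2\<Lambda> whatever \<epsilon> is. Mere continuity of
  \<open>F\<close> on a compact set then suffices.\<close>

lemma negligible_UNION_countable:
  assumes "countable I" "\<And>i. i \<in> I \<Longrightarrow> negligible (A i)"
  shows "negligible (\<Union>i\<in>I. A i)"
  using assms by (auto simp: negligible_iff_null_sets intro: null_sets_UN')

text \<open>Vitali covering. Intervals around points of \<open>E\<close> with chord slope at most
  \<open>a\<close> are thinned to a countable disjoint family inside an open set barely larger than
  \<open>E\<close>; the images of its members have total length at most \<open>a\<close> times the
  measure of that set. The points that the family misses form a null set, and so does their image
  under a Lipschitz map.\<close>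

lemma emeasure_image_le_straddle:
  fixes G :: "real \<Rightarrow> real"
  assumes lip: "L-lipschitz_on UNIV G" and mono: "strict_mono G"
    and E: "E \<in> sets lebesgue" and a: "0 \<le> a"
    and str: "\<And>x d. x \<in> E \<Longrightarrow> 0 < d \<Longrightarrow>
      \<exists>c y. c < x \<and> x < y \<and> y - c < d \<and> G y - G c \<le> a * (y - c)"
  shows "emeasure lebesgue (G ` E) \<le> ennreal a * emeasure lebesgue E"
proof (rule ennreal_le_epsilon)
  fix e :: real assume "0 < e"
  define e' where "e' = e / (a + 1)"
  have e': "0 < e'" "a * e' \<le> e" using \<open>0 < e\<close> a by (auto simp: e'_def field_simps)
  obtain U where U: "open U" "E \<subseteq> U" "U - E \<in> lmeasurable" "emeasure lebesgue (U - E) < ennreal e'"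
    using sets_lebesgue_outer_open[OF E e'(1)] by blast
  define K where "K = {(c, y). c < y \<and> {c..y} \<subseteq> U \<and> G y - G c \<le> a * (y - c)}"
  \<comment> \<open>Midpoints and half-lengths present the intervals as balls, the shape that the
    covering theorem takes.\<close>
  define m where "m = (\<lambda>(c, y). (c + y) / 2 :: real)"
  define r where "r = (\<lambda>(c, y). (y - c) / 2 :: real)"
  have cb: "cball (m i) (r i) = {fst i..snd i}" for i
    by (cases i) (auto simp: m_def r_def cball_eq_atLeastAtMost field_simps)
  obtain C where C: "countable C" "C \<subseteq> K"
     "pairwise (\<lambda>i j. disjnt (cball (m i) (r i)) (cball (m j) (r j))) C"
     "negligible (E - (\<Union>i \<in> C. cball (m i) (r i)))"
  proof (rule Vitali_covering_theorem_cballs[of K r E m])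
    show "0 < r i" if "i \<in> K" for i using that by (auto simp: K_def r_def)
    fix x d :: real assume x: "x \<in> E" and d: "0 < d"
    obtain t where t: "0 < t" "ball x t \<subseteq> U" using U(1,2) x open_contains_ball by blast
    obtain c y where cy: "c < x" "x < y" "y - c < min d t" "G y - G c \<le> a * (y - c)"
      using str[OF x, of "min d t"] d t by auto
    have "{c..y} \<subseteq> ball x t" using cy by (auto simp: dist_real_def)
    then have "(c, y) \<in> K" using cy t by (auto simp: K_def)
    moreover have "x \<in> cball (m (c,y)) (r (c,y))" unfolding cb using cy by auto
    moreover have "r (c,y) < d" using cy d by (auto simp: r_def)
    ultimately show "\<exists>i. i \<in> K \<and> x \<in> cball (m i) (r i) \<and> r i < d" by blast
  qed blast
  have pw: "disjoint_family_on (\<lambda>i. {fst i..snd i}) C"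
    using C(3) unfolding cb pairwise_def disjoint_family_on_def disjnt_def by auto
  have contG: "continuous_on S G" for S
    using lip lipschitz_on_continuous_on continuous_on_subset subset_UNIV by blast
  have img: "G ` {c..y} = {G c..G y}" if "c \<le> y" for c y
  proof
    show "G ` {c..y} \<subseteq> {G c..G y}" using strict_mono_less_eq[OF mono] by auto
    show "{G c..G y} \<subseteq> G ` {c..y}"
    proof
      fix w assume "w \<in> {G c..G y}"
      then show "w \<in> G ` {c..y}" using IVT'[of G c w y] that contG by auto
    qed
  qed
  have C': "fst i < snd i" "{fst i..snd i} \<subseteq> U" "G (snd i) - G (fst i) \<le> a * (snd i - fst i)" if "i \<in> C" for i
  proof -
    have "i \<in> K" using that C(2) by blast
    then have "fst i < snd i \<and> {fst i..snd i} \<subseteq> U \<and> G (snd i) - G (fst i) \<le> a * (snd i - fst i)"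
      unfolding K_def by (simp add: case_prod_unfold)
    then show "fst i < snd i" "{fst i..snd i} \<subseteq> U" "G (snd i) - G (fst i) \<le> a * (snd i - fst i)" by auto
  qed
  have pw': "disjoint_family_on (\<lambda>i. {G (fst i)..G (snd i)}) C"
  proof -
    have "{G (fst i)..G (snd i)} \<inter> {G (fst j)..G (snd j)} = {}" if "i \<in> C" "j \<in> C" "i \<noteq> j" for i j
    proof -
      have "{fst i..snd i} \<inter> {fst j..snd j} = {}"
        using pw that unfolding disjoint_family_on_def by blast
      then have "G ` {fst i..snd i} \<inter> G ` {fst j..snd j} = {}"
        using image_Int[OF strict_mono_imp_inj_on[OF mono], of "{fst i..snd i}" "{fst j..snd j}"] by simp
      then show ?thesis using img[of "fst i" "snd i"] img[of "fst j" "snd j"] C'(1)[of i] C'(1)[of j] that by simp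
    qed
    then show ?thesis by (auto simp: disjoint_family_on_def)
  qed
  have neg: "negligible (G ` (E - (\<Union>i \<in> C. {fst i..snd i})))"
    using C(4) unfolding cb
    by (rule negligible_locally_Lipschitz_image[rotated])
      (use lip in \<open>auto simp: lipschitz_on_def dist_norm norm_minus_commute intro!: exI[of _ UNIV] exI[of _ L]\<close>)
  have sub: "G ` E \<subseteq> (\<Union>i\<in>C. {G (fst i)..G (snd i)}) \<union> G ` (E - (\<Union>i \<in> C. {fst i..snd i}))"
  proof
    fix w assume "w \<in> G ` E"
    then obtain x where x: "x \<in> E" "w = G x" by auto
    show "w \<in> (\<Union>i\<in>C. {G (fst i)..G (snd i)}) \<union> G ` (E - (\<Union>i \<in> C. {fst i..snd i}))"
    proof (cases "x \<in> (\<Union>i \<in> C. {fst i..snd i})")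
      case True
      then obtain i where "i \<in> C" "x \<in> {fst i..snd i}" by auto
      then have "w \<in> {G (fst i)..G (snd i)}" using x strict_mono_less_eq[OF mono] by auto
      then show ?thesis using \<open>i \<in> C\<close> by blast
    qed (use x in auto)
  qed
  have meas: "(\<Union>i\<in>C. {G (fst i)..G (snd i)}) \<in> sets lebesgue" "(\<Union>i\<in>C. {fst i..snd i}) \<in> sets lebesgue"
    using C(1) by (auto intro!: sets.countable_UN'')
  have "emeasure lebesgue (G ` E) \<le> emeasure lebesgue ((\<Union>i\<in>C. {G (fst i)..G (snd i)}) \<union> G ` (E - (\<Union>i \<in> C. {fst i..snd i})))"
    by (rule emeasure_mono[OF sub]) (use meas neg negligible_imp_sets in auto)
  also have "\<dots> \<le> emeasure lebesgue (\<Union>i\<in>C. {G (fst i)..G (snd i)}) + emeasure lebesgue (G ` (E - (\<Union>i \<in> C. {fst i..snd i})))"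
    using meas neg negligible_imp_sets by (intro emeasure_subadditive) auto
  also have "emeasure lebesgue (G ` (E - (\<Union>i \<in> C. {fst i..snd i}))) = 0"
    using neg negligible_iff_null_sets by blast
  also have "emeasure lebesgue (\<Union>i\<in>C. {G (fst i)..G (snd i)}) = (\<integral>\<^sup>+ i. emeasure lebesgue {G (fst i)..G (snd i)} \<partial>count_space C)"
    by (rule emeasure_UN_countable) (use C(1) pw' in auto)
  also have "\<dots> \<le> (\<integral>\<^sup>+ i. ennreal a * emeasure lebesgue {fst i..snd i} \<partial>count_space C)"
  proof (rule nn_integral_mono)
    fix i assume "i \<in> space (count_space C)"
    then have i: "i \<in> C" by simp
    have "G (fst i) \<le> G (snd i)" using C'(1)[OF i] strict_mono_less_eq[OF mono] by auto
    then show "emeasure lebesgue {G (fst i)..G (snd i)} \<le> ennreal a * emeasure lebesgue {fst i..snd i}"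
      using C'[OF i] a by (auto simp: ennreal_mult[symmetric] intro!: ennreal_leI)
  qed
  also have "\<dots> = ennreal a * (\<integral>\<^sup>+ i. emeasure lebesgue {fst i..snd i} \<partial>count_space C)"
    by (rule nn_integral_cmult) auto
  also have "(\<integral>\<^sup>+ i. emeasure lebesgue {fst i..snd i} \<partial>count_space C) = emeasure lebesgue (\<Union>i\<in>C. {fst i..snd i})"
    by (rule emeasure_UN_countable[symmetric]) (use C(1) pw in auto)
  also have "\<dots> \<le> emeasure lebesgue U"
    using U(1) C'(2) by (intro emeasure_mono) auto
  also have "\<dots> \<le> emeasure lebesgue (E \<union> (U - E))"
    using E U by (intro emeasure_mono) auto
  also have "\<dots> \<le> emeasure lebesgue E + emeasure lebesgue (U - E)"
    using E U by (intro emeasure_subadditive) auto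
  also have "\<dots> \<le> emeasure lebesgue E + ennreal e'" using U(4) by (intro add_left_mono) auto
  finally have "emeasure lebesgue (G ` E) \<le> ennreal a * (emeasure lebesgue E + ennreal e')"
    by (simp add: mult_left_mono)
  also have "\<dots> = ennreal a * emeasure lebesgue E + ennreal (a * e')"
    using a e' by (simp add: distrib_left ennreal_mult)
  also have "\<dots> \<le> ennreal a * emeasure lebesgue E + ennreal e"
    using e' by (intro add_left_mono ennreal_leI) auto
  finally show "emeasure lebesgue (G ` E) \<le> ennreal a * emeasure lebesgue E + ennreal e" .
qed

text \<open>The hypothesis only speaks of intervals with \<open>x\<close> strictly inside; letting
  one endpoint tend to \<open>x\<close> recovers the one-sided quotients by continuity.\<close>

lemma differentiable_if_straddle_quotients_converge:
  fixes G :: "real \<Rightarrow> real"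
  assumes cont: "continuous_on UNIV G"
    and lo: "\<And>e. 0 < e \<Longrightarrow> \<exists>d>0. \<forall>c y. c < x \<and> x < y \<and> y - c < d \<longrightarrow> \<bar>G y - G c - l * (y - c)\<bar> \<le> e * (y - c)"
  shows "(G has_field_derivative l) (at x)"
  unfolding has_field_derivative_def has_derivative_at_alt
proof (intro conjI allI impI)
  show "bounded_linear ((*) l)" by (rule bounded_linear_mult_right)
  fix e :: real assume "0 < e"
  then obtain d where d: "d > 0"
    "\<And>c y. c < x \<and> x < y \<and> y - c < d \<Longrightarrow> \<bar>G y - G c - l * (y - c)\<bar> \<le> e * (y - c)" using lo by meson
  have isc: "isCont G z" for z using cont by (simp add: continuous_on_eq_continuous_at)
  have "norm (G y - G x - l * (y - x)) \<le> e * norm (y - x)" if y: "norm (y - x) < d" for y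
  proof -
    consider "y = x" | "x < y" | "y < x" by linarith
    then show ?thesis
    proof cases
      case 1 then show ?thesis by simp
    next
      case 2
      have "\<bar>G y - G x - l * (y - x)\<bar> \<le> e * (y - x)"
      proof (rule tendsto_le[OF trivial_limit_at_left_real])
        show "((\<lambda>c. e * (y - c)) \<longlongrightarrow> e * (y - x)) (at_left x)" by (intro tendsto_intros)
        show "((\<lambda>c. \<bar>G y - G c - l * (y - c)\<bar>) \<longlongrightarrow> \<bar>G y - G x - l * (y - x)\<bar>) (at_left x)"
          using isc[of x] by (intro tendsto_intros) (auto simp: isCont_def filterlim_at_split)
        show "\<forall>\<^sub>F c in at_left x. \<bar>G y - G c - l * (y - c)\<bar> \<le> e * (y - c)"
          using eventually_at_left_real[of "y - d" x] y 2
          by (auto elim!: eventually_mono intro!: d(2))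
      qed
      then show ?thesis using 2 by (simp add: norm_mult)
    next
      case 3
      have "\<bar>G x - G y - l * (x - y)\<bar> \<le> e * (x - y)"
      proof (rule tendsto_le[OF trivial_limit_at_right_real])
        show "((\<lambda>c. e * (c - y)) \<longlongrightarrow> e * (x - y)) (at_right x)" by (intro tendsto_intros)
        show "((\<lambda>c. \<bar>G c - G y - l * (c - y)\<bar>) \<longlongrightarrow> \<bar>G x - G y - l * (x - y)\<bar>) (at_right x)"
          using isc[of x] by (intro tendsto_intros) (auto simp: isCont_def filterlim_at_split)
        show "\<forall>\<^sub>F c in at_right x. \<bar>G c - G y - l * (c - y)\<bar> \<le> e * (c - y)"
          using eventually_at_right_real[of x "y + d"] y 3
          by (auto elim!: eventually_mono intro!: d(2))
      qed
      then show ?thesis using 3 by (simp add: abs_real_def algebra_simps split: if_splits)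
    qed
  qed
  then show "\<exists>d>0. \<forall>y. norm (y - x) < d \<longrightarrow> norm (G y - G x - l * (y - x)) \<le> e * norm (y - x)"
    using d(1) by blast
qed

text \<open>The covering estimate is used in both directions: on a bounded part E of the set,
  \<open>G\<close> scales the measure by at most \<open>a\<close>, and its inverse takes the image
  back with a factor at most 1/b. Hence the measure of E is at most a/b times itself, and being
  finite it vanishes. The lower slope bound \<open>L\<close> makes the inverse Lipschitz.\<close>

lemma negligible_straddle_gap:
  fixes G :: "real \<Rightarrow> real"
  assumes lip: "M-lipschitz_on UNIV G" and L: "0 < L"
    and low: "\<And>x y. x \<le> y \<Longrightarrow> L * (y - x) \<le> G y - G x" and ab: "0 < a" "a < b"
  defines "lo \<equiv> {x. \<forall>d>0. \<exists>c y. c < x \<and> x < y \<and> y - c < d \<and> G y - G c < a * (y - c)}"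
    and "up \<equiv> {x. \<forall>d>0. \<exists>c y. c < x \<and> x < y \<and> y - c < d \<and> G y - G c > b * (y - c)}"
  shows "negligible (lo \<inter> up)"
proof -
  have mono: "strict_mono G"
  proof (rule strict_monoI)
    fix x y :: real assume "x < y"
    then have "0 < L * (y - x)" using L by simp
    then show "G x < G y" using low[of x y] \<open>x < y\<close> by linarith
  qed
  have contG: "continuous_on UNIV G" using lip lipschitz_on_continuous_on by blast
  have M: "0 \<le> M" using lip by (simp add: lipschitz_on_def)
  have GM: "\<bar>G y - G x\<bar> \<le> M * \<bar>y - x\<bar>" for x y
    using lip by (auto simp: lipschitz_on_def dist_real_def)
  have surj: "surj G"
  proof -
    have "\<exists>x. G x = w" for w
    proof -
      define t where "t = (\<bar>w\<bar> + \<bar>G 0\<bar>) / L"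
      have "t \<ge> 0" using L by (simp add: t_def)
      have Lt: "L * t = \<bar>w\<bar> + \<bar>G 0\<bar>" using L by (simp add: t_def)
      have "G (-t) \<le> w" "w \<le> G t" using low[of 0 t] low[of "-t" 0] \<open>t \<ge> 0\<close> Lt by auto
      then show ?thesis using IVT'[of G "-t" w t] continuous_on_subset[OF contG] \<open>t \<ge> 0\<close> by auto
    qed
    then show ?thesis by (metis surjI)
  qed
  have inj: "inj G" using mono strict_mono_imp_inj_on by blast
  define J where "J = inv G"
  have JG: "J (G x) = x" for x using inj by (simp add: J_def)
  have GJ: "G (J w) = w" for w using surj by (simp add: J_def surj_f_inv_f)
  have Jmono: "strict_mono J"
  proof (rule strict_monoI)
    fix x y :: real assume "x < y"
    then show "J x < J y" using strict_mono_less[OF mono, of "J x" "J y"] GJ by simp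
  qed
  have lipJ: "(1/L)-lipschitz_on UNIV J"
  proof (rule lipschitz_onI)
    have *: "L * (y - x) \<le> \<bar>G y - G x\<bar>" for x y
    proof (cases "x \<le> y")
      case False
      then have "L * (y - x) \<le> 0" using L by (simp add: mult_nonneg_nonpos)
      then show ?thesis by linarith
    qed (use low[of x y] in auto)
    fix x y :: real
    have "L * \<bar>J x - J y\<bar> \<le> \<bar>x - y\<bar>"
      using *[of "J x" "J y"] *[of "J y" "J x"] GJ by (auto simp: abs_real_def split: if_splits)
    then show "dist (J x) (J y) \<le> 1 / L * dist x y"
      using L by (auto simp: dist_real_def field_simps)
  qed (use L in auto)
  \<comment> \<open>Two-sided intervals pay off here: for fixed endpoints the condition on
    \<open>x\<close> is membership in an open interval, so \<open>lo\<close> and \<open>up\<close>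
    are countable intersections of open sets, hence Borel.\<close>
  have Gd: "lo = (\<Inter>n::nat. \<Union>{{c<..<y} | c y. y - c < 1 / real (Suc n) \<and> G y - G c < a * (y - c)})"
  proof -
    have "(\<forall>d>0. \<exists>c y. c < x \<and> x < y \<and> y - c < d \<and> G y - G c < a * (y - c)) \<longleftrightarrow>
      (\<forall>n. \<exists>c y. c < x \<and> x < y \<and> y - c < 1 / real (Suc n) \<and> G y - G c < a * (y - c))" for x
    proof (intro iffI allI impI)
      fix d :: real assume A: "\<forall>n. \<exists>c y. c < x \<and> x < y \<and> y - c < 1 / real (Suc n) \<and> G y - G c < a * (y - c)" and "0 < d"
      obtain n where "1 / real (Suc n) < d" using \<open>0 < d\<close> nat_approx_posE by blast
      then show "\<exists>c y. c < x \<and> x < y \<and> y - c < d \<and> G y - G c < a * (y - c)" using A less_trans by meson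
    qed simp
    then show ?thesis unfolding lo_def by (auto simp: set_eq_iff) (metis greaterThanLessThan_iff)+
  qed
  have Gd': "up = (\<Inter>n::nat. \<Union>{{c<..<y} | c y. y - c < 1 / real (Suc n) \<and> G y - G c > b * (y - c)})"
  proof -
    have "(\<forall>d>0. \<exists>c y. c < x \<and> x < y \<and> y - c < d \<and> G y - G c > b * (y - c)) \<longleftrightarrow>
      (\<forall>n. \<exists>c y. c < x \<and> x < y \<and> y - c < 1 / real (Suc n) \<and> G y - G c > b * (y - c))" for x
    proof (intro iffI allI impI)
      fix d :: real assume A: "\<forall>n. \<exists>c y. c < x \<and> x < y \<and> y - c < 1 / real (Suc n) \<and> G y - G c > b * (y - c)" and "0 < d"
      obtain n where "1 / real (Suc n) < d" using \<open>0 < d\<close> nat_approx_posE by blast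
      then show "\<exists>c y. c < x \<and> x < y \<and> y - c < d \<and> G y - G c > b * (y - c)" using A less_trans by meson
    qed simp
    then show ?thesis unfolding up_def by (auto simp: set_eq_iff) (metis greaterThanLessThan_iff)+
  qed
  have bor: "lo \<in> sets borel" "up \<in> sets borel"
  proof -
    have "(\<Inter>n. U n) \<in> sets borel" if "\<And>n. open (U n)" for U :: "nat \<Rightarrow> real set"
      using that by (intro sets.countable_INT'') auto
    then show "lo \<in> sets borel" "up \<in> sets borel"
      unfolding Gd Gd' by (smt (verit, ccfv_SIG) mem_Collect_eq open_Union open_greaterThanLessThan)+
  qed
  have "negligible (lo \<inter> up \<inter> {-k<..<k})" for k :: real
  proof -
    define E where "E = lo \<inter> up \<inter> {-k<..<k}"
    have Eb: "E \<in> sets borel" using bor by (auto simp: E_def)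
    have El: "E \<in> sets lebesgue" using Eb by auto
    have GE: "G ` E = J -` E" using JG GJ by (auto simp: image_iff) (metis GJ)
    have "J \<in> borel_measurable borel" using lipJ lipschitz_on_continuous_on borel_measurable_continuous_onI by blast
    then have GEb: "G ` E \<in> sets borel" unfolding GE using Eb measurable_sets_borel by blast
    have 1: "emeasure lebesgue (G ` E) \<le> ennreal a * emeasure lebesgue E"
      using ab by (intro emeasure_image_le_straddle[OF lip mono El]) (auto simp: E_def lo_def intro: less_imp_le, meson less_imp_le)
    have 2: "emeasure lebesgue (J ` (G ` E)) \<le> ennreal (1 / b) * emeasure lebesgue (G ` E)"
    proof (rule emeasure_image_le_straddle[OF lipJ Jmono])
      show "G ` E \<in> sets lebesgue" using GEb by auto
      show "0 \<le> 1 / b" using ab by simp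
      fix w d :: real assume w: "w \<in> G ` E" and d: "0 < d"
      then obtain x where x: "x \<in> E" "w = G x" by auto
      \<comment> \<open>\<open>G\<close> stretches lengths by at most \<open>M\<close>, so intervals
        this short have images shorter than \<open>d\<close>; the added 1 covers
        \<open>M = 0\<close>.\<close>
      obtain c y where cy: "c < x" "x < y" "y - c < d / (M + 1)" "G y - G c > b * (y - c)"
        using x(1) d M unfolding E_def up_def by (auto dest!: spec[of _ "d / (M + 1)"])
      have "G y - G c \<le> M * (y - c)" using GM[of y c] cy by auto
      also have "\<dots> \<le> (M + 1) * (y - c)" using cy by (intro mult_right_mono) auto
      also have "\<dots> < d" using cy(3) M by (auto simp: field_simps)
      finally have "G y - G c < d" .
      moreover have "G c < w" "w < G y" using x cy mono by (auto simp: strict_mono_less)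
      moreover have "J (G y) - J (G c) \<le> 1 / b * (G y - G c)"
        using cy(4) ab by (simp add: JG field_simps)
      ultimately show "\<exists>c y. c < w \<and> w < y \<and> y - c < d \<and> J y - J c \<le> 1 / b * (y - c)" by blast
    qed
    have JGE: "J ` (G ` E) = E" by (auto simp: JG image_iff)
    have fin: "emeasure lebesgue E < \<infinity>"
    proof -
      have "emeasure lebesgue E \<le> emeasure lebesgue {-k<..<k}" by (intro emeasure_mono) (auto simp: E_def)
      also have "\<dots> < \<infinity>" by (simp add: emeasure_lborel_Ioo)  (cases "-k \<le> k", auto)
      finally show ?thesis .
    qed
    then obtain m where m: "emeasure lebesgue E = ennreal m" "0 \<le> m" by (cases "emeasure lebesgue E") auto
    have "ennreal m \<le> ennreal (1 / b) * (ennreal a * ennreal m)"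
      using order_trans[OF 2 mult_left_mono[OF 1]] JGE m by simp
    also have "\<dots> = ennreal (1 / b * (a * m))" using ab m by (simp only: ennreal_mult mult_nonneg_nonneg divide_nonneg_nonneg less_imp_le zero_le_one)
    finally have "m \<le> 1 / b * (a * m)" using ab m by (subst (asm) ennreal_le_iff) auto
    then have "b * m \<le> a * m" using ab by (simp add: field_simps)
    then have "m = 0" using ab m(2) by (metis less_eq_real_def linorder_not_le mult_le_cancel_right)
    then have "emeasure lebesgue E = 0" using m by simp
    then show ?thesis using El negligible_iff_emeasure0 E_def by blast
  qed
  then have "negligible (\<Union>n::nat. lo \<inter> up \<inter> {-real n<..<real n})" by (intro negligible_Union_nat)
  moreover have "lo \<inter> up \<subseteq> (\<Union>n::nat. lo \<inter> up \<inter> {-real n<..<real n})"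
  proof
    fix x assume x: "x \<in> lo \<inter> up"
    obtain n where "\<bar>x\<bar> < real n" using reals_Archimedean2 by blast
    then show "x \<in> (\<Union>n::nat. lo \<inter> up \<inter> {-real n<..<real n})" using x by (auto simp: abs_less_iff intro!: exI[of _ n])
  qed
  ultimately show ?thesis using negligible_subset by blast
qed

lemma lipschitz_real_differentiable_ae:
  fixes F :: "real \<Rightarrow> real"
  assumes lip: "L-lipschitz_on UNIV F"
  shows "negligible {x. \<not> F differentiable (at x)}"
proof -
  define M where "M = L + 1"
  have M: "0 < M" "L \<le> M" using lip by (auto simp: M_def lipschitz_on_def)
  \<comment> \<open>The extra slope puts all chord slopes of \<open>G\<close> between
    \<open>M\<close> and \<open>3 * M\<close>, so that \<open>G\<close> has a Lipschitz inverse;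
    differentiability is unaffected.\<close>
  define G where "G x = F x + 2 * M * x" for x
  have FM: "\<bar>F y - F x\<bar> \<le> M * \<bar>y - x\<bar>" for x y
    using lipschitz_on_mono[OF lip order_refl M(2)] by (auto simp: lipschitz_on_def dist_real_def)
  have low: "M * (y - x) \<le> G y - G x" and upp: "G y - G x \<le> 3 * M * (y - x)" if "x \<le> y" for x y
    using FM[of y x] that by (auto simp: G_def algebra_simps abs_le_iff)
  have lipG: "(3 * M)-lipschitz_on UNIV G"
  proof (rule lipschitz_onI)
    fix x y
    have "\<bar>G x - G y\<bar> \<le> \<bar>F x - F y\<bar> + 2 * M * \<bar>x - y\<bar>"
    proof -
      have "\<bar>(F x - F y) + 2 * M * (x - y)\<bar> \<le> \<bar>F x - F y\<bar> + \<bar>2 * M * (x - y)\<bar>" by (rule abs_triangle_ineq)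
      also have "\<bar>2 * M * (x - y)\<bar> = 2 * M * \<bar>x - y\<bar>" using M by (simp add: abs_mult)
      finally show ?thesis by (simp add: G_def algebra_simps)
    qed
    also have "\<dots> \<le> 3 * M * \<bar>x - y\<bar>" using FM[of x y] by simp
    finally show "dist (G x) (G y) \<le> 3 * M * dist x y" by (simp add: dist_real_def)
  qed (use M in auto)
  define lo where "lo a = {x. \<forall>d>0. \<exists>c y. c < x \<and> x < y \<and> y - c < d \<and> G y - G c < a * (y - c)}" for a
  define up where "up b = {x. \<forall>d>0. \<exists>c y. c < x \<and> x < y \<and> y - c < d \<and> G y - G c > b * (y - c)}" for b
  have "negligible (\<Union>p\<in>{p\<in>\<rat> \<times> \<rat>. 0 < fst p \<and> fst p < snd p}. lo (fst p) \<inter> up (snd p))"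
    using negligible_straddle_gap[OF lipG M(1) low]
  proof (intro negligible_UNION_countable)
    show "countable {p \<in> \<rat> \<times> \<rat> :: (real \<times> real) set. 0 < fst p \<and> fst p < snd p}"
      using countable_rat by (intro countable_Collect) auto
  qed (simp add: lo_def up_def)
  moreover have "{x. \<not> F differentiable (at x)} \<subseteq> (\<Union>p\<in>{p\<in>\<rat> \<times> \<rat>. 0 < fst p \<and> fst p < snd p}. lo (fst p) \<inter> up (snd p))"
  proof (intro subsetI, rule ccontr)
    fix x assume nd: "x \<in> {x. \<not> F differentiable (at x)}"
      and "x \<notin> (\<Union>p\<in>{p\<in>\<rat> \<times> \<rat>. 0 < fst p \<and> fst p < snd p}. lo (fst p) \<inter> up (snd p))"
    then have no: "\<not> (x \<in> lo a \<and> x \<in> up b)" if "a \<in> \<rat>" "b \<in> \<rat>" "0 < a" "a < b" for a b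
      using that by force
    \<comment> \<open>The infimum of \<open>S\<close> is the lower limit of the chord slopes at
      \<open>x\<close>. Outside the exceptional set no pair of rationals separates it from the upper
      limit, so it is the derivative.\<close>
    define S where "S = {a. x \<in> lo a}"
    have mem: "3 * M + 1 \<in> S"
    proof -
      have "\<exists>c y. c < x \<and> x < y \<and> y - c < d \<and> G y - G c < (3 * M + 1) * (y - c)" if "0 < d" for d
      proof (intro exI conjI)
        show "G (x + d / 3) - G (x - d / 3) < (3 * M + 1) * (x + d / 3 - (x - d / 3))"
          using upp[of "x - d / 3" "x + d / 3"] that by (simp add: algebra_simps)
      qed (use that in auto)
      then show ?thesis by (auto simp: S_def lo_def)
    qed
    have bd: "M \<le> a" if aS: "a \<in> S" for a
    proof (rule ccontr)
      assume "\<not> M \<le> a"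
      obtain c y where "c < x" "x < y" "G y - G c < a * (y - c)"
        using aS unfolding S_def lo_def using zero_less_one by blast
      moreover have "a * (y - c) \<le> M * (y - c)" using calculation \<open>\<not> M \<le> a\<close> by (intro mult_right_mono) auto
      ultimately show False using low[of c y] by linarith
    qed
    define l where "l = Inf S"
    have lb: "bdd_below S" using bd by (auto simp: bdd_below_def)
    have lM: "M \<le> l" unfolding l_def using mem bd by (intro cInf_greatest) auto
    have mono: "a' \<in> S" if "a \<in> S" "a \<le> a'" for a a'
    proof -
      have "\<exists>c y. c < x \<and> x < y \<and> y - c < d \<and> G y - G c < a' * (y - c)" if d: "0 < d" for d
      proof -
        obtain c y where cy: "c < x" "x < y" "y - c < d" "G y - G c < a * (y - c)"
          using \<open>a \<in> S\<close> d by (auto simp: S_def lo_def)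
        have "a * (y - c) \<le> a' * (y - c)" using cy \<open>a \<le> a'\<close> by (intro mult_right_mono) auto
        then have "G y - G c < a' * (y - c)" using cy(4) by linarith
        then show ?thesis using cy by blast
      qed
      then show ?thesis by (simp add: S_def lo_def)
    qed
    have conv: "\<exists>d>0. \<forall>c y. c < x \<and> x < y \<and> y - c < d \<longrightarrow> \<bar>G y - G c - l * (y - c)\<bar> \<le> e * (y - c)" if e: "0 < e" for e
    proof -
      have "l - e \<notin> S"
        using cInf_lower[OF _ lb, of "l - e"] e by (auto simp: l_def)
      then obtain d1 where d1: "d1 > 0" "\<And>c y. c < x \<Longrightarrow> x < y \<Longrightarrow> y - c < d1 \<Longrightarrow> G y - G c \<ge> (l - e) * (y - c)"
        unfolding S_def lo_def by (auto simp: not_less) (metis linorder_not_le)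
      obtain a0 where "a0 \<in> S" "a0 < l + e/4"
        using cInf_lessD[of S "l + e/4"] mem e by (auto simp: l_def)
      obtain a where a: "a \<in> \<rat>" "l + e / 4 < a" "a < l + e / 2" using Rats_dense_in_real[of "l + e/4" "l + e/2"] e by auto
      obtain b where b: "b \<in> \<rat>" "l + e / 2 < b" "b < l + e" using Rats_dense_in_real[of "l + e/2" "l + e"] e by auto
      have "a \<in> S" using mono \<open>a0 \<in> S\<close> \<open>a0 < l + e/4\<close> a by auto
      then have "x \<notin> up b" using no[of a b] a b lM M e by (auto simp: S_def)
      then obtain d2 where d2: "d2 > 0" "\<And>c y. c < x \<Longrightarrow> x < y \<Longrightarrow> y - c < d2 \<Longrightarrow> G y - G c \<le> b * (y - c)"
        unfolding up_def by (auto simp: not_less) (metis linorder_not_le)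
      have "\<bar>G y - G c - l * (y - c)\<bar> \<le> e * (y - c)" if "c < x \<and> x < y \<and> y - c < min d1 d2" for c y
      proof -
        have "b * (y - c) \<le> (l + e) * (y - c)" using b that by (intro mult_right_mono) auto
        then show ?thesis using d1(2)[of c y] d2(2)[of c y] that by (auto simp: abs_le_iff algebra_simps)
      qed
      then show ?thesis using d1(1) d2(1) by (intro exI[of _ "min d1 d2"]) auto
    qed
    have "continuous_on UNIV G" using lipG lipschitz_on_continuous_on by blast
    then have "(G has_field_derivative l) (at x)"
      using differentiable_if_straddle_quotients_converge conv by blast
    then have "((\<lambda>x. G x - 2 * M * x) has_field_derivative (l - 2 * M)) (at x)"
      by (auto intro!: derivative_eq_intros)
    then have "F differentiable (at x)"
      unfolding G_def by (auto simp: real_differentiable_def)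
    then show False using nd by simp
  qed
  ultimately show ?thesis using negligible_subset by blast
qed

section \<open>Directional derivatives and the passage to several variables\<close>

lemma integrable_indicator_box_mult:
  fixes h :: "'a::euclidean_space \<Rightarrow> real"
  assumes "h \<in> borel_measurable borel" "\<And>z. \<bar>h z\<bar> \<le> c"
  shows "integrable lborel (\<lambda>z. indicator (box l u) z * h z)"
proof (rule Bochner_Integration.integrable_bound)
  show "integrable lborel (\<lambda>z. indicator (box l u) z * c)"
    by (intro integrable_mult_left integrable_real_indicator) (auto simp: emeasure_lborel_box_eq)
qed (use assms in \<open>auto simp: indicator_def intro!: AE_I2 intro: order_trans[OF _ abs_ge_self]\<close>)

text \<open>Scaled and shifted, \<open>g\<close> becomes a nonnegative density
  \<open>1 + g / c'\<close>. The measure with this density gives every box its volume, so it is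
  Lebesgue measure, and densities are unique almost everywhere.\<close>

lemma ae_zero_if_box_integrals_zero:
  fixes g :: "'a::euclidean_space \<Rightarrow> real"
  assumes g: "g \<in> borel_measurable borel" and bnd: "\<And>z. \<bar>g z\<bar> \<le> c"
    and box: "\<And>l u. (\<integral>z. indicator (box l u) z * g z \<partial>lborel) = 0"
  shows "AE z in lborel. g z = 0"
proof -
  define c' where "c' = \<bar>c\<bar> + 1"
  have c': "0 < c'" "\<And>z. \<bar>g z\<bar> \<le> c'" using bnd by (auto simp: c'_def) (metis abs_ge_self add_increasing2 order_trans zero_le_one)
  define d where "d z = ennreal (1 + g z / c')" for z
  have pos: "0 \<le> 1 + g z / c'" for z using c'(1) c'(2)[of z] by (simp add: field_simps abs_le_iff)
  have dm: "d \<in> borel_measurable lborel" using g unfolding d_def[abs_def] by measurable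
  have int: "integrable lborel (\<lambda>z. indicator (box l u) z * g z)" for l u
    using g c'(2) by (rule integrable_indicator_box_mult)
  have "lborel = density lborel d"
  proof (rule lborel_eqI)
    fix l u :: 'a assume lu: "\<And>b. b \<in> Basis \<Longrightarrow> l \<bullet> b \<le> u \<bullet> b"
    have i1: "integrable lborel (indicator (box l u) :: 'a \<Rightarrow> real)"
      by (intro integrable_real_indicator) (auto simp: emeasure_lborel_box_eq)
    have i2: "integrable lborel (\<lambda>z. indicator (box l u) z * (1 + g z / c'))"
      using Bochner_Integration.integrable_add[OF i1 integrable_divide_zero[OF int, of l u c']]
      by (simp add: distrib_left)
    have "emeasure (density lborel d) (box l u) = (\<integral>\<^sup>+z. d z * indicator (box l u) z \<partial>lborel)"
      using dm by (intro emeasure_density) auto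
    also have "\<dots> = (\<integral>\<^sup>+z. ennreal (indicator (box l u) z * (1 + g z / c')) \<partial>lborel)"
      using pos by (intro nn_integral_cong) (auto simp: d_def indicator_def)
    also have "\<dots> = ennreal (\<integral>z. indicator (box l u) z * (1 + g z / c') \<partial>lborel)"
      using pos by (intro nn_integral_eq_integral[OF i2]) auto
    also have "(\<integral>z. indicator (box l u) z * (1 + g z / c') \<partial>lborel)
       = (\<integral>z. indicator (box l u) z \<partial>lborel) + (\<integral>z. indicator (box l u) z * g z / c' \<partial>lborel)"
      using i1 int by (subst Bochner_Integration.integral_add[symmetric]) (auto simp: distrib_left)
    also have "\<dots> = measure lborel (box l u)" using box by simp
    finally show "emeasure (density lborel d) (box l u) = ennreal (\<Prod>b\<in>Basis. (u - l) \<bullet> b)"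
      using lu by (simp add: measure_lborel_box_eq)
  qed auto
  then have "density lborel (\<lambda>_. 1) = density lborel d" by (simp add: density_1)
  then have "AE z in lborel. 1 = d z"
    by (intro sigma_finite_measure.density_unique sigma_finite_lborel) (use dm in auto)
  then show ?thesis
  proof eventually_elim
    case (elim z)
    then have "1 + g z / c' = 1" using pos[of z] by (simp add: d_def ennreal_eq_1)
    then show ?case using c' by simp
  qed
qed

definition dir_diff :: "('a::euclidean_space \<Rightarrow> real) \<Rightarrow> 'a \<Rightarrow> 'a set" where
  "dir_diff F v = {z. \<exists>D. ((\<lambda>s. F (z + s *\<^sub>R v)) has_field_derivative D) (at 0)}"

definition dir_quot :: "('a::euclidean_space \<Rightarrow> real) \<Rightarrow> 'a \<Rightarrow> nat \<Rightarrow> 'a \<Rightarrow> real" where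
  "dir_quot F v n z = (F (z + (1 / real (Suc n)) *\<^sub>R v) - F z) * real (Suc n)"

text \<open>A limit along a single sequence is measurable in \<open>z\<close>, and the default 0 off
  \<open>dir_diff\<close> keeps the bound \<open>L * norm v\<close> valid at every point.\<close>

definition dir_deriv :: "('a::euclidean_space \<Rightarrow> real) \<Rightarrow> 'a \<Rightarrow> 'a \<Rightarrow> real" where
  "dir_deriv F v z = (if z \<in> dir_diff F v then lim (\<lambda>n. dir_quot F v n z) else 0)"

lemma dir_quot_tendsto:
  assumes "((\<lambda>s. F (z + s *\<^sub>R v)) has_field_derivative D) (at 0)"
  shows "(\<lambda>n. dir_quot F v n z) \<longlonglongrightarrow> D"
proof -
  have "((\<lambda>h. (F (z + h *\<^sub>R v) - F z) / h) \<longlongrightarrow> D) (at 0)"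
    using assms by (simp add: DERIV_def)
  moreover have "filterlim (\<lambda>n. 1 / real (Suc n)) (at 0) sequentially"
    using LIMSEQ_inverse_real_of_nat by (auto simp: filterlim_at divide_inverse)
  ultimately have "((\<lambda>n. (F (z + (1 / real (Suc n)) *\<^sub>R v) - F z) / (1 / real (Suc n))) \<longlongrightarrow> D) sequentially"
    by (rule filterlim_compose)
  then show ?thesis by (simp add: dir_quot_def)
qed

lemma dir_deriv_works:
  assumes "z \<in> dir_diff F v"
  shows "((\<lambda>s. F (z + s *\<^sub>R v)) has_field_derivative dir_deriv F v z) (at 0)"
    "(\<lambda>n. dir_quot F v n z) \<longlonglongrightarrow> dir_deriv F v z"
proof -
  obtain D where D: "((\<lambda>s. F (z + s *\<^sub>R v)) has_field_derivative D) (at 0)"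
    using assms by (auto simp: dir_diff_def)
  have "dir_deriv F v z = D" using dir_quot_tendsto[OF D] assms by (simp add: dir_deriv_def limI)
  then show "((\<lambda>s. F (z + s *\<^sub>R v)) has_field_derivative dir_deriv F v z) (at 0)"
    "(\<lambda>n. dir_quot F v n z) \<longlonglongrightarrow> dir_deriv F v z" using D dir_quot_tendsto[OF D] by auto
qed

text \<open>Phrased as a Cauchy condition, differentiability needs only countable quantifiers over
  \<open>k\<close> and \<open>n\<close> and, for each fixed pair of increments, a non-strict
  inequality. This makes \<open>dir_diff\<close> a countable combination of closed sets.\<close>

lemma has_field_derivative_iff_quot_Cauchy:
  fixes f :: "real \<Rightarrow> real"
  shows "(\<exists>D. (f has_field_derivative D) (at 0)) \<longleftrightarrow>
    (\<forall>k::nat. \<exists>n::nat. \<forall>h h'. h \<noteq> 0 \<and> h' \<noteq> 0 \<and> \<bar>h\<bar> < 1 / real (Suc n) \<and> \<bar>h'\<bar> < 1 / real (Suc n) \<longrightarrow>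
      \<bar>(f h - f 0) / h - (f h' - f 0) / h'\<bar> \<le> 1 / real (Suc k))" (is "?L \<longleftrightarrow> ?R")
proof
  assume ?L
  then obtain D where D: "((\<lambda>h. (f h - f 0) / h) \<longlongrightarrow> D) (at 0)" by (auto simp: DERIV_def)
  show ?R
  proof
    fix k :: nat
    obtain d where d: "0 < d" "\<And>h. h \<noteq> 0 \<Longrightarrow> \<bar>h\<bar> < d \<Longrightarrow> \<bar>(f h - f 0) / h - D\<bar> < 1 / real (Suc k) / 2"
      using LIM_D[OF D, of "1 / real (Suc k) / 2"] by auto
    obtain n where n: "1 / real (Suc n) < d" using d(1) nat_approx_posE by blast
    show "\<exists>n. \<forall>h h'. h \<noteq> 0 \<and> h' \<noteq> 0 \<and> \<bar>h\<bar> < 1 / real (Suc n) \<and> \<bar>h'\<bar> < 1 / real (Suc n) \<longrightarrow>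
      \<bar>(f h - f 0) / h - (f h' - f 0) / h'\<bar> \<le> 1 / real (Suc k)"
    proof (intro exI[of _ n] allI impI)
      fix h h' :: real assume hh: "h \<noteq> 0 \<and> h' \<noteq> 0 \<and> \<bar>h\<bar> < 1 / real (Suc n) \<and> \<bar>h'\<bar> < 1 / real (Suc n)"
      have "\<bar>a - D\<bar> < r / 2 \<Longrightarrow> \<bar>b - D\<bar> < r / 2 \<Longrightarrow> \<bar>a - b\<bar> \<le> r" for a b r :: real by linarith
      moreover have "\<bar>h\<bar> < d" "\<bar>h'\<bar> < d" using hh n by auto
      ultimately show "\<bar>(f h - f 0) / h - (f h' - f 0) / h'\<bar> \<le> 1 / real (Suc k)"
        using d(2)[of h] d(2)[of h'] hh by blast
    qed
  qed
next
  assume R: ?R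
  define q where "q h = (f h - f 0) / h" for h
  \<comment> \<open>The second \<open>Suc\<close> keeps the increments of index m >= n strictly
    below \<open>1 / real (Suc n)\<close>, as the Cauchy condition requires.\<close>
  define a where "a n = q (1 / real (Suc (Suc n)))" for n
  have small: "\<bar>1 / real (Suc (Suc m))\<bar> < 1 / real (Suc n)" if "n \<le> m" for n m
    using that by (simp add: field_simps)
  have "Cauchy a"
  proof (rule metric_CauchyI)
    fix e :: real assume "0 < e"
    obtain k where k: "1 / real (Suc k) < e" using \<open>0 < e\<close> nat_approx_posE by blast
    obtain n where n: "\<forall>h h'. h \<noteq> 0 \<and> h' \<noteq> 0 \<and> \<bar>h\<bar> < 1 / real (Suc n) \<and> \<bar>h'\<bar> < 1 / real (Suc n) \<longrightarrow>
      \<bar>q h - q h'\<bar> \<le> 1 / real (Suc k)" using R unfolding q_def by blast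
    have "dist (a i) (a j) < e" if "i \<ge> n" "j \<ge> n" for i j
    proof -
      have "\<bar>a i - a j\<bar> \<le> 1 / real (Suc k)" unfolding a_def
        by (rule n[rule_format]) (use small[OF that(1)] small[OF that(2)] in auto)
      then show ?thesis using k by (simp add: dist_real_def)
    qed
    then show "\<exists>M. \<forall>m\<ge>M. \<forall>n\<ge>M. dist (a m) (a n) < e" by blast
  qed
  then obtain D where D: "a \<longlonglongrightarrow> D" using Cauchy_convergent convergent_def by blast
  have "(q \<longlongrightarrow> D) (at 0)"
  proof (rule LIM_I)
    fix e :: real assume "0 < e"
    obtain k where k: "1 / real (Suc k) < e" using \<open>0 < e\<close> nat_approx_posE by blast
    obtain n where n: "\<forall>h h'. h \<noteq> 0 \<and> h' \<noteq> 0 \<and> \<bar>h\<bar> < 1 / real (Suc n) \<and> \<bar>h'\<bar> < 1 / real (Suc n) \<longrightarrow>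
      \<bar>q h - q h'\<bar> \<le> 1 / real (Suc k)" using R unfolding q_def by blast
    have "\<bar>q h - D\<bar> \<le> 1 / real (Suc k)" if h: "h \<noteq> 0" "\<bar>h\<bar> < 1 / real (Suc n)" for h
    proof (rule LIMSEQ_le_const2)
      show "(\<lambda>m. \<bar>q h - a m\<bar>) \<longlonglongrightarrow> \<bar>q h - D\<bar>" using D by (intro tendsto_intros)
      show "\<exists>N. \<forall>m\<ge>N. \<bar>q h - a m\<bar> \<le> 1 / real (Suc k)"
      proof (intro exI[of _ n] allI impI)
        fix m assume "n \<le> m"
        then show "\<bar>q h - a m\<bar> \<le> 1 / real (Suc k)" unfolding a_def
          by (intro n[rule_format]) (use h small[OF \<open>n \<le> m\<close>] in auto)
      qed
    qed
    then show "\<exists>s>0. \<forall>x. x \<noteq> 0 \<and> norm (x - 0) < s \<longrightarrow> norm (q x - D) < e"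
      using k by (intro exI[of _ "1 / real (Suc n)"]) (auto intro: le_less_trans)
  qed
  then show ?L unfolding q_def[abs_def] by (auto simp: DERIV_def)
qed

context
  fixes F :: "'a::euclidean_space \<Rightarrow> real" and L :: real
  assumes lip: "L-lipschitz_on UNIV F"
begin

lemma lipschitz_abs_diff_le: "\<bar>F x - F y\<bar> \<le> L * norm (x - y)"
  using lip by (auto simp: lipschitz_on_def dist_norm)

lemma lipschitz_continuous: "continuous_on S F"
  using lip lipschitz_on_continuous_on continuous_on_subset subset_UNIV by blast

lemma lipschitz_borel_measurable [measurable]: "F \<in> borel_measurable borel"
  using lipschitz_continuous borel_measurable_continuous_onI by blast

lemma dir_diff_borel: "dir_diff F v \<in> sets borel"
proof -
  have eq: "dir_diff F v = (\<Inter>k. \<Union>n. {z. \<forall>h h'. h \<noteq> 0 \<and> h' \<noteq> 0 \<and> \<bar>h\<bar> < 1 / real (Suc n) \<and> \<bar>h'\<bar> < 1 / real (Suc n) \<longrightarrow>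
      \<bar>(F (z + h *\<^sub>R v) - F z) / h - (F (z + h' *\<^sub>R v) - F z) / h'\<bar> \<le> 1 / real (Suc k)})"
    unfolding dir_diff_def has_field_derivative_iff_quot_Cauchy by simp blast
  have qc: "continuous_on UNIV (\<lambda>z. (F (z + h *\<^sub>R v) - F z) / h)" for h
    by (cases "h = 0") (auto intro!: continuous_intros continuous_on_compose2[OF lipschitz_continuous[of UNIV]])
  have cl: "closed {z. \<forall>h h'. h \<noteq> 0 \<and> h' \<noteq> 0 \<and> \<bar>h\<bar> < 1 / real (Suc n) \<and> \<bar>h'\<bar> < 1 / real (Suc n) \<longrightarrow>
      \<bar>(F (z + h *\<^sub>R v) - F z) / h - (F (z + h' *\<^sub>R v) - F z) / h'\<bar> \<le> 1 / real (Suc k)}" for n k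
    by (intro closed_Collect_all closed_Collect_imp open_Collect_const closed_Collect_le continuous_on_const
        continuous_on_rabs continuous_on_diff qc)
  show ?thesis unfolding eq using cl by (intro sets.countable_INT'' sets.countable_UN) auto
qed

text \<open>Fubini along lines: for every \<open>z\<close> the one-dimensional theorem makes
  \<open>z + s *\<^sub>R v\<close> good for almost every \<open>s\<close>. After exchanging the
  quantifiers, one fixed \<open>s\<close> is good for almost every \<open>z\<close>, and translation
  invariance removes this \<open>s\<close>.\<close>

lemma dir_diff_ae: "AE z in lborel. z \<in> dir_diff F v"
proof -
  define N where "N = - dir_diff F v"
  have N: "N \<in> sets borel" using dir_diff_borel by (auto simp: N_def)
  have m: "(\<lambda>p. snd p + fst p *\<^sub>R v) \<in> borel_measurable (borel \<Otimes>\<^sub>M borel :: (real \<times> 'a) measure)"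
    by measurable
  have "AE s in lborel. z + s *\<^sub>R v \<notin> N" for z
  proof -
    define \<phi> where "\<phi> s = F (z + s *\<^sub>R v)" for s
    have "(L * norm v)-lipschitz_on UNIV \<phi>"
    proof (rule lipschitz_onI)
      show "0 \<le> L * norm v" using lip by (simp add: lipschitz_on_def)
      show "dist (\<phi> s) (\<phi> t) \<le> L * norm v * dist s t" for s t
        using lipschitz_abs_diff_le[of "z + s *\<^sub>R v" "z + t *\<^sub>R v"]
        by (simp add: \<phi>_def dist_norm scaleR_diff_left[symmetric] mult_ac)
    qed
    then have neg: "negligible {s. \<not> \<phi> differentiable (at s)}" by (rule lipschitz_real_differentiable_ae)
    have sub: "{s. z + s *\<^sub>R v \<in> N} \<subseteq> {s. \<not> \<phi> differentiable (at s)}"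
    proof safe
      fix s assume "z + s *\<^sub>R v \<in> N" "\<phi> differentiable (at s)"
      then obtain D where "(\<phi> has_field_derivative D) (at (s + 0))"
        by (auto simp: real_differentiable_def)
      then have "((\<lambda>r. \<phi> (s + r)) has_field_derivative D) (at 0)"
        using DERIV_shift[of \<phi> D 0 s] by (simp add: add.commute)
      then have "z + s *\<^sub>R v \<in> dir_diff F v" unfolding dir_diff_def \<phi>_def
        by (auto simp: algebra_simps)
      then show False using \<open>z + s *\<^sub>R v \<in> N\<close> by (simp add: N_def)
    qed
    have "(\<lambda>s. z + s *\<^sub>R v) -` N \<inter> space borel \<in> sets borel"
      by (rule measurable_sets[OF _ N]) measurable
    then have "{s. z + s *\<^sub>R v \<in> N} \<in> sets lborel" by (simp add: vimage_def)
    moreover have "{s. z + s *\<^sub>R v \<in> N} \<in> null_sets lebesgue"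
      using negligible_subset[OF neg sub] negligible_iff_null_sets by blast
    ultimately have "{s. z + s *\<^sub>R v \<in> N} \<in> null_sets lborel"
      using null_sets_completion_iff by blast
    then show ?thesis by (auto dest: AE_not_in)
  qed
  then have "AE z in lborel. AE s in lborel. z + s *\<^sub>R v \<notin> N" by simp
  moreover have "(AE s in lborel. AE z in lborel. z + s *\<^sub>R v \<notin> N) \<longleftrightarrow> (AE z in lborel. AE s in lborel. z + s *\<^sub>R v \<notin> N)"
  proof (rule lborel_pair.AE_commute)
    have "(\<lambda>p. snd p + fst p *\<^sub>R v) -` (- N) \<inter> space (borel \<Otimes>\<^sub>M borel) \<in> sets (borel \<Otimes>\<^sub>M borel :: (real \<times> 'a) measure)"
      by (intro measurable_sets[OF m] borel_comp N)
    moreover have "sets (lborel \<Otimes>\<^sub>M lborel :: (real \<times> 'a) measure) = sets (borel \<Otimes>\<^sub>M borel)"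
      by (intro sets_pair_measure_cong) auto
    moreover have "{p \<in> space (lborel \<Otimes>\<^sub>M lborel). snd p + fst p *\<^sub>R v \<notin> N} = (\<lambda>p. snd p + fst p *\<^sub>R v) -` (- N) \<inter> space (borel \<Otimes>\<^sub>M borel)"
      by (auto simp: space_pair_measure)
    ultimately show "{p \<in> space (lborel \<Otimes>\<^sub>M lborel). snd p + fst p *\<^sub>R v \<notin> N} \<in> sets (lborel \<Otimes>\<^sub>M lborel :: (real \<times> 'a) measure)"
      by simp
  qed
  ultimately have "AE s in lborel. AE z in lborel. z + s *\<^sub>R v \<notin> N" by blast
  moreover have "\<not> (AE s in (lborel :: real measure). False)"
    using AE_iff_measurable[of UNIV lborel "\<lambda>_::real. False"] by simp
  ultimately obtain s :: real where "AE z in lborel. z + s *\<^sub>R v \<notin> N"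
    by (metis (mono_tags, lifting) AE_mp eventually_mono)
  then have "AE z in distr lborel borel ((+) (s *\<^sub>R v)). z \<notin> N"
    using N by (subst AE_distr_iff) (auto simp: add.commute Collect_neg_eq)
  then have "AE z in lborel. z \<notin> N" using lborel_distr_plus by metis
  then show ?thesis by (simp add: N_def)
qed

lemma dir_quot_meas [measurable]: "dir_quot F v n \<in> borel_measurable borel"
  unfolding dir_quot_def[abs_def] by measurable

lemma dir_quot_bound: "\<bar>dir_quot F v n z\<bar> \<le> L * norm v"
proof -
  have "\<bar>dir_quot F v n z\<bar> \<le> (L * norm ((1 / real (Suc n)) *\<^sub>R v)) * real (Suc n)"
    unfolding dir_quot_def abs_mult using lipschitz_abs_diff_le[of "z + (1 / real (Suc n)) *\<^sub>R v" z]
    by (intro mult_mono) auto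
  also have "\<dots> = L * norm v" by simp
  finally show ?thesis .
qed

lemma dir_deriv_meas [measurable]: "dir_deriv F v \<in> borel_measurable borel"
proof -
  have "(\<lambda>z. lim (\<lambda>n. dir_quot F v n z)) \<in> borel_measurable borel" by measurable
  then show ?thesis unfolding dir_deriv_def[abs_def]
    using dir_diff_borel by (intro measurable_If_set) auto
qed

lemma dir_deriv_bound: "\<bar>dir_deriv F v z\<bar> \<le> L * norm v"
proof (cases "z \<in> dir_diff F v")
  case True
  show ?thesis
    by (rule LIMSEQ_le_const2[OF tendsto_rabs[OF dir_deriv_works(2)[OF True]]]) (use dir_quot_bound in auto)
next
  case False
  then show ?thesis using lip by (simp add: dir_deriv_def lipschitz_on_def)
qed

text \<open>The moving box is what a change of variables leaves behind in
  \<open>dir_deriv_add_ae\<close>, where \<open>b\<close> is 0 or a direction. Its indicator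
  converges off the frontier of the box, which is null, and the quotients are bounded by the
  Lipschitz constant, so dominated convergence applies.\<close>

lemma integral_dir_quot_tendsto:
  fixes b :: 'a
  shows "(\<lambda>n. \<integral>z. indicator (box l u) (z - (1 / real (Suc n)) *\<^sub>R b) * dir_quot F v n z \<partial>lborel)
    \<longlonglongrightarrow> (\<integral>z. indicator (box l u) z * dir_deriv F v z \<partial>lborel)"
proof -
  obtain r where r: "box l u \<subseteq> cball 0 r" using bounded_box[of l u] bounded_subset_ballD[of "box l u" 0] ball_subset_cball by (meson order_trans)
  show ?thesis
  proof (rule integral_dominated_convergence)
  show "integrable lborel (\<lambda>z::'a. indicator (cball 0 (r + norm b)) z * (L * norm v))"
    by (intro integrable_mult_left integrable_real_indicator) (use emeasure_bounded_finite[OF bounded_cball, of "0::'a" "r + norm b"] in auto)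
  show "AE z in lborel. norm (indicator (box l u) (z - (1 / real (Suc n)) *\<^sub>R b) * dir_quot F v n z)
     \<le> indicator (cball 0 (r + norm b)) z * (L * norm v)" for n
  proof (rule AE_I2)
    fix z
    have "(1 / real (Suc n)) * norm b \<le> 1 * norm b" by (intro mult_right_mono) auto
    then have "norm z \<le> norm (z - (1 / real (Suc n)) *\<^sub>R b) + norm b"
      using norm_triangle_ineq[of "z - (1 / real (Suc n)) *\<^sub>R b" "(1 / real (Suc n)) *\<^sub>R b"] by simp
    then have "z - (1 / real (Suc n)) *\<^sub>R b \<in> box l u \<Longrightarrow> z \<in> cball 0 (r + norm b)"
      using r by (force simp: subset_iff)
    then show "norm (indicator (box l u) (z - (1 / real (Suc n)) *\<^sub>R b) * dir_quot F v n z)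
     \<le> indicator (cball 0 (r + norm b)) z * (L * norm v)"
      using dir_quot_bound[of v n z] lip by (auto simp: indicator_def abs_mult lipschitz_on_def)
  qed
  have fr: "AE z in lborel. z \<notin> frontier (box l u)"
  proof -
    have "frontier (box l u) \<in> null_sets lebesgue"
      using negligible_convex_frontier[of "box l u"] negligible_iff_null_sets by (auto simp: convex_box)
    then have "frontier (box l u) \<in> null_sets lborel"
      using null_sets_completion_iff[of "frontier (box l u)" lborel] by (auto simp: borel_closed)
    then show ?thesis by (rule AE_not_in)
  qed
  show "AE z in lborel. (\<lambda>n. indicator (box l u) (z - (1 / real (Suc n)) *\<^sub>R b) * dir_quot F v n z)
     \<longlonglongrightarrow> indicator (box l u) z * dir_deriv F v z"
    using fr dir_diff_ae[of v]
  proof eventually_elim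
    case (elim z)
    have lim: "(\<lambda>n. z - (1 / real (Suc n)) *\<^sub>R b) \<longlonglongrightarrow> z - 0 *\<^sub>R b"
      using LIMSEQ_inverse_real_of_nat by (intro tendsto_intros) (simp add: divide_inverse)
    have ev: "\<forall>\<^sub>F n in sequentially. (indicator (box l u) (z - (1 / real (Suc n)) *\<^sub>R b) :: real) = indicator (box l u) z"
    proof (cases "z \<in> box l u")
      case True
      then have "\<forall>\<^sub>F n in sequentially. z - (1 / real (Suc n)) *\<^sub>R b \<in> box l u"
        using topological_tendstoD[OF lim, of "box l u"] by (auto simp: open_box)
      then show ?thesis by eventually_elim (use True in auto)
    next
      case False
      then have "z \<in> - closure (box l u)" using elim(1) by (auto simp: frontier_def interior_open open_box)
      then have "\<forall>\<^sub>F n in sequentially. z - (1 / real (Suc n)) *\<^sub>R b \<in> - closure (box l u)"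
        using topological_tendstoD[OF lim, of "- closure (box l u)"] by (auto simp: open_Compl)
      then show ?thesis by eventually_elim (use False closure_subset in \<open>auto simp: indicator_def\<close>)
    qed
    show ?case
      by (rule tendsto_mult[OF tendsto_eventually[OF ev] dir_deriv_works(2)[OF elim(2)]])
  qed
  qed measurable
qed

text \<open>The quotient in direction \<open>v + w\<close> is the one for \<open>v\<close> plus the
  one for \<open>w\<close> at a translated point. Inside an integral over a box the translation
  passes to the box and disappears in the limit, so the two sides have equal integrals over all
  boxes.\<close>

lemma dir_deriv_add_ae: "AE z in lborel. dir_deriv F (v + w) z = dir_deriv F v z + dir_deriv F w z"
proof -
  define g where "g z = dir_deriv F (v + w) z - (dir_deriv F v z + dir_deriv F w z)" for z
  have "AE z in lborel. g z = 0"
  proof (rule ae_zero_if_box_integrals_zero)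
    show "g \<in> borel_measurable borel" unfolding g_def[abs_def] by measurable
    show "\<bar>g z\<bar> \<le> L * norm (v + w) + (L * norm v + L * norm w)" for z
      using dir_deriv_bound[of "v + w" z] dir_deriv_bound[of v z] dir_deriv_bound[of w z] unfolding g_def by linarith
    fix l u :: 'a
    define I where "I h = (\<integral>z. indicator (box l u) z * h z \<partial>lborel)" for h :: "'a \<Rightarrow> real"
    have step: "I (dir_quot F (v + w) n) = I (dir_quot F v n)
        + (\<integral>z. indicator (box l u) (z - (1 / real (Suc n)) *\<^sub>R v) * dir_quot F w n z \<partial>lborel)" for n
    proof -
      define t where "t = (1 / real (Suc n)) *\<^sub>R v"
      have "(\<integral>z. indicator (box l u) (z - t) * dir_quot F w n z \<partial>lborel)
          = (\<integral>z. indicator (box l u) (z - t) * dir_quot F w n z \<partial>(distr lborel borel ((+) t)))"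
        by (simp add: lborel_distr_plus)
      also have "\<dots> = (\<integral>z. indicator (box l u) (t + z - t) * dir_quot F w n (t + z) \<partial>lborel)"
        by (rule integral_distr) measurable
      also have "\<dots> = (\<integral>z. indicator (box l u) z * dir_quot F w n (z + t) \<partial>lborel)"
        by (simp add: add.commute)
      finally have 1: "(\<integral>z. indicator (box l u) (z - t) * dir_quot F w n z \<partial>lborel) = I (\<lambda>z. dir_quot F w n (z + t))"
        by (simp add: I_def)
      have "dir_quot F (v + w) n z = dir_quot F v n z + dir_quot F w n (z + t)" for z
        by (simp add: dir_quot_def t_def algebra_simps scaleR_add_right)
      then have "I (dir_quot F (v + w) n) = (\<integral>z. indicator (box l u) z * dir_quot F v n z + indicator (box l u) z * dir_quot F w n (z + t) \<partial>lborel)"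
        unfolding I_def by (simp add: distrib_left)
      also have "\<dots> = I (dir_quot F v n) + I (\<lambda>z. dir_quot F w n (z + t))"
        unfolding I_def by (intro Bochner_Integration.integral_add integrable_indicator_box_mult[OF _ dir_quot_bound]) measurable
      finally show ?thesis using 1 by (simp add: t_def)
    qed
    have "(\<lambda>n. I (dir_quot F (v + w) n)) \<longlonglongrightarrow> I (dir_deriv F v) + I (dir_deriv F w)"
      unfolding step
      using integral_dir_quot_tendsto[of l u 0 v] integral_dir_quot_tendsto[of l u v w]
      by (intro tendsto_add) (auto simp: I_def)
    moreover have "(\<lambda>n. I (dir_quot F (v + w) n)) \<longlonglongrightarrow> I (dir_deriv F (v + w))"
      using integral_dir_quot_tendsto[of l u 0 "v + w"] by (simp add: I_def)
    ultimately have eq: "I (dir_deriv F (v + w)) = I (dir_deriv F v) + I (dir_deriv F w)"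
      using LIMSEQ_unique by blast
    have "I g = I (dir_deriv F (v + w)) - (I (dir_deriv F v) + I (dir_deriv F w))"
      unfolding g_def[abs_def] I_def right_diff_distrib distrib_left
      using integrable_indicator_box_mult[OF dir_deriv_meas dir_deriv_bound]
      by (simp add: Bochner_Integration.integral_diff Bochner_Integration.integral_add)
    then show "(\<integral>z. indicator (box l u) z * g z \<partial>lborel) = 0" using eq by (simp add: I_def)
  qed
  then show ?thesis by eventually_elim (simp add: g_def)
qed

lemma dir_deriv_scale:
  assumes "z \<in> dir_diff F v"
  shows "z \<in> dir_diff F (c *\<^sub>R v)" "dir_deriv F (c *\<^sub>R v) z = c * dir_deriv F v z"
proof -
  have "((\<lambda>s. F (z + s *\<^sub>R v)) has_field_derivative dir_deriv F v z) (at (0 * c))"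
    using dir_deriv_works(1)[OF assms] by simp
  then have D: "((\<lambda>s. F (z + (s * c) *\<^sub>R v)) has_field_derivative dir_deriv F v z * c) (at 0)"
    by (rule DERIV_chain2) (auto intro!: derivative_eq_intros)
  then show "z \<in> dir_diff F (c *\<^sub>R v)" by (auto simp: dir_diff_def)
  then have "((\<lambda>s. F (z + s *\<^sub>R c *\<^sub>R v)) has_field_derivative dir_deriv F (c *\<^sub>R v) z) (at 0)"
    by (rule dir_deriv_works)
  then show "dir_deriv F (c *\<^sub>R v) z = c * dir_deriv F v z"
    using DERIV_unique D by (fastforce simp: mult.commute)
qed

lemma dir_deriv_linear_ae:
  "AE z in lborel. dir_deriv F v z = v \<bullet> (\<Sum>b\<in>Basis. dir_deriv F b z *\<^sub>R b)"
proof -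
  have "AE z in lborel. dir_deriv F (\<Sum>b\<in>S. (v \<bullet> b) *\<^sub>R b) z = (\<Sum>b\<in>S. (v \<bullet> b) * dir_deriv F b z)"
    if "S \<subseteq> Basis" for S
    using finite_subset[OF that finite_Basis] that
  proof (induction S rule: finite_induct)
    case empty
    have "dir_deriv F 0 z = 0" for z using dir_deriv_bound[of 0 z] by simp
    then show ?case by simp
  next
    case (insert b S)
    have "AE z in lborel. dir_deriv F (\<Sum>b\<in>S. (v \<bullet> b) *\<^sub>R b) z = (\<Sum>b\<in>S. (v \<bullet> b) * dir_deriv F b z)"
      using insert by auto
    then show ?case
      using dir_deriv_add_ae[of "(v \<bullet> b) *\<^sub>R b" "\<Sum>b\<in>S. (v \<bullet> b) *\<^sub>R b"] dir_diff_ae[of b]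
    proof eventually_elim
      case (elim z)
      then show ?case using insert dir_deriv_scale(2)[OF elim(3)] by simp
    qed
  qed
  from this[of Basis] show ?thesis
    by (simp add: euclidean_representation inner_sum_right mult.commute)
qed

text \<open>Compactness of the unit sphere: finitely many directions of \<open>D\<close> come within
  \<eta> of all unit vectors. Their derivatives converge at a common rate, and the Lipschitz bound
  carries the estimate to the remaining directions.\<close>

lemma differentiable_if_dir_derivs:
  assumes dense: "\<And>x e. 0 < e \<Longrightarrow> \<exists>v\<in>D. norm (x - v) < e"
    and z: "\<And>v. v \<in> D \<Longrightarrow> ((\<lambda>s. F (z + s *\<^sub>R v)) has_field_derivative v \<bullet> T) (at 0)"
  shows "(F has_derivative (\<lambda>h. h \<bullet> T)) (at z)"
  unfolding has_derivative_at_alt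
proof (intro conjI allI impI)
  show "bounded_linear (\<lambda>h. h \<bullet> T)" by (rule bounded_linear_inner_left)
  fix e :: real assume e: "0 < e"
  \<comment> \<open>The cost of replacing a direction by one of \<open>D\<close>: \<open>L\<close>
    for \<open>F\<close> and \<open>norm T\<close> for its linear model. Dividing by
    \<open>2 * c\<close> lets this use up half of \<open>e\<close>.\<close>
  define c where "c = L + norm T + 1"
  have c: "0 < c" using lip by (simp add: c_def lipschitz_on_def add_nonneg_pos)
  define \<eta> where "\<eta> = e / (2 * c)"
  have \<eta>: "0 < \<eta>" using e c by (simp add: \<eta>_def)
  have "compact (sphere (0::'a) 1)" by simp
  then obtain K where K: "finite K" "K \<subseteq> D" "sphere (0::'a) 1 \<subseteq> (\<Union>v\<in>K. ball v \<eta>)"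
  proof (rule compactE_image)
    show "sphere 0 1 \<subseteq> (\<Union>v\<in>D. ball v \<eta>)"
      using dense[OF \<eta>] by (fastforce simp: dist_norm norm_minus_commute)
  qed auto
  have "\<forall>v\<in>K. \<exists>d>0. \<forall>s. \<bar>s\<bar> < d \<longrightarrow> \<bar>F (z + s *\<^sub>R v) - F z - s * (v \<bullet> T)\<bar> \<le> e/2 * \<bar>s\<bar>"
  proof
    fix v assume "v \<in> K"
    then have "((\<lambda>s. F (z + s *\<^sub>R v)) has_derivative (*) (v \<bullet> T)) (at 0)"
      using z K(2) by (auto simp: has_field_derivative_def)
    then show "\<exists>d>0. \<forall>s. \<bar>s\<bar> < d \<longrightarrow> \<bar>F (z + s *\<^sub>R v) - F z - s * (v \<bullet> T)\<bar> \<le> e/2 * \<bar>s\<bar>"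
      using e unfolding has_derivative_at_alt by (force simp: mult.commute dest!: conjunct2 spec[of _ "e/2"])
  qed
  then obtain d where d: "\<And>v. v \<in> K \<Longrightarrow> 0 < d v"
    "\<And>v s. v \<in> K \<Longrightarrow> \<bar>s\<bar> < d v \<Longrightarrow> \<bar>F (z + s *\<^sub>R v) - F z - s * (v \<bullet> T)\<bar> \<le> e/2 * \<bar>s\<bar>"
    by metis
  define d0 where "d0 = Min (insert 1 (d ` K))"
  have d0: "0 < d0" "\<And>v. v \<in> K \<Longrightarrow> d0 \<le> d v" using K(1) d(1) by (auto simp: d0_def)
  have "norm (F y - F z - (y - z) \<bullet> T) \<le> e * norm (y - z)" if y: "norm (y - z) < d0" for y
  proof (cases "y = z")
    case False
    define s where "s = norm (y - z)"
    have s: "0 < s" using False by (simp add: s_def)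
    define w where "w = (1 / s) *\<^sub>R (y - z)"
    have w: "norm w = 1" "y = z + s *\<^sub>R w" using s by (auto simp: w_def s_def)
    then obtain v where v: "v \<in> K" "norm (w - v) < \<eta>"
      using K(3) by (force simp: dist_norm norm_minus_commute)
    have "\<bar>F y - F (z + s *\<^sub>R v)\<bar> \<le> L * (s * norm (w - v))"
      using lipschitz_abs_diff_le[of y "z + s *\<^sub>R v"] s unfolding w(2) by (simp add: scaleR_diff_right[symmetric])
    moreover have "\<bar>s * (v \<bullet> T) - (y - z) \<bullet> T\<bar> \<le> norm T * (s * norm (w - v))"
    proof -
      have "s * (v \<bullet> T) - (y - z) \<bullet> T = - (s * ((w - v) \<bullet> T))" unfolding w(2) by (simp add: algebra_simps inner_diff_left)
      then have "\<bar>s * (v \<bullet> T) - (y - z) \<bullet> T\<bar> = s * \<bar>(w - v) \<bullet> T\<bar>" using s by (simp add: abs_mult)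
      also have "\<dots> \<le> s * (norm (w - v) * norm T)" using s Cauchy_Schwarz_ineq2 by (intro mult_left_mono) auto
      finally show ?thesis by (simp add: mult_ac)
    qed
    moreover have "\<bar>F (z + s *\<^sub>R v) - F z - s * (v \<bullet> T)\<bar> \<le> e/2 * s"
      using d(2)[OF v(1), of s] d0(2)[OF v(1)] y s by (simp add: s_def)
    moreover have "(L + norm T) * (s * norm (w - v)) \<le> e/2 * s"
    proof -
      have "(L + norm T) * (s * norm (w - v)) \<le> c * (s * \<eta>)"
        using v(2) s lip by (intro mult_mono) (auto simp: c_def lipschitz_on_def)
      also have "\<dots> = e/2 * s" using c by (simp add: \<eta>_def)
      finally show ?thesis .
    qed
    ultimately have "\<bar>F y - F z - (y - z) \<bullet> T\<bar> \<le> e * s" by (simp add: distrib_right) argo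
    then show ?thesis by (simp add: s_def)
  qed auto
  then show "\<exists>d>0. \<forall>y. norm (y - z) < d \<longrightarrow> norm (F y - F z - (y - z) \<bullet> T) \<le> e * norm (y - z)"
    using d0(1) by blast
qed

theorem Rademacher: "negligible {z. \<not> F differentiable (at z)}"
proof -
  obtain D :: "'a set" where D: "countable D" "\<And>X. open X \<Longrightarrow> X \<noteq> {} \<Longrightarrow> \<exists>d\<in>D. d \<in> X"
    using countable_dense_setE by blast
  have dense: "\<exists>v\<in>D. norm (x - v) < e" if "0 < e" for x e
    using D(2)[of "ball x e"] that by (auto simp: dist_norm)
  have "AE z in lborel. \<forall>v\<in>D. z \<in> dir_diff F v \<and> dir_deriv F v z = v \<bullet> (\<Sum>b\<in>Basis. dir_deriv F b z *\<^sub>R b)"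
    using D(1) dir_diff_ae dir_deriv_linear_ae by (subst AE_ball_countable) (auto intro: AE_conjI)
  then have "AE z in lborel. F differentiable (at z)"
  proof eventually_elim
    case (elim z)
    then have "(F has_derivative (\<lambda>h. h \<bullet> (\<Sum>b\<in>Basis. dir_deriv F b z *\<^sub>R b))) (at z)"
    proof (intro differentiable_if_dir_derivs[OF dense])
      fix v assume "v \<in> D"
      then show "((\<lambda>s. F (z + s *\<^sub>R v)) has_field_derivative v \<bullet> (\<Sum>b\<in>Basis. dir_deriv F b z *\<^sub>R b)) (at 0)"
        using dir_deriv_works(1)[of z F v] elim by auto
    qed
    then show ?case by (auto simp: differentiable_def)
  qed
  then obtain N where "N \<in> null_sets lborel" "{z. \<not> F differentiable (at z)} \<subseteq> N"
    by (auto simp: eventually_ae_filter)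
  then show ?thesis using negligible_subset negligible_iff_null_sets null_sets_completionI by metis
qed

end

section \<open>Second-order expansions at approximate maxima\<close>

lemma lipschitz_extension_real:
  fixes p :: "'a::metric_space \<Rightarrow> real"
  assumes "L-lipschitz_on E p"
  obtains P where "L-lipschitz_on UNIV P" "\<And>z. z \<in> E \<Longrightarrow> P z = p z"
proof (cases "E = {}")
  case True
  then show ?thesis using that[of "\<lambda>_. 0"] assms by (auto simp: lipschitz_on_def)
next
  case False
  have L: "0 \<le> L" using assms by (simp add: lipschitz_on_def)
  have p: "p x \<le> p y + L * dist x y" if "x \<in> E" "y \<in> E" for x y
    using lipschitz_onD[OF assms that] by (auto simp: dist_real_def abs_le_iff)
  \<comment> \<open>McShane's formula, the largest \<open>L\<close>-Lipschitz extension.\<close>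
  define P where "P z = (INF e\<in>E. p e + L * dist e z)" for z
  obtain e0 where e0: "e0 \<in> E" using False by blast
  have bdd: "bdd_below ((\<lambda>e. p e + L * dist e z) ` E)" for z
  proof (rule bdd_belowI2)
    fix e assume e: "e \<in> E"
    have "L * dist e0 e \<le> L * (dist e z + dist e0 z)"
      using L by (intro mult_left_mono) (metis add.commute dist_commute dist_triangle2, auto)
    then show "p e0 - L * dist e0 z \<le> p e + L * dist e z" using p[OF e0 e] by (simp add: distrib_left)
  qed
  have le: "P z \<le> P w + L * dist z w" for z w
  proof -
    have "P z - L * dist z w \<le> P w" unfolding P_def[of w]
    proof (rule cINF_greatest[OF False])
      fix e assume e: "e \<in> E"
      have "P z \<le> p e + L * dist e z" unfolding P_def using cINF_lower[OF bdd e] .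
      also have "L * dist e z \<le> L * (dist e w + dist z w)"
        using L by (intro mult_left_mono dist_triangle2) auto
      finally show "P z - L * dist z w \<le> p e + L * dist e w" by (simp add: distrib_left)
    qed
    then show ?thesis by simp
  qed
  show ?thesis
  proof (rule that)
    show "L-lipschitz_on UNIV P"
    proof (rule lipschitz_onI)
      show "dist (P z) (P w) \<le> L * dist z w" for z w
        using le[of z w] le[of w z] by (auto simp: dist_real_def abs_le_iff dist_commute)
    qed (rule L)
    show "P z = p z" if z: "z \<in> E" for z
    proof (rule antisym)
      show "P z \<le> p z" unfolding P_def using cINF_lower[OF bdd z, of z] by simp
      show "p z \<le> P z" unfolding P_def by (rule cINF_greatest[OF False]) (use p z dist_commute in metis)
    qed
  qed
qed

text \<open>Over \<open>N\<close> equal steps the linear errors add up to \<alpha>, the quadratic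
  ones only to C/N.\<close>

lemma increment_le_if_quadratic_error:
  fixes \<theta> :: "real \<Rightarrow> real"
  assumes inc: "\<And>s t. s \<in> {0..1} \<Longrightarrow> t \<in> {0..1} \<Longrightarrow> \<theta> t - \<theta> s \<ge> - (\<alpha> * \<bar>t - s\<bar> + C * (t - s)\<^sup>2)"
  shows "\<bar>\<theta> 1 - \<theta> 0\<bar> \<le> \<alpha>"
proof -
  have "\<bar>\<theta> 1 - \<theta> 0\<bar> \<le> \<alpha> + C / real (Suc n)" for n
  proof -
    define N where "N = real (Suc n)"
    have N: "0 < N" by (simp add: N_def)
    have step: "\<bar>\<theta> (real (Suc i) / N) - \<theta> (real i / N)\<bar> \<le> \<alpha> / N + C / N\<^sup>2" if "i < Suc n" for i
    proof -
      have mem: "real i / N \<in> {0..1}" "real (Suc i) / N \<in> {0..1}" using that N by (auto simp: N_def)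
      have d: "real (Suc i) / N - real i / N = 1 / N" "real i / N - real (Suc i) / N = - (1 / N)"
        by (simp_all add: diff_divide_distrib[symmetric])
      show ?thesis
        using inc[OF mem] inc[OF mem(2,1)] N unfolding d
        by (simp add: power_divide abs_le_iff)
    qed
    have "\<theta> 1 - \<theta> 0 = (\<Sum>i<Suc n. \<theta> (real (Suc i) / N) - \<theta> (real i / N))"
      unfolding sum_lessThan_telescope[of "\<lambda>i. \<theta> (real i / N)" "Suc n"] using N by (simp add: N_def[symmetric] del: of_nat_Suc)
    then have "\<bar>\<theta> 1 - \<theta> 0\<bar> \<le> (\<Sum>i<Suc n. \<bar>\<theta> (real (Suc i) / N) - \<theta> (real i / N)\<bar>)"
      using sum_abs by metis
    also have "\<dots> \<le> (\<Sum>i<Suc n. \<alpha> / N + C / N\<^sup>2)" using step by (intro sum_mono) auto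
    also have "\<dots> = \<alpha> + C / N" using N by (simp only: sum_constant card_lessThan N_def[symmetric]) (simp add: power2_eq_square field_simps)
    finally show ?thesis by (simp add: N_def)
  qed
  moreover have "(\<lambda>n. \<alpha> + C / real (Suc n)) \<longlonglongrightarrow> \<alpha> + 0"
    by (intro tendsto_intros LIMSEQ_Suc[OF lim_const_over_n])
  ultimately show ?thesis by (auto intro: LIMSEQ_le_const)
qed

text \<open>\<open>A\<close> is whatever linear map the slopes have as derivative at
  \<open>z\<close>; only its quadratic form enters. The symmetric matrix is formed later, in
  \<open>sconv_subsolution\<close>.\<close>

definition second_order_at :: "('a::real_inner \<Rightarrow> real) \<Rightarrow> 'a \<Rightarrow> 'a \<Rightarrow> ('a \<Rightarrow> 'a) \<Rightarrow> bool" where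
  "second_order_at f z p A \<longleftrightarrow> linear A \<and> (\<forall>e>0. \<forall>\<^sub>F w in nhds z.
     \<bar>f w - f z - p \<bullet> (w - z) - A (w - z) \<bullet> (w - z) / 2\<bar> \<le> e * (norm (w - z))\<^sup>2)"

lemma second_order_atD:
  assumes "second_order_at f z p A"
  shows "linear A"
    "0 < e \<Longrightarrow> \<forall>\<^sub>F w in nhds z. \<bar>f w - f z - p \<bullet> (w - z) - A (w - z) \<bullet> (w - z) / 2\<bar> \<le> e * (norm (w - z))\<^sup>2"
  using assms by (auto simp: second_order_at_def)

text \<open>Tested along \<open>z + t *\<^sub>R v\<close>, the linear term beats the quadratic one
  for small \<open>t\<close>. This is the device that identifies slopes: functions touching from
  opposite sides with quadratic errors have the same slope.\<close>

lemma eq_0_if_inner_le_square: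
  fixes v z :: "'a::real_inner"
  assumes "\<forall>\<^sub>F w in nhds z. v \<bullet> (w - z) \<le> c * (norm (w - z))\<^sup>2"
  shows "v = 0"
proof (rule ccontr)
  assume "v \<noteq> 0"
  then have v: "0 < norm v" by simp
  obtain d where d: "0 < d" "\<And>w. dist w z < d \<Longrightarrow> v \<bullet> (w - z) \<le> c * (norm (w - z))\<^sup>2"
    using assms unfolding eventually_nhds_metric by blast
  \<comment> \<open>The first bound keeps the test point in the neighbourhood, the second makes
    \<open>c * t\<close> at most 1/2.\<close>
  define t where "t = min (d / (2 * norm v)) (1 / (2 * (\<bar>c\<bar> + 1)))"
  have t: "0 < t" "t * norm v < d" "t * (\<bar>c\<bar> + 1) \<le> 1 / 2"
  proof -
    show "0 < t" using d v by (simp add: t_def add_nonneg_pos)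
    have "t * norm v \<le> d / (2 * norm v) * norm v" using v by (intro mult_right_mono) (auto simp: t_def)
    then show "t * norm v < d" using v d by simp
    have "t * m \<le> 1 / 2" if "0 < m" "t \<le> 1 / (2 * m)" for m
      using mult_right_mono[OF that(2), of m] that(1) by simp
    then show "t * (\<bar>c\<bar> + 1) \<le> 1 / 2" by (simp add: t_def add_nonneg_pos)
  qed
  have "v \<bullet> (t *\<^sub>R v) \<le> c * (norm (t *\<^sub>R v))\<^sup>2" using d(2)[of "z + t *\<^sub>R v"] t by (simp add: dist_norm)
  then have "t * (norm v)\<^sup>2 \<le> t * ((c * t) * (norm v)\<^sup>2)"
    by (simp add: dot_square_norm power_mult_distrib power2_eq_square mult_ac)
  then have "1 * (norm v)\<^sup>2 \<le> (c * t) * (norm v)\<^sup>2" using t by simp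
  then have "1 \<le> c * t" using v by (subst (asm) mult_le_cancel_right) auto
  also have "c * t \<le> t * (\<bar>c\<bar> + 1)" using t(1) by (simp add: mult.commute)
  finally show False using t(3) by simp
qed

text \<open>The lower paraboloids of \<open>f\<close> supply the remainder estimate only once their slopes are known
  to be differentiable at \<open>z\<close>; the second-order expansion then follows by summing increments of
  \<open>f\<close> along the segment from \<open>z\<close> to \<open>z + h\<close>.\<close>

lemma second_order_atI:
  fixes f :: "'a::euclidean_space \<Rightarrow> real" and A :: "'a \<Rightarrow> 'a"
  assumes A: "linear A" and \<rho>: "0 < \<rho>"
    and low: "\<And>y w. y \<in> ball z \<rho> \<Longrightarrow> w \<in> ball z \<rho> \<Longrightarrow> f w \<ge> f y + p y \<bullet> (w - y) - C * (norm (w - y))\<^sup>2"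
    and diff: "\<And>e. 0 < e \<Longrightarrow> \<forall>\<^sub>F y in nhds z. norm (p y - p z - A (y - z)) \<le> e * norm (y - z)"
  shows "second_order_at f z (p z) A"
  unfolding second_order_at_def
proof (intro conjI allI impI A)
  fix e :: real assume e: "0 < e"
  obtain d where d: "0 < d" "\<And>y. dist y z < d \<Longrightarrow> norm (p y - p z - A (y - z)) \<le> e * norm (y - z)"
    using diff[OF e] unfolding eventually_nhds_metric by blast
  have "\<bar>f w - f z - p z \<bullet> (w - z) - A (w - z) \<bullet> (w - z) / 2\<bar> \<le> e * (norm (w - z))\<^sup>2"
    if w: "dist w z < min d \<rho>" for w
  proof -
    define h where "h = w - z"
    \<comment> \<open>Along the segment, \<open>f\<close> minus its expected model; the claim
      becomes a bound on \<open>\<theta> 1 - \<theta> 0\<close>. Splitting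
      \<open>t\<^sup>2 - s\<^sup>2\<close> into \<open>2 * s * (t - s) + (t - s)\<^sup>2\<close>
      matches the linear part of an increment with the slope at parameter \<open>s\<close>.\<close>
    define \<theta> where "\<theta> s = f (z + s *\<^sub>R h) - s * (p z \<bullet> h) - s\<^sup>2 * (A h \<bullet> h) / 2" for s
    have nh: "norm h < d" "norm h < \<rho>" using w by (auto simp: h_def dist_norm)
    have inc: "\<theta> t - \<theta> s \<ge> - (e * (norm h)\<^sup>2 * \<bar>t - s\<bar> + (\<bar>C\<bar> * (norm h)\<^sup>2 + \<bar>A h \<bullet> h\<bar>) * (t - s)\<^sup>2)"
      if st: "s \<in> {0..1}" "t \<in> {0..1}" for s t
    proof -
      have n1: "norm (s *\<^sub>R h) \<le> norm h" "norm (t *\<^sub>R h) \<le> norm h"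
        using st mult_left_le_one_le[of "norm h" s] mult_left_le_one_le[of "norm h" t] by auto
      have "f (z + t *\<^sub>R h) \<ge> f (z + s *\<^sub>R h) + p (z + s *\<^sub>R h) \<bullet> ((t - s) *\<^sub>R h) - C * (norm ((t - s) *\<^sub>R h))\<^sup>2"
        using low[of "z + s *\<^sub>R h" "z + t *\<^sub>R h"] n1 nh by (auto simp: dist_norm algebra_simps)
      then have 1: "f (z + t *\<^sub>R h) - f (z + s *\<^sub>R h) \<ge> (t - s) * (p (z + s *\<^sub>R h) \<bullet> h) - C * ((t - s)\<^sup>2 * (norm h)\<^sup>2)"
        by (simp add: power_mult_distrib)
      have "norm (p (z + s *\<^sub>R h) - p z - s *\<^sub>R A h) \<le> e * norm (s *\<^sub>R h)"
        using d(2)[of "z + s *\<^sub>R h"] n1 nh linear_scale[OF A] by (auto simp: dist_norm)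
      also have "\<dots> \<le> e * norm h" using e n1 by (intro mult_left_mono) auto
      finally have "\<bar>(p (z + s *\<^sub>R h) - p z - s *\<^sub>R A h) \<bullet> h\<bar> \<le> e * norm h * norm h"
        using Cauchy_Schwarz_ineq2[of "p (z + s *\<^sub>R h) - p z - s *\<^sub>R A h" h] mult_right_mono[of _ _ "norm h"]
        by (meson norm_ge_zero order_trans)
      then have "\<bar>t - s\<bar> * \<bar>p (z + s *\<^sub>R h) \<bullet> h - p z \<bullet> h - s * (A h \<bullet> h)\<bar> \<le> \<bar>t - s\<bar> * (e * norm h * norm h)"
        by (intro mult_left_mono) (auto simp: inner_diff_left)
      then have 2: "(t - s) * (p (z + s *\<^sub>R h) \<bullet> h - p z \<bullet> h - s * (A h \<bullet> h)) \<ge> - (e * (norm h)\<^sup>2 * \<bar>t - s\<bar>)"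
        unfolding abs_mult[symmetric] by (auto simp: abs_le_iff power2_eq_square mult_ac)
      have 3: "C * ((t - s)\<^sup>2 * (norm h)\<^sup>2) \<le> \<bar>C\<bar> * (norm h)\<^sup>2 * (t - s)\<^sup>2"
        using mult_right_mono[OF abs_ge_self[of C], of "(t - s)\<^sup>2 * (norm h)\<^sup>2"] by (simp add: mult_ac)
      have 4: "(t - s)\<^sup>2 * (A h \<bullet> h) / 2 \<le> \<bar>A h \<bullet> h\<bar> * (t - s)\<^sup>2"
      proof -
        have "(t - s)\<^sup>2 * (A h \<bullet> h) / 2 \<le> (t - s)\<^sup>2 * \<bar>A h \<bullet> h\<bar> / 2" by (intro divide_right_mono mult_left_mono) auto
        also have "\<dots> \<le> (t - s)\<^sup>2 * \<bar>A h \<bullet> h\<bar>" by simp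
        finally show ?thesis by (simp add: mult.commute)
      qed
      have "\<theta> t - \<theta> s = (f (z + t *\<^sub>R h) - f (z + s *\<^sub>R h)) - (t - s) * (p z \<bullet> h) - (t\<^sup>2 - s\<^sup>2) * (A h \<bullet> h) / 2"
        by (simp add: \<theta>_def field_simps)
      also have "\<dots> = (f (z + t *\<^sub>R h) - f (z + s *\<^sub>R h)) - (t - s) * (p z \<bullet> h + s * (A h \<bullet> h)) - (t - s)\<^sup>2 * (A h \<bullet> h) / 2"
        by (simp add: power2_eq_square field_simps)
      finally show ?thesis using 1 2 3 4 by (simp add: algebra_simps)
    qed
    have "\<bar>\<theta> 1 - \<theta> 0\<bar> \<le> e * (norm h)\<^sup>2" by (rule increment_le_if_quadratic_error[OF inc])
    then show ?thesis by (simp add: \<theta>_def h_def algebra_simps)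
  qed
  moreover have "0 < min d \<rho>" using d(1) \<rho> by simp
  ultimately show "\<forall>\<^sub>F w in nhds z. \<bar>f w - f z - p z \<bullet> (w - z) - A (w - z) \<bullet> (w - z) / 2\<bar> \<le> e * (norm (w - z))\<^sup>2"
    unfolding eventually_nhds_metric by blast
qed

text \<open>At a contact point of \<open>f + g\<close> with an affine function from above, \<open>f\<close> inherits an upper
  paraboloid from the lower one of \<open>g\<close>; this makes the slopes of \<open>f\<close> Lipschitz on the set of
  contact points.\<close>

lemma slopes_lipschitz:
  fixes f :: "'a::real_inner \<Rightarrow> real"
  assumes low: "\<And>w. w \<in> cball a (3 * \<rho>) \<Longrightarrow> f w \<ge> f z' + p' \<bullet> (w - z') - C * (norm (w - z'))\<^sup>2"
    and low': "f z' \<ge> f z + p \<bullet> (z' - z) - C * (norm (z' - z))\<^sup>2"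
    and up: "\<And>w. w \<in> cball a (3 * \<rho>) \<Longrightarrow> f w \<le> f z + p \<bullet> (w - z) + C * (norm (w - z))\<^sup>2"
    and z: "z \<in> ball a \<rho>" "z' \<in> ball a \<rho>" and C: "0 \<le> C"
  shows "norm (p' - p) \<le> 6 * C * norm (z' - z)"
proof (cases "p' = p")
  case False
  define d where "d = norm (z' - z)"
  \<comment> \<open>A step of length \<open>d\<close> in the direction of \<open>p' - p\<close>. At
    \<open>z' + h\<close> the upper paraboloid of \<open>z\<close> meets the lower one of
    \<open>z'\<close>, which bounds \<open>d * norm (p' - p)\<close>; the radius
    \<open>3 * \<rho>\<close> leaves room for this point.\<close>
  define h where "h = (d / norm (p' - p)) *\<^sub>R (p' - p)"
  have d0: "0 \<le> d" by (simp add: d_def)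
  have nh: "norm h = d" using False by (simp add: h_def d_def)
  have "d \<le> dist a z + dist a z'" unfolding d_def using dist_triangle3[of z' z a] by (simp add: dist_norm norm_minus_commute)
  then have "norm (a - (z' + h)) \<le> 3 * \<rho>"
    using norm_triangle_ineq4[of "a - z'" h] nh z by (simp add: dist_norm algebra_simps)
  then have w: "z' + h \<in> cball a (3 * \<rho>)" by (simp add: dist_norm)
  have n2: "(norm (z' + h - z))\<^sup>2 \<le> 4 * d\<^sup>2"
  proof -
    have "norm (z' + h - z) \<le> 2 * d" using norm_triangle_ineq[of "z' - z" h] nh by (simp add: d_def algebra_simps)
    then have "(norm (z' + h - z))\<^sup>2 \<le> (2 * d)\<^sup>2" by (intro power_mono) auto
    then show ?thesis by simp
  qed
  have "(p' - p) \<bullet> h \<le> C * d\<^sup>2 + C * (norm (z' + h - z))\<^sup>2 + C * d\<^sup>2"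
    using low[OF w] up[OF w] low' nh by (simp add: d_def inner_diff_left inner_diff_right inner_add_right algebra_simps)
  also have "\<dots> \<le> C * d\<^sup>2 + C * (4 * d\<^sup>2) + C * d\<^sup>2"
    using n2 C by (intro add_mono mult_left_mono) auto
  finally have 1: "(p' - p) \<bullet> h \<le> 6 * C * d\<^sup>2" by simp
  have "(p' - p) \<bullet> h = d * norm (p' - p)"
    using False by (simp add: h_def dot_square_norm power2_eq_square)
  then have "d * norm (p' - p) \<le> d * (6 * C * d)" using 1 by (simp add: power2_eq_square mult_ac)
  \<comment> \<open>For \<open>z' = z\<close> the step \<open>h\<close> degenerates; there an upper
    and a lower paraboloid at one point force equal slopes.\<close>
  moreover have "d \<noteq> 0"
  proof
    assume "d = 0"
    then have "z' = z" by (simp add: d_def)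
    have "p' - p = 0"
    proof (rule eq_0_if_inner_le_square)
      have r: "0 < \<rho>" using z zero_le_dist[of a z] unfolding mem_ball by linarith
      then have "\<forall>\<^sub>F w in nhds z. w \<in> ball a (3 * \<rho>)"
        using z by (intro eventually_nhds_in_open) auto
      then show "\<forall>\<^sub>F w in nhds z. (p' - p) \<bullet> (w - z) \<le> (2 * C) * (norm (w - z))\<^sup>2"
      proof eventually_elim
        case (elim w)
        then have "w \<in> cball a (3 * \<rho>)" by auto
        from low[OF this] up[OF this] show ?case by (simp add: \<open>z' = z\<close> inner_diff_left)
      qed
    qed
    then show False using False by simp
  qed
  ultimately show ?thesis using d0 unfolding d_def[symmetric] by auto
qed (use C in auto)

text \<open>Every tilt of slope at most \<open>r\<close> moves the maximum to a contact point inside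
  the ball. On the set \<open>E\<close> of these points the slopes \<open>pf\<close> and
  \<open>pg\<close> are Lipschitz and their sum covers a ball, so \<open>E\<close> is not null and
  Rademacher's theorem yields a point of \<open>E\<close> at which everything relevant is
  differentiable.\<close>

lemma Jensen_strict:
  fixes f g :: "'a::euclidean_space \<Rightarrow> real"
  assumes \<rho>: "0 < \<rho>" and C: "0 \<le> C" and \<kappa>: "0 < \<kappa>"
    and cont: "continuous_on (cball a (3 * \<rho>)) f" "continuous_on (cball a (3 * \<rho>)) g"
    and lowf: "\<And>z. z \<in> cball a (3 * \<rho>) \<Longrightarrow> \<exists>p. \<forall>w\<in>cball a (3 * \<rho>). f w \<ge> f z + p \<bullet> (w - z) - C * (norm (w - z))\<^sup>2"
    and lowg: "\<And>z. z \<in> cball a (3 * \<rho>) \<Longrightarrow> \<exists>p. \<forall>w\<in>cball a (3 * \<rho>). g w \<ge> g z + p \<bullet> (w - z) - C * (norm (w - z))\<^sup>2"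
    and mx: "\<And>z. z \<in> cball a (3 * \<rho>) - ball a \<rho> \<Longrightarrow> f z + g z \<le> f a + g a - \<kappa>"
  shows "\<exists>z\<in>ball a \<rho>. \<exists>p q A A'. second_order_at f z p A \<and> second_order_at g z q A' \<and>
     norm (p + q) \<le> \<kappa> / (4 * \<rho>) \<and> (\<forall>h. A h \<bullet> h + A' h \<bullet> h \<le> 0)"
proof -
  let ?S = "cball a (3 * \<rho>)"
  define W where "W z = f z + g z" for z
  \<comment> \<open>With \<open>r * (3 * \<rho>)\<close> below \<kappa>, a tilt cannot make up for
    the drop of \<open>f + g\<close> outside the small ball.\<close>
  define r where "r = \<kappa> / (4 * \<rho>)"
  have r: "0 < r" using \<kappa> \<rho> by (simp add: r_def)
  obtain pf where pf: "\<And>z w. z \<in> ?S \<Longrightarrow> w \<in> ?S \<Longrightarrow> f w \<ge> f z + pf z \<bullet> (w - z) - C * (norm (w - z))\<^sup>2"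
    using lowf by metis
  obtain pg where pg: "\<And>z w. z \<in> ?S \<Longrightarrow> w \<in> ?S \<Longrightarrow> g w \<ge> g z + pg z \<bullet> (w - z) - C * (norm (w - z))\<^sup>2"
    using lowg by metis
  define con where "con z q \<longleftrightarrow> z \<in> ball a \<rho> \<and> norm q \<le> r \<and> (\<forall>w\<in>?S. W w - q \<bullet> w \<le> W z - q \<bullet> z)" for z q
  define E where "E = {z. \<exists>q. con z q}"
  have bS: "z \<in> ?S" if "z \<in> ball a \<rho>" for z using that \<rho> by auto
  have ex: "\<exists>z. con z q" if q: "norm q \<le> r" for q
  proof -
    have "\<exists>z\<in>?S. \<forall>w\<in>?S. W w - q \<bullet> w \<le> W z - q \<bullet> z"
      by (rule continuous_attains_sup) (use \<rho> in \<open>auto simp: W_def intro!: continuous_intros cont\<close>)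
    then obtain z where z: "z \<in> ?S" "\<forall>w\<in>?S. W w - q \<bullet> w \<le> W z - q \<bullet> z" by blast
    have "z \<in> ball a \<rho>"
    proof (rule ccontr)
      assume "z \<notin> ball a \<rho>"
      then have "W z \<le> W a - \<kappa>" using mx[of z] z(1) by (simp add: W_def)
      moreover have "W a - q \<bullet> a \<le> W z - q \<bullet> z" using z(2) \<rho> by simp
      ultimately have "\<kappa> \<le> q \<bullet> (a - z)" by (simp add: inner_diff_right)
      also have "\<dots> \<le> norm q * norm (a - z)" by (rule norm_cauchy_schwarz)
      also have "\<dots> \<le> r * (3 * \<rho>)" using q z(1) \<rho> r by (intro mult_mono) (auto simp: dist_norm)
      also have "\<dots> < \<kappa>" using \<rho> \<kappa> by (simp add: r_def)
      finally show False by simp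
    qed
    then show ?thesis using q z(2) by (auto simp: con_def)
  qed
  \<comment> \<open>At a contact point \<open>W\<close> lies below an affine function of slope
    \<open>q\<close> and above the sum of the two lower paraboloids, so the slopes agree.\<close>
  have sumq: "pf z + pg z = q" if con: "con z q" for z q
  proof -
    have z: "z \<in> ball a \<rho>" using con by (simp add: con_def)
    have "pf z + pg z - q = 0"
    proof (rule eq_0_if_inner_le_square)
      have "\<forall>\<^sub>F w in nhds z. w \<in> ball a \<rho>" using z by (intro eventually_nhds_in_open) auto
      then show "\<forall>\<^sub>F w in nhds z. (pf z + pg z - q) \<bullet> (w - z) \<le> (2 * C) * (norm (w - z))\<^sup>2"
      proof eventually_elim
        case (elim w)
        have "W w - q \<bullet> w \<le> W z - q \<bullet> z" using con bS[OF elim] unfolding con_def by blast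
        then show ?case using pf[OF bS[OF z] bS[OF elim]] pg[OF bS[OF z] bS[OF elim]]
          by (simp add: W_def inner_diff_left inner_add_left inner_diff_right[of q])
      qed
    qed
    then show ?thesis by simp
  qed
  have upf: "f w \<le> f z + pf z \<bullet> (w - z) + C * (norm (w - z))\<^sup>2"
    and upg: "g w \<le> g z + pg z \<bullet> (w - z) + C * (norm (w - z))\<^sup>2"
    and upW: "W w \<le> W z + (pf z + pg z) \<bullet> (w - z)" if zw: "z \<in> E" "w \<in> ?S" for z w
  proof -
    obtain q where q: "con z q" using zw by (auto simp: E_def)
    then have "W w - q \<bullet> w \<le> W z - q \<bullet> z" "z \<in> ?S" using zw(2) bS unfolding con_def by blast+
    then have "W w \<le> W z + q \<bullet> (w - z)" "z \<in> ?S" by (auto simp: inner_diff_right)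
    then show "W w \<le> W z + (pf z + pg z) \<bullet> (w - z)"
      "f w \<le> f z + pf z \<bullet> (w - z) + C * (norm (w - z))\<^sup>2" "g w \<le> g z + pg z \<bullet> (w - z) + C * (norm (w - z))\<^sup>2"
      using pf[of z w] pg[of z w] sumq[OF q] zw by (auto simp: W_def inner_add_left)
  qed
  have EB: "E \<subseteq> ball a \<rho>" by (auto simp: E_def con_def)
  have Lf: "norm (pf y - pf z) \<le> 6 * C * norm (y - z)" if "z \<in> E" "y \<in> ball a \<rho>" for y z
    using that EB bS by (intro slopes_lipschitz[where a = a and \<rho> = \<rho> and f = f] pf upf C) auto
  have Lg: "norm (pg y - pg z) \<le> 6 * C * norm (y - z)" if "z \<in> E" "y \<in> ball a \<rho>" for y z
    using that EB bS by (intro slopes_lipschitz[where a = a and \<rho> = \<rho> and f = g] pg upg C) auto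
  have notneg: "\<not> negligible E"
  proof
    assume "negligible E"
    then have "negligible ((\<lambda>z. pf z + pg z) ` E)"
    proof (rule negligible_locally_Lipschitz_image[OF order_refl])
      fix x assume x: "x \<in> E"
      have "norm (pf y + pg y - (pf x + pg x)) \<le> 12 * C * norm (y - x)" if "y \<in> E" for y
      proof -
        have "norm ((pf y - pf x) + (pg y - pg x)) \<le> 6 * C * norm (y - x) + 6 * C * norm (y - x)"
          using Lf[OF x, of y] Lg[OF x, of y] that EB by (intro norm_triangle_mono) auto
        then show ?thesis by (simp add: algebra_simps)
      qed
      then show "\<exists>T B. open T \<and> x \<in> T \<and> (\<forall>y\<in>E \<inter> T. norm (pf y + pg y - (pf x + pg x)) \<le> B * norm (y - x))"
        by (intro exI[of _ UNIV] exI[of _ "12 * C"]) auto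
    qed
    moreover have "cball 0 r \<subseteq> (\<lambda>z. pf z + pg z) ` E"
    proof
      fix q :: 'a assume "q \<in> cball 0 r"
      then obtain z where "con z q" using ex by auto
      then show "q \<in> (\<lambda>z. pf z + pg z) ` E" using sumq[of z q] by (auto simp: E_def image_iff)
    qed
    ultimately have "negligible (ball (0::'a) r)" using negligible_subset ball_subset_cball by (meson order_trans)
    then show False using r open_not_negligible[of "ball (0::'a) r"] by simp
  qed
  have ext: "\<exists>P. (6 * C)-lipschitz_on UNIV P \<and> (\<forall>z\<in>E. P z = s z \<bullet> b)"
    if s: "\<And>y z. z \<in> E \<Longrightarrow> y \<in> ball a \<rho> \<Longrightarrow> norm (s y - s z) \<le> 6 * C * norm (y - z)" and b: "b \<in> Basis"
    for s :: "'a \<Rightarrow> 'a" and b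
  proof -
    have "(6 * C)-lipschitz_on E (\<lambda>z. s z \<bullet> b)"
    proof (rule lipschitz_onI)
      fix x y assume xy: "x \<in> E" "y \<in> E"
      have "\<bar>(s x - s y) \<bullet> b\<bar> \<le> norm (s x - s y)" by (rule Basis_le_norm[OF b])
      also have "\<dots> \<le> 6 * C * norm (x - y)" using s xy EB by blast
      finally show "dist (s x \<bullet> b) (s y \<bullet> b) \<le> 6 * C * dist x y" by (simp add: dist_real_def dist_norm inner_diff_left)
    qed (use C in auto)
    then show ?thesis by (metis lipschitz_extension_real)
  qed
  obtain Pf where Pf: "\<And>b. b \<in> Basis \<Longrightarrow> (6 * C)-lipschitz_on UNIV (Pf b)"
    "\<And>b z. b \<in> Basis \<Longrightarrow> z \<in> E \<Longrightarrow> Pf b z = pf z \<bullet> b"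
    using ext[OF Lf] by metis
  obtain Pg where Pg: "\<And>b. b \<in> Basis \<Longrightarrow> (6 * C)-lipschitz_on UNIV (Pg b)"
    "\<And>b z. b \<in> Basis \<Longrightarrow> z \<in> E \<Longrightarrow> Pg b z = pg z \<bullet> b"
    using ext[OF Lg] by metis
  \<comment> \<open>The distance to \<open>E\<close> joins the list of functions to be
    differentiated. At a point of \<open>E\<close> it is minimal, so its derivative there vanishes:
    \<open>E\<close> comes relatively close to every nearby point. This plays the part of a density
    theorem.\<close>
  have dE: "1-lipschitz_on UNIV (\<lambda>z. infdist z E)"
    by (rule lipschitz_onI) (auto simp: dist_real_def infdist_triangle_abs)
  define N where "N = {z. \<not> (\<lambda>z. infdist z E) differentiable (at z)} \<union>
     (\<Union>b\<in>Basis. {z. \<not> Pf b differentiable (at z)}) \<union> (\<Union>b\<in>Basis. {z. \<not> Pg b differentiable (at z)})"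
  have "negligible N" unfolding N_def
    by (intro negligible_Un negligible_Union finite_imageI finite_Basis) (auto intro: Rademacher dE Pf Pg)
  then obtain z where zE: "z \<in> E" and zN: "z \<notin> N" using notneg negligible_subset by blast
  have zb: "z \<in> ball a \<rho>" using zE EB by blast
  have Eclose: "\<forall>\<^sub>F w in nhds z. \<exists>y\<in>E. norm (w - y) \<le> e * norm (w - z)" if e: "0 < e" for e
  proof -
    obtain D where D: "((\<lambda>z. infdist z E) has_derivative D) (at z)" using zN by (auto simp: N_def differentiable_def)
    have iz: "infdist z E = 0" using zE by simp
    have "D = (\<lambda>_. 0)"
    proof (rule differential_zero_maxmin[OF _ open_UNIV D])
      show "(\<forall>y\<in>UNIV. infdist y E \<le> infdist z E) \<or> (\<forall>y\<in>UNIV. infdist z E \<le> infdist y E)"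
        using iz infdist_nonneg by auto
    qed simp
    then have "\<exists>d>0. \<forall>y. norm (y - z) < d \<longrightarrow> norm (infdist y E - 0 - 0) \<le> e / 2 * norm (y - z)"
      using D e iz unfolding has_derivative_at_alt by (metis half_gt_zero)
    then obtain d where d: "0 < d" "\<And>w. norm (w - z) < d \<Longrightarrow> infdist w E \<le> e / 2 * norm (w - z)"
      unfolding real_norm_def diff_0_right abs_of_nonneg[OF infdist_nonneg] by blast
    have "\<exists>y\<in>E. norm (w - y) \<le> e * norm (w - z)" if w: "dist w z < d" for w
    proof (cases "w = z")
      case False
      then have "0 < e * norm (w - z)" using e by simp
      then have "infdist w E < e * norm (w - z)" using d(2)[of w] w by (simp add: dist_norm)
      then have "\<exists>y\<in>E. dist w y < e * norm (w - z)"
        using zE cINF_less_iff[of E "dist w"] unfolding infdist_def by (auto split: if_splits)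
      then show ?thesis by (auto simp: dist_norm intro: less_imp_le)
    qed (use zE in auto)
    then show ?thesis unfolding eventually_nhds_metric using d(1) by blast
  qed
  \<comment> \<open>The extensions agree with the slopes only on \<open>E\<close>. A nearby
    \<open>w\<close> has a point of \<open>E\<close> at distance at most
    \<open>e / c * norm (w - z)\<close>, and moving to it changes slope and extension by controlled
    amounts, so the derivative of the extension is also that of the slopes, through all points near
    \<open>z\<close>.\<close>
  have slopes_diff: "\<exists>A. linear A \<and> (\<forall>e>0. \<forall>\<^sub>F y in nhds z. norm (s y - s z - A (y - z)) \<le> e * norm (y - z))"
    if s: "\<And>y z. z \<in> E \<Longrightarrow> y \<in> ball a \<rho> \<Longrightarrow> norm (s y - s z) \<le> 6 * C * norm (y - z)"
      and P: "\<And>b. b \<in> Basis \<Longrightarrow> (6 * C)-lipschitz_on UNIV (P b)"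
        "\<And>b z. b \<in> Basis \<Longrightarrow> z \<in> E \<Longrightarrow> P b z = s z \<bullet> b"
      and dP: "\<And>b. b \<in> Basis \<Longrightarrow> P b differentiable (at z)"
    for s :: "'a \<Rightarrow> 'a" and P
  proof -
    define Q where "Q y = (\<Sum>b\<in>Basis. P b y *\<^sub>R b)" for y
    have QE: "Q y = s y" if "y \<in> E" for y
      using P(2) that by (simp add: Q_def euclidean_representation)
    have Qlip: "norm (Q x - Q y) \<le> real DIM('a) * (6 * C) * norm (x - y)" for x y
    proof -
      have "norm (Q x - Q y) \<le> (\<Sum>b\<in>Basis. \<bar>P b x - P b y\<bar>)"
        unfolding Q_def sum_subtractf[symmetric] scaleR_diff_left[symmetric]
        by (rule order_trans[OF norm_sum]) auto
      also have "\<dots> \<le> (\<Sum>b\<in>(Basis::'a set). 6 * C * norm (x - y))"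
        using P(1) by (intro sum_mono) (auto simp: lipschitz_on_def dist_norm)
      finally show ?thesis by simp
    qed
    obtain D where D: "\<And>b. b \<in> Basis \<Longrightarrow> (P b has_derivative D b) (at z)" using dP unfolding differentiable_def by metis
    define A where "A h = (\<Sum>b\<in>Basis. D b h *\<^sub>R b)" for h
    have QD: "(Q has_derivative A) (at z)" unfolding Q_def[abs_def] A_def[abs_def]
      by (intro has_derivative_sum has_derivative_scaleR_left D)
    have "\<forall>\<^sub>F y in nhds z. norm (s y - s z - A (y - z)) \<le> e * norm (y - z)" if e: "0 < e" for e
    proof -
      \<comment> \<open>Twice the sum of the two Lipschitz constants involved, so that the detour
        through \<open>E\<close> costs half of \<open>e\<close>; the added 1 covers
        \<open>C = 0\<close>.\<close>
      define c where "c = 2 * (6 * C + real DIM('a) * (6 * C) + 1)"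
      have c: "0 < c" using C by (simp add: c_def add_nonneg_pos)
      have "\<forall>\<^sub>F y in nhds z. norm (Q y - Q z - A (y - z)) \<le> e / 2 * norm (y - z)"
        using QD e unfolding has_derivative_at_alt eventually_nhds_metric dist_norm by (meson half_gt_zero)
      moreover have "\<forall>\<^sub>F y in nhds z. y \<in> ball a \<rho>" using zb by (intro eventually_nhds_in_open) auto
      moreover have "\<forall>\<^sub>F w in nhds z. \<exists>y\<in>E. norm (w - y) \<le> e / c * norm (w - z)" using Eclose[of "e / c"] e c by (simp only: divide_pos_pos)
      ultimately show ?thesis
      proof eventually_elim
        case (elim w)
        then obtain y where y: "y \<in> E" "norm (w - y) \<le> e / c * norm (w - z)" by blast
        have "norm (s w - Q w) \<le> norm (s w - s y) + norm (Q w - Q y)"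
          using QE[OF y(1)] norm_triangle_ineq4[of "s w - s y" "Q w - Q y"] by simp
        also have "\<dots> \<le> c / 2 * norm (w - y)"
        proof -
          have "norm (s w - s y) + norm (Q w - Q y) \<le> (6 * C + real DIM('a) * (6 * C)) * norm (w - y)"
            using s[OF y(1) elim(2)] Qlip[of w y] unfolding distrib_right by linarith
          also have "\<dots> \<le> c / 2 * norm (w - y)" by (intro mult_right_mono) (auto simp: c_def)
          finally show ?thesis .
        qed
        also have "\<dots> \<le> c / 2 * (e / c * norm (w - z))" using y(2) c by (intro mult_left_mono) auto
        also have "\<dots> = e / 2 * norm (w - z)" using c by simp
        finally have "norm (s w - Q w) \<le> e / 2 * norm (w - z)" .
        then have "norm ((s w - Q w) + (Q w - Q z - A (w - z))) \<le> e / 2 * norm (w - z) + e / 2 * norm (w - z)"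
          using elim(1) by (intro norm_triangle_mono)
        moreover have "(s w - Q w) + (Q w - Q z - A (w - z)) = s w - s z - A (w - z)" using QE[OF zE] by simp
        ultimately show ?case by simp
      qed
    qed
    then show ?thesis using has_derivative_linear[OF QD] by blast
  qed
  obtain A where A: "linear A" "\<And>e. 0 < e \<Longrightarrow> \<forall>\<^sub>F y in nhds z. norm (pf y - pf z - A (y - z)) \<le> e * norm (y - z)"
    using slopes_diff[OF Lf Pf] zN by (auto simp: N_def)
  obtain A' where A': "linear A'" "\<And>e. 0 < e \<Longrightarrow> \<forall>\<^sub>F y in nhds z. norm (pg y - pg z - A' (y - z)) \<le> e * norm (y - z)"
    using slopes_diff[OF Lg Pg] zN by (auto simp: N_def)
  have sub: "ball z \<rho> \<subseteq> ?S"
  proof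
    fix w assume "w \<in> ball z \<rho>"
    then show "w \<in> ?S" using zb \<rho> dist_triangle[of a w z] by (simp add: dist_commute)
  qed
  have exf: "second_order_at f z (pf z) A"
    by (rule second_order_atI[OF A(1) \<rho> pf A(2)]) (use sub in blast)+
  have exg: "second_order_at g z (pg z) A'"
    by (rule second_order_atI[OF A'(1) \<rho> pg A'(2)]) (use sub in blast)+
  \<comment> \<open>\<open>W\<close> stays below its affine contact function, so the sum of the two
    expansions has no positive quadratic part.\<close>
  have neg: "A h \<bullet> h + A' h \<bullet> h \<le> 0" for h
  proof (cases "h = 0")
    case True
    then show ?thesis by simp
  next
    case False
    have "(A h \<bullet> h + A' h \<bullet> h) / 2 \<le> 2 * e * (norm h)\<^sup>2" if e: "0 < e" for e
    proof -
      have "\<forall>\<^sub>F w in nhds z. w \<in> ball z \<rho> \<and> \<bar>f w - f z - pf z \<bullet> (w - z) - A (w - z) \<bullet> (w - z) / 2\<bar> \<le> e * (norm (w - z))\<^sup>2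
         \<and> \<bar>g w - g z - pg z \<bullet> (w - z) - A' (w - z) \<bullet> (w - z) / 2\<bar> \<le> e * (norm (w - z))\<^sup>2"
        using second_order_atD(2)[OF exf e] second_order_atD(2)[OF exg e] \<rho> by (intro eventually_conj eventually_nhds_in_open) auto
      then obtain d where d: "0 < d" "\<And>w. dist w z < d \<Longrightarrow> w \<in> ball z \<rho> \<and> \<bar>f w - f z - pf z \<bullet> (w - z) - A (w - z) \<bullet> (w - z) / 2\<bar> \<le> e * (norm (w - z))\<^sup>2
         \<and> \<bar>g w - g z - pg z \<bullet> (w - z) - A' (w - z) \<bullet> (w - z) / 2\<bar> \<le> e * (norm (w - z))\<^sup>2"
        unfolding eventually_nhds_metric by blast
      define t where "t = d / (2 * norm h)"
      have t: "0 < t" "t * norm h < d" using d(1) False by (auto simp: t_def)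
      define w where "w = z + t *\<^sub>R h"
      have wz: "w - z = t *\<^sub>R h" by (simp add: w_def)
      have dw: "dist w z < d" using t by (simp add: dist_norm wz)
      have "W w \<le> W z + (pf z + pg z) \<bullet> (w - z)" using upW[OF zE] d(2)[OF dw] sub by blast
      then have "A (w - z) \<bullet> (w - z) / 2 + A' (w - z) \<bullet> (w - z) / 2 \<le> 2 * (e * (norm (w - z))\<^sup>2)"
        using d(2)[OF dw] by (simp add: W_def inner_add_left abs_le_iff)
      then have "t\<^sup>2 * ((A h \<bullet> h + A' h \<bullet> h) / 2) \<le> t\<^sup>2 * (2 * e * (norm h)\<^sup>2)"
        unfolding wz linear_scale[OF A(1)] linear_scale[OF A'(1)]
        by (simp add: power_mult_distrib power2_eq_square algebra_simps)
      then show ?thesis using t(1) by simp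
    qed
    then have ev: "\<forall>\<^sub>F e in at_right 0. (A h \<bullet> h + A' h \<bullet> h) / 2 \<le> 2 * e * (norm h)\<^sup>2"
      using eventually_at_right_real[of 0 1] by (auto elim!: eventually_mono)
    have "(A h \<bullet> h + A' h \<bullet> h) / 2 \<le> 2 * 0 * (norm h)\<^sup>2"
      by (rule tendsto_le[OF trivial_limit_at_right_real _ tendsto_const ev]) (intro tendsto_intros)
    then show ?thesis by simp
  qed
  have "norm (pf z + pg z) \<le> r" using zE sumq by (auto simp: E_def con_def)
  then show ?thesis using zb exf exg neg unfolding r_def
    by (intro bexI[of _ z] exI[of _ "pf z"] exI[of _ "pg z"] exI[of _ A] exI[of _ A']) auto
qed

text \<open>Subtracting \<open>c * (norm (z - a))\<^sup>2\<close> from \<open>f\<close> turns the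
  approximate maximum into a strict one: outside the ball of radius \<rho> it removes at least
  2\<kappa> against a possible excess \<kappa>. The price is at most \<open>2 * c * \<rho>\<close>
  in the slope and \<open>2 * c\<close> in the quadratic form. The resulting bounds are free of
  \<open>C\<close>, which blows up as \<epsilon> tends to 0 in the application.\<close>

theorem Jensen_approximate_max:
  fixes f g :: "'a::euclidean_space \<Rightarrow> real"
  assumes \<rho>: "0 < \<rho>" and C: "0 \<le> C" and \<kappa>: "0 < \<kappa>"
    and cont: "continuous_on (cball a (3 * \<rho>)) f" "continuous_on (cball a (3 * \<rho>)) g"
    and lowf: "\<And>z. z \<in> cball a (3 * \<rho>) \<Longrightarrow> \<exists>p. \<forall>w\<in>cball a (3 * \<rho>). f w \<ge> f z + p \<bullet> (w - z) - C * (norm (w - z))\<^sup>2"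
    and lowg: "\<And>z. z \<in> cball a (3 * \<rho>) \<Longrightarrow> \<exists>p. \<forall>w\<in>cball a (3 * \<rho>). g w \<ge> g z + p \<bullet> (w - z) - C * (norm (w - z))\<^sup>2"
    and mx: "\<And>z. z \<in> cball a (3 * \<rho>) \<Longrightarrow> f z + g z \<le> f a + g a + \<kappa>"
  shows "\<exists>z\<in>ball a \<rho>. \<exists>p q A A'. second_order_at f z p A \<and> second_order_at g z q A' \<and>
     norm (p + q) \<le> 5 * \<kappa> / \<rho> \<and> (\<forall>h. A h \<bullet> h + A' h \<bullet> h \<le> 4 * \<kappa> / \<rho>\<^sup>2 * (norm h)\<^sup>2)"
proof -
  define c where "c = 2 * \<kappa> / \<rho>\<^sup>2"
  have c: "0 < c" using \<kappa> \<rho> by (simp add: c_def)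
  have c\<rho>: "c * \<rho>\<^sup>2 = 2 * \<kappa>" "c * \<rho> = 2 * \<kappa> / \<rho>" using \<rho> by (auto simp: c_def power2_eq_square)
  define f' where "f' z = f z - c * (norm (z - a))\<^sup>2" for z
  have quad: "(norm (w - a))\<^sup>2 = (norm (z - a))\<^sup>2 + 2 * ((z - a) \<bullet> (w - z)) + (norm (w - z))\<^sup>2" for w z
    using dot_norm[of "z - a" "w - z"] by (simp add: field_simps)
  have "\<exists>z\<in>ball a \<rho>. \<exists>p q A A'. second_order_at f' z p A \<and> second_order_at g z q A' \<and>
     norm (p + q) \<le> \<kappa> / (4 * \<rho>) \<and> (\<forall>h. A h \<bullet> h + A' h \<bullet> h \<le> 0)"
  proof (rule Jensen_strict[where C = "C + c"])
    show "continuous_on (cball a (3 * \<rho>)) f'" unfolding f'_def[abs_def] by (intro continuous_intros cont)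
    show "\<exists>p. \<forall>w\<in>cball a (3 * \<rho>). f' z + p \<bullet> (w - z) - (C + c) * (norm (w - z))\<^sup>2 \<le> f' w"
      if z: "z \<in> cball a (3 * \<rho>)" for z
    proof -
      obtain p where p: "\<forall>w\<in>cball a (3 * \<rho>). f w \<ge> f z + p \<bullet> (w - z) - C * (norm (w - z))\<^sup>2" using lowf[OF z] by blast
      show ?thesis
      proof (intro exI[of _ "p - (2 * c) *\<^sub>R (z - a)"] ballI)
        fix w assume "w \<in> cball a (3 * \<rho>)"
        then have "f w \<ge> f z + p \<bullet> (w - z) - C * (norm (w - z))\<^sup>2" using p by blast
        then show "f' z + (p - (2 * c) *\<^sub>R (z - a)) \<bullet> (w - z) - (C + c) * (norm (w - z))\<^sup>2 \<le> f' w"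
          unfolding f'_def quad[of w z] by (simp add: inner_diff_left[of p] distrib_left distrib_right)
      qed
    qed
    show "\<exists>p. \<forall>w\<in>cball a (3 * \<rho>). g z + p \<bullet> (w - z) - (C + c) * (norm (w - z))\<^sup>2 \<le> g w"
      if z: "z \<in> cball a (3 * \<rho>)" for z
    proof -
      have "g z + p \<bullet> (w - z) - (C + c) * (norm (w - z))\<^sup>2 \<le> g z + p \<bullet> (w - z) - C * (norm (w - z))\<^sup>2" for p w
        using c by (simp add: distrib_right)
      then show ?thesis using lowg[OF z] order_trans by meson
    qed
    show "f' z + g z \<le> f' a + g a - \<kappa>" if z: "z \<in> cball a (3 * \<rho>) - ball a \<rho>" for z
    proof -
      have "\<rho>\<^sup>2 \<le> (norm (z - a))\<^sup>2" using z \<rho> by (intro power_mono) (auto simp: dist_norm norm_minus_commute)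
      then have "c * \<rho>\<^sup>2 \<le> c * (norm (z - a))\<^sup>2" using c by simp
      then show ?thesis using mx[of z] z c\<rho>(1) by (simp add: f'_def)
    qed
  qed (use \<rho> C \<kappa> c cont in auto)
  then obtain z p q A A' where z: "z \<in> ball a \<rho>" and exf: "second_order_at f' z p A"
    and exg: "second_order_at g z q A'"
    and pq: "norm (p + q) \<le> \<kappa> / (4 * \<rho>)" and neg: "\<And>h. A h \<bullet> h + A' h \<bullet> h \<le> 0" by blast
  note lin = second_order_atD(1)[OF exf]
  define B where "B h = A h + (2 * c) *\<^sub>R h" for h
  have B: "linear B" unfolding B_def[abs_def]
    by (intro linearI) (simp_all add: linear_add[OF lin] linear_scale[OF lin] algebra_simps)
  show ?thesis
  proof (rule bexI[OF _ z], rule exI[of _ "p + (2 * c) *\<^sub>R (z - a)"], rule exI[of _ q], rule exI[of _ B], rule exI[of _ A'], intro conjI exg, goal_cases)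
    case 1
    show ?case unfolding second_order_at_def
    proof (intro conjI allI impI B)
      fix e :: real assume "0 < e"
      from second_order_atD(2)[OF exf this] show "\<forall>\<^sub>F w in nhds z. \<bar>f w - f z - (p + (2 * c) *\<^sub>R (z - a)) \<bullet> (w - z) - B (w - z) \<bullet> (w - z) / 2\<bar> \<le> e * (norm (w - z))\<^sup>2"
      proof eventually_elim
        case (elim w)
        have "f w - f z - (p + (2 * c) *\<^sub>R (z - a)) \<bullet> (w - z) - B (w - z) \<bullet> (w - z) / 2
          = f' w - f' z - p \<bullet> (w - z) - A (w - z) \<bullet> (w - z) / 2"
          unfolding f'_def quad[of w z] B_def
          by (simp add: inner_add_left dot_square_norm distrib_left add_divide_distrib)
        then show ?case using elim by simp
      qed
    qed
  next
    case 2
    have "norm (p + (2 * c) *\<^sub>R (z - a) + q) \<le> norm (p + q) + norm ((2 * c) *\<^sub>R (z - a))"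
      using norm_triangle_ineq[of "p + q" "(2 * c) *\<^sub>R (z - a)"] by (simp add: algebra_simps)
    also have "\<dots> \<le> norm (p + q) + 2 * c * \<rho>" using z c by (simp add: dist_norm norm_minus_commute)
    also have "norm (p + q) + 2 * c * \<rho> \<le> \<kappa> / (4 * \<rho>) + 4 * \<kappa> / \<rho>" using pq c\<rho>(2) by simp
    also have "\<dots> \<le> 5 * \<kappa> / \<rho>" using \<kappa> \<rho> by (simp add: field_simps)
    finally show ?case by simp
  next
    case 3
    have "B h \<bullet> h + A' h \<bullet> h \<le> 4 * \<kappa> / \<rho>\<^sup>2 * (norm h)\<^sup>2" for h
      using neg[of h] by (simp add: B_def inner_add_left dot_square_norm c_def)
    then show ?case by blast
  qed
qed

section \<open>Diffeomorphisms and characteristics\<close>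

lemma grad_eqI:
  assumes "(f has_derivative (\<lambda>h. h \<bullet> g)) (at x)"
  shows "grad f x = g"
  using frechet_derivative_at[OF assms, symmetric]
  by (simp add: grad_def vec_eq_iff inner_axis' )

lemma hess_eqI:
  assumes "(grad f has_derivative (\<lambda>h. A *v h)) (at x)"
  shows "hess f x = A"
  using frechet_derivative_at[OF assms, symmetric] by (simp add: hess_def jacobian_def)

lemma C1_funI:
  assumes "\<And>x. (f has_derivative blinfun_apply (f' x)) (at x)" "continuous_on UNIV f'"
  shows "C1_fun f"
  using assms unfolding C1_fun_def by blast

lemma C1_fun_continuous: "C1_fun f \<Longrightarrow> continuous_on S f"
  unfolding C1_fun_def by (meson continuous_at_imp_continuous_on has_derivative_continuous)

lemma C1_fun_compose:
  assumes "C1_fun f" "C1_fun g"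
  shows "C1_fun (\<lambda>x. f (g x))"
proof -
  obtain f' where f: "\<And>x. (f has_derivative blinfun_apply (f' x)) (at x)" "continuous_on UNIV f'"
    using assms(1) by (auto simp: C1_fun_def)
  obtain g' where g: "\<And>x. (g has_derivative blinfun_apply (g' x)) (at x)" "continuous_on UNIV g'"
    using assms(2) by (auto simp: C1_fun_def)
  show ?thesis
  proof (rule C1_funI)
    show "((\<lambda>x. f (g x)) has_derivative blinfun_apply (f' (g x) o\<^sub>L g' x)) (at x)" for x
      using has_derivative_compose[OF g(1)[of x] f(1)] unfolding blinfun_compose.rep_eq o_def .
    show "continuous_on UNIV (\<lambda>x. f' (g x) o\<^sub>L g' x)"
      by (intro continuous_intros continuous_on_compose2[OF f(2)] g(2) C1_fun_continuous[OF assms(2)]) auto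
  qed
qed

lemma C1_fun_bounded_linear:
  assumes "bounded_linear f"
  shows "C1_fun f"
  by (rule C1_funI[where f' = "\<lambda>_. Blinfun f"])
    (auto simp: bounded_linear_Blinfun_apply[OF assms] intro: bounded_linear_imp_has_derivative assms)

lemma C1_fun_const: "C1_fun (\<lambda>_. c)"
  by (rule C1_funI[where f' = "\<lambda>_. 0"]) (auto simp: zero_blinfun.rep_eq)

lemma C1_fun_add:
  assumes "C1_fun f" "C1_fun g"
  shows "C1_fun (\<lambda>x. f x + g x)"
proof -
  obtain f' where f: "\<And>x. (f has_derivative blinfun_apply (f' x)) (at x)" "continuous_on UNIV f'"
    using assms(1) by (auto simp: C1_fun_def)
  obtain g' where g: "\<And>x. (g has_derivative blinfun_apply (g' x)) (at x)" "continuous_on UNIV g'"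
    using assms(2) by (auto simp: C1_fun_def)
  show ?thesis
  proof (rule C1_funI)
    show "((\<lambda>x. f x + g x) has_derivative blinfun_apply (f' x + g' x)) (at x)" for x
      using has_derivative_add[OF f(1) g(1)] by (simp add: plus_blinfun.rep_eq)
    show "continuous_on UNIV (\<lambda>x. f' x + g' x)" by (intro continuous_intros f g)
  qed
qed

lemma C1_fun_scaleR:
  fixes f :: "'a::real_normed_vector \<Rightarrow> real" and g :: "'a \<Rightarrow> 'b::real_normed_vector"
  assumes "C1_fun f" "C1_fun g"
  shows "C1_fun (\<lambda>x. f x *\<^sub>R g x)"
proof -
  obtain f' where f: "\<And>x. (f has_derivative blinfun_apply (f' x)) (at x)" "continuous_on UNIV f'"
    using assms(1) by (auto simp: C1_fun_def)
  obtain g' where g: "\<And>x. (g has_derivative blinfun_apply (g' x)) (at x)" "continuous_on UNIV g'"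
    using assms(2) by (auto simp: C1_fun_def)
  show ?thesis
  proof (rule C1_funI)
    show "((\<lambda>x. f x *\<^sub>R g x) has_derivative blinfun_apply (f x *\<^sub>R g' x + (blinfun_scaleR_left (g x) o\<^sub>L f' x))) (at x)" for x
      using has_derivative_scaleR[OF f(1)[of x] g(1)[of x]]
      by (simp add: plus_blinfun.rep_eq scaleR_blinfun.rep_eq o_def)
    show "continuous_on UNIV (\<lambda>x. f x *\<^sub>R g' x + (blinfun_scaleR_left (g x) o\<^sub>L f' x))"
      by (intro continuous_intros C1_fun_continuous assms f g)
  qed
qed

lemma C1_fun_sum:
  assumes "\<And>i. i \<in> I \<Longrightarrow> C1_fun (f i)"
  shows "C1_fun (\<lambda>x. \<Sum>i\<in>I. f i x)"
  using assms by (induction I rule: infinite_finite_induct) (auto intro: C1_fun_const C1_fun_add)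

lemma C1_fun_real:
  fixes f :: "real \<Rightarrow> real"
  assumes "\<And>x. (f has_field_derivative f' x) (at x)" "continuous_on UNIV f'"
  shows "C1_fun f"
proof (rule C1_funI)
  show "(f has_derivative blinfun_apply (blinfun_mult_right (f' x))) (at x)" for x
    using assms(1)[of x] by (simp add: has_field_derivative_def)
  show "continuous_on UNIV (\<lambda>x. blinfun_mult_right (f' x))"
    by (intro bounded_linear.continuous_on[OF bounded_linear_blinfun_mult_right] assms)
qed

lemma C1_fun_vec:
  fixes f :: "'a::real_normed_vector \<Rightarrow> real^'n"
  assumes "\<And>i. C1_fun (\<lambda>x. f x $ i)"
  shows "C1_fun f"
proof -
  have "f = (\<lambda>x. \<Sum>i\<in>UNIV. f x $ i *\<^sub>R axis i 1)"
    by (auto simp: basis_expansion scalar_mult_eq_scaleR[symmetric] fun_eq_iff)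
  moreover have "C1_fun (\<lambda>x. \<Sum>i\<in>UNIV. f x $ i *\<^sub>R axis i (1::real) :: real^'n)"
    by (intro C1_fun_sum C1_fun_scaleR C1_fun_const assms)
  ultimately show ?thesis by simp
qed

lemma lipschitz_derivative_bound:
  assumes lip: "L-lipschitz_on UNIV G" and D: "(G has_derivative D) (at x)"
  shows "norm (D h) \<le> L * norm h"
proof (cases "h = 0")
  case True
  then show ?thesis using D has_derivative_bounded_linear linear_simps(3) by fastforce
next
  case False
  interpret D: bounded_linear D using D by (rule has_derivative_bounded_linear)
  have "norm (D h) \<le> L * norm h + e * norm h" if e: "0 < e" for e
  proof -
    obtain d where d: "0 < d" "\<And>y. norm (y - x) < d \<Longrightarrow> norm (G y - G x - D (y - x)) \<le> e * norm (y - x)"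
      using D e unfolding has_derivative_at_alt by blast
    define t where "t = d / (2 * norm h)"
    have t: "0 < t" "t * norm h < d" using d(1) False by (auto simp: t_def)
    have "norm (G (x + t *\<^sub>R h) - G x - D (t *\<^sub>R h)) \<le> e * (t * norm h)"
      using d(2)[of "x + t *\<^sub>R h"] t by simp
    moreover have "norm (G (x + t *\<^sub>R h) - G x) \<le> L * (t * norm h)"
      using lipschitz_onD[OF lip, of "x + t *\<^sub>R h" x] t by (simp add: dist_norm)
    ultimately have "norm (D (t *\<^sub>R h)) \<le> L * (t * norm h) + e * (t * norm h)"
      using norm_triangle_sub[of "D (t *\<^sub>R h)" "G (x + t *\<^sub>R h) - G x"] by (simp add: norm_minus_commute)
    then have "t * norm (D h) \<le> t * (L * norm h + e * norm h)" using t by (simp add: D.scaleR algebra_simps)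
    then show ?thesis using t by simp
  qed
  then have ev: "\<forall>\<^sub>F e in at_right 0. norm (D h) \<le> L * norm h + e * norm h"
    using eventually_at_right_real[of 0 1] by (auto elim!: eventually_mono)
  have "norm (D h) \<le> L * norm h + 0 * norm h"
    by (rule tendsto_le[OF trivial_limit_at_right_real _ tendsto_const ev]) (intro tendsto_intros)
  then show ?thesis by simp
qed

text \<open>Solving x - G x = y is a fixed point problem for a contraction, which gives bijectivity;
  expansion of distances by at least 1/2 makes the inverse 2-Lipschitz, and the same bound for the
  derivative makes that invertible.\<close>

lemma C1_diffeomorphism_contraction_perturbation:
  fixes G :: "'a::euclidean_space \<Rightarrow> 'a"
  assumes C1: "C1_fun G" and lip: "(1/2)-lipschitz_on UNIV G"
  shows "C1_diffeomorphism (\<lambda>x. x - G x)"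
proof -
  obtain G' where G: "\<And>x. (G has_derivative blinfun_apply (G' x)) (at x)" "continuous_on UNIV G'"
    using C1 by (auto simp: C1_fun_def)
  define X where "X x = x - G x" for x
  define X' where "X' x = id_blinfun - G' x" for x
  have X: "(X has_derivative blinfun_apply (X' x)) (at x)" for x
    unfolding X_def[abs_def] X'_def using has_derivative_diff[OF has_derivative_ident G(1)[of x]]
    by (simp add: minus_blinfun.rep_eq)
  have X'c: "continuous_on UNIV X'" unfolding X'_def[abs_def] by (intro continuous_intros G)
  have lower: "dist x y / 2 \<le> dist (X x) (X y)" for x y
  proof -
    have "norm (x - y) \<le> norm (X x - X y) + norm (G x - G y)"
      using norm_triangle_ineq[of "X x - X y" "G x - G y"] by (simp add: X_def)
    moreover have "norm (G x - G y) \<le> 1/2 * norm (x - y)" using lipschitz_onD[OF lip, of x y] by (simp add: dist_norm)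
    ultimately show ?thesis by (simp add: dist_norm)
  qed
  have inj: "inj X"
  proof (rule injI)
    fix x y assume "X x = X y"
    then show "x = y" using lower[of x y] by simp
  qed
  have "\<exists>x. X x = y" for y
  proof -
    have "\<exists>!x. G x + y = x"
      by (rule banach_fix_type[of "1/2"]) (use lipschitz_onD[OF lip] in \<open>auto simp: dist_norm\<close>)
    then show ?thesis unfolding X_def by (metis add_diff_cancel_left')
  qed
  then have surj: "surj X" by (metis surjI)
  define Y where "Y = inv X"
  have XY: "X (Y y) = y" for y using surj by (simp add: Y_def surj_f_inv_f)
  have YX: "Y (X x) = x" for x using inj by (simp add: Y_def)
  have Ylip: "2-lipschitz_on UNIV Y"
    by (rule lipschitz_onI) (use lower[of "Y _" "Y _"] XY in \<open>auto simp: field_simps\<close>)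
  have low': "norm h / 2 \<le> norm (X' x h)" for x h
    using lipschitz_derivative_bound[OF lip G(1)[of x], of h] norm_triangle_ineq2[of h "G' x h"]
    by (simp add: X'_def minus_blinfun.rep_eq)
  have "\<exists>T. (\<forall>h. blinfun_apply T (X' x h) = h) \<and> (\<forall>h. X' x (blinfun_apply T h) = h)" for x
  proof -
    have lin: "linear (blinfun_apply (X' x))" by (simp add: linear_conv_bounded_linear blinfun.bounded_linear_right)
    have inj': "inj (blinfun_apply (X' x))"
    proof (rule injI)
      fix h k assume "X' x h = X' x k"
      then show "h = k" using low'[of "h - k" x] by (simp add: blinfun.diff_right)
    qed
    obtain g where g: "linear g" "g \<circ> blinfun_apply (X' x) = id"
      using linear_injective_left_inverse[OF lin inj'] by blast
    have gX: "g (X' x h) = h" for h using g(2) by (metis comp_apply id_apply)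
    have "X' x (g h) = h" for h
    proof -
      obtain k where "h = X' x k" using linear_injective_imp_surjective[OF lin inj'] by (metis surjD)
      then show ?thesis using gX by simp
    qed
    moreover have "blinfun_apply (Blinfun g) = g"
      using g(1) by (intro bounded_linear_Blinfun_apply) (simp add: linear_conv_bounded_linear)
    ultimately show ?thesis using gX by (intro exI[of _ "Blinfun g"]) auto
  qed
  then obtain J where JX: "\<And>x h. blinfun_apply (J x) (X' x h) = h" "\<And>x h. X' x (blinfun_apply (J x) h) = h"
    by metis
  have Jn: "norm (J x h) \<le> 2 * norm h" for x h using low'[of "J x h" x] JX by simp
  \<comment> \<open>The resolvent identity: J x - J y is J x composed with X' y - X' x and J y. It
    passes continuity from \<open>X'\<close> to the inverse derivatives.\<close>
  have Jlip: "norm (J x - J y) \<le> 4 * norm (X' x - X' y)" for x y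
  proof (rule norm_blinfun_bound)
    fix h
    have "(J x - J y) h = J x ((X' y - X' x) (J y h))"
      by (simp add: minus_blinfun.rep_eq blinfun.diff_right JX)
    then have "norm ((J x - J y) h) \<le> 2 * norm ((X' y - X' x) (J y h))" using Jn by simp
    also have "\<dots> \<le> 2 * (norm (X' y - X' x) * norm (J y h))" by (intro mult_left_mono norm_blinfun) auto
    also have "\<dots> \<le> 2 * (norm (X' y - X' x) * (2 * norm h))" by (intro mult_left_mono Jn) auto
    finally show "norm ((J x - J y) h) \<le> 4 * norm (X' x - X' y) * norm h" by (simp add: norm_minus_commute)
  qed auto
  have Jc: "continuous_on UNIV J"
    unfolding continuous_on_iff
  proof (intro ballI allI impI)
    fix x :: 'a and e :: real assume "0 < e"
    then obtain d where d: "d > 0" "\<And>y. dist y x < d \<Longrightarrow> dist (X' y) (X' x) < e / 4"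
      using X'c unfolding continuous_on_iff by (metis UNIV_I divide_pos_pos zero_less_numeral)
    then show "\<exists>d>0. \<forall>x'\<in>UNIV. dist x' x < d \<longrightarrow> dist (J x') (J x) < e"
      using Jlip by (intro exI[of _ d]) (fastforce simp: dist_norm intro: le_less_trans)
  qed
  have "C1_fun Y"
  proof (rule C1_funI)
    show "(Y has_derivative blinfun_apply (J (Y y))) (at y)" for y
    proof (rule has_derivative_inverse_basic[OF X, where T = UNIV])
      show "bounded_linear (blinfun_apply (J (Y y)))" by (rule blinfun.bounded_linear_right)
      show "blinfun_apply (J (Y y)) \<circ> blinfun_apply (X' (Y y)) = id" using JX by (auto simp: fun_eq_iff)
      show "continuous (at y) Y"
        using lipschitz_on_continuous_on[OF Ylip] by (simp add: continuous_on_eq_continuous_at)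
    qed (use XY in auto)
    show "continuous_on UNIV (\<lambda>y. J (Y y))"
      by (intro continuous_on_compose2[OF Jc] lipschitz_on_continuous_on[OF Ylip]) auto
  qed
  moreover have "C1_fun X" by (rule C1_funI[OF X X'c])
  ultimately show ?thesis using inj surj by (simp add: C1_diffeomorphism_def bij_def X_def[abs_def] Y_def)
qed

section \<open>The noise-weighted gradient of the Hamiltonian, and characteristics\<close>

definition Hgrad :: "(real^'d \<Rightarrow> real^'m) \<Rightarrow> real^'m \<Rightarrow> real^'d \<Rightarrow> real^'d" where
  "Hgrad H b p = (\<Sum>i\<in>UNIV. b $ i *\<^sub>R grad (\<lambda>q. H q $ i) p)"

lemma char_X_Hgrad: "char_X H B t0 \<phi> x t = x - Hgrad H (B t - B t0) (grad \<phi> x)"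
  by (simp add: char_X_def Hgrad_def)

lemma char_U_Hgrad: "char_U H B t0 \<phi> x t = \<phi> x + H (grad \<phi> x) \<bullet> (B t - B t0)
    - Hgrad H (B t - B t0) (grad \<phi> x) \<bullet> grad \<phi> x"
proof -
  have "H (grad \<phi> x) \<bullet> (B t - B t0) - Hgrad H (B t - B t0) (grad \<phi> x) \<bullet> grad \<phi> x =
    (\<Sum>i\<in>UNIV. (H (grad \<phi> x) $ i - grad (\<lambda>p. H p $ i) (grad \<phi> x) \<bullet> grad \<phi> x) * (B t $ i - B t0 $ i))"
    unfolding Hgrad_def inner_sum_left inner_vec_def[of "H _"] sum_subtractf[symmetric]
    by (rule sum.cong) (simp_all add: algebra_simps)
  then show ?thesis by (simp add: char_U_def)
qed

lemma grad_works:
  assumes "f differentiable (at x)"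
  shows "(f has_derivative (\<lambda>h. h \<bullet> grad f x)) (at x)"
proof -
  obtain D where D: "(f has_derivative D) (at x)" using assms by (auto simp: differentiable_def)
  have lin: "linear D" using D by (rule has_derivative_linear)
  have "D h = h \<bullet> grad f x" for h
  proof -
    have "D h = D (\<Sum>j\<in>UNIV. h $ j *\<^sub>R axis j 1)"
      by (simp add: basis_expansion[of h, unfolded scalar_mult_eq_scaleR])
    also have "\<dots> = h \<bullet> grad f x"
      by (simp add: frechet_derivative_at[OF D, symmetric] linear_sum[OF lin] linear_scale[OF lin]
          grad_def inner_vec_def)
    finally show ?thesis .
  qed
  then have "D = (\<lambda>h. h \<bullet> grad f x)" by auto
  then show ?thesis using D by simp
qed

lemma C2_fun_grad:
  assumes "C2_fun \<phi>"
  shows "C1_fun (grad \<phi>)" "(\<phi> has_derivative (\<lambda>h. h \<bullet> grad \<phi> x)) (at x)"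
proof -
  obtain \<phi>' where \<phi>: "\<And>x. (\<phi> has_derivative blinfun_apply (\<phi>' x)) (at x)" "C1_fun \<phi>'"
    using assms unfolding C2_fun_def by blast
  have D: "(\<phi> has_derivative (\<lambda>h. h \<bullet> grad \<phi> x)) (at x)" for x
    using \<phi>(1) grad_works by (auto simp: differentiable_def)
  show "(\<phi> has_derivative (\<lambda>h. h \<bullet> grad \<phi> x)) (at x)" by (rule D)
  have g: "grad \<phi> x $ i = blinfun_apply (\<phi>' x) (axis i 1)" for x i
    using has_derivative_unique[OF \<phi>(1) D, of x] by (simp add: inner_axis')
  show "C1_fun (grad \<phi>)"
    by (rule C1_fun_vec) (simp add: g, intro C1_fun_compose[OF C1_fun_bounded_linear[OF blinfun.bounded_linear_left]] \<phi>(2))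
qed

lemma C2_fun_bounded_linear_compose:
  assumes L: "bounded_linear L" and f: "C2_fun f"
  shows "C2_fun (\<lambda>x. L (f x))"
proof -
  obtain f' where f': "\<And>x. (f has_derivative blinfun_apply (f' x)) (at x)" "C1_fun f'"
    using f unfolding C2_fun_def by blast
  show ?thesis unfolding C2_fun_def
  proof (intro exI conjI allI)
    show "((\<lambda>x. L (f x)) has_derivative blinfun_apply (Blinfun L o\<^sub>L f' x)) (at x)" for x
      using bounded_linear.has_derivative[OF L f'(1)[of x]]
      unfolding blinfun_compose.rep_eq bounded_linear_Blinfun_apply[OF L] o_def .
    show "C1_fun (\<lambda>x. Blinfun L o\<^sub>L f' x)"
      by (intro C1_fun_compose[OF C1_fun_bounded_linear[OF bounded_bilinear.bounded_linear_right[OF bounded_bilinear_blinfun_compose]]] f')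
  qed
qed

lemmas C2_fun_component = C2_fun_bounded_linear_compose[OF bounded_linear_vec_nth]

lemma Hgrad_derivative:
  assumes "C2_fun H"
  shows "((\<lambda>p. H p \<bullet> b) has_derivative (\<lambda>h. h \<bullet> Hgrad H b p)) (at p)"
proof -
  have "((\<lambda>p. \<Sum>i\<in>UNIV. H p $ i * b $ i) has_derivative (\<lambda>h. \<Sum>i\<in>UNIV. (h \<bullet> grad (\<lambda>q. H q $ i) p) * b $ i)) (at p)"
    by (intro has_derivative_sum has_derivative_mult_left C2_fun_grad(2) C2_fun_component assms)
  then show ?thesis by (simp add: inner_vec_def[of "H _"] Hgrad_def inner_sum_right mult.commute)
qed

lemma C1_fun_lipschitz_on_cball:
  fixes f :: "'a::euclidean_space \<Rightarrow> 'b::real_normed_vector"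
  assumes "C1_fun f"
  shows "\<exists>K\<ge>0. K-lipschitz_on (cball 0 R) f \<and> (\<forall>x\<in>cball 0 R. norm (f x) \<le> K)"
proof -
  obtain f' where f: "\<And>x. (f has_derivative blinfun_apply (f' x)) (at x)" "continuous_on UNIV f'"
    using assms by (auto simp: C1_fun_def)
  have bd: "bounded (f' ` cball 0 R)" "bounded (f ` cball 0 R)"
    using compact_imp_bounded compact_continuous_image continuous_on_subset[OF f(2)] C1_fun_continuous[OF assms]
    by (metis compact_cball subset_UNIV)+
  obtain K1 where K1: "\<And>x. x \<in> cball 0 R \<Longrightarrow> norm (f' x) \<le> K1" "0 < K1" using bd(1) unfolding bounded_pos by (metis imageI)
  obtain K2 where K2: "\<And>x. x \<in> cball 0 R \<Longrightarrow> norm (f x) \<le> K2" "0 < K2" using bd(2) unfolding bounded_pos by (metis imageI)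
  have "norm (f x - f y) \<le> K1 * norm (x - y)" if "x \<in> cball 0 R" "y \<in> cball 0 R" for x y
  proof (rule differentiable_bound[OF convex_cball _ _ that])
    show "(f has_derivative blinfun_apply (f' x)) (at x within cball 0 R)" for x
      using f(1) has_derivative_at_withinI by blast
    show "onorm (blinfun_apply (f' x)) \<le> K1" if "x \<in> cball 0 R" for x
      using K1(1)[OF that] by (simp add: norm_blinfun.rep_eq)
  qed
  then have "K1-lipschitz_on (cball 0 R) f" using K1(2) by (auto simp: lipschitz_on_def dist_norm)
  then have "(max K1 K2)-lipschitz_on (cball 0 R) f" by (rule lipschitz_on_mono) auto
  then show ?thesis using K1 K2 by (intro exI[of _ "max K1 K2"]) (auto simp: le_max_iff_disj)
qed

text \<open>With \<open>H\<close> merely C2, constants exist only for momenta in a ball. Their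
  proportionality to \<open>norm b\<close> is the point: with \<open>b\<close> an increment of
  \<open>B\<close>, short times make every noise term small although \<open>B\<close> has no
  derivative.\<close>

lemma Hgrad_bounds:
  fixes H :: "real^'d \<Rightarrow> real^'m"
  assumes "C2_fun H"
  obtains C where "0 \<le> C"
    "\<And>p. p \<in> cball 0 R \<Longrightarrow> norm (H p) \<le> C"
    "\<And>p b. p \<in> cball 0 R \<Longrightarrow> norm (Hgrad H b p) \<le> C * norm b"
    "\<And>p q b. p \<in> cball 0 R \<Longrightarrow> q \<in> cball 0 R \<Longrightarrow> norm (Hgrad H b p - Hgrad H b q) \<le> C * norm b * norm (p - q)"
    "\<And>p q b. p \<in> cball 0 R \<Longrightarrow> q \<in> cball 0 R \<Longrightarrow>
      \<bar>H p \<bullet> b - H q \<bullet> b - (p - q) \<bullet> Hgrad H b q\<bar> \<le> C * norm b * (norm (p - q))\<^sup>2"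
proof -
  have "\<forall>i. \<exists>K\<ge>0. K-lipschitz_on (cball 0 R) (grad (\<lambda>q. H q $ i)) \<and> (\<forall>x\<in>cball 0 R. norm (grad (\<lambda>q. H q $ i) x) \<le> K)"
    using C1_fun_lipschitz_on_cball C2_fun_grad(1)[OF C2_fun_component[OF assms]] by blast
  then obtain K where K: "\<And>i. 0 \<le> K i" "\<And>i. (K i)-lipschitz_on (cball 0 R) (grad (\<lambda>q. H q $ i))"
    "\<And>i x. x \<in> cball 0 R \<Longrightarrow> norm (grad (\<lambda>q. H q $ i) x) \<le> K i" by metis
  define C0 where "C0 = (\<Sum>i\<in>UNIV. K i)"
  have C0: "0 \<le> C0" using K by (auto simp: C0_def intro: sum_nonneg)
  have hb: "norm (Hgrad H b p) \<le> C0 * norm b" if "p \<in> cball 0 R" for p b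
  proof -
    have "norm (Hgrad H b p) \<le> (\<Sum>i\<in>UNIV. norm b * K i)" unfolding Hgrad_def
    proof (rule sum_norm_le)
      show "norm (b $ i *\<^sub>R grad (\<lambda>q. H q $ i) p) \<le> norm b * K i" for i
        using component_le_norm_cart[of b i] K(3)[OF that, of i] by (auto intro!: mult_mono)
    qed
    then show ?thesis by (simp add: C0_def sum_distrib_left mult.commute)
  qed
  have hl: "norm (Hgrad H b p - Hgrad H b q) \<le> C0 * norm b * norm (p - q)" if "p \<in> cball 0 R" "q \<in> cball 0 R" for p q b
  proof -
    have "norm (Hgrad H b p - Hgrad H b q) \<le> (\<Sum>i\<in>UNIV. norm b * (K i * norm (p - q)))"
      unfolding Hgrad_def sum_subtractf[symmetric] scaleR_diff_right[symmetric]
    proof (rule sum_norm_le)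
      show "norm (b $ i *\<^sub>R (grad (\<lambda>q. H q $ i) p - grad (\<lambda>q. H q $ i) q)) \<le> norm b * (K i * norm (p - q))" for i
        using component_le_norm_cart[of b i] lipschitz_onD[OF K(2) that, of i] K(1)[of i] by (auto simp: dist_norm intro!: mult_mono)
    qed
    also have "\<dots> = C0 * norm b * norm (p - q)" by (simp add: C0_def sum_distrib_left sum_distrib_right mult_ac)
    finally show ?thesis .
  qed
  have ht: "\<bar>H p \<bullet> b - H q \<bullet> b - (p - q) \<bullet> Hgrad H b q\<bar> \<le> C0 * norm b * (norm (p - q))\<^sup>2"
    if pq: "p \<in> cball 0 R" "q \<in> cball 0 R" for p q b
  proof -
    \<comment> \<open>Subtracting the tangent at \<open>q\<close> leaves a function whose gradient
      is a difference of values of \<open>Hgrad\<close>, so the mean value estimate on the segment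
      gives the quadratic remainder.\<close>
    define f where "f w = H w \<bullet> b - w \<bullet> Hgrad H b q" for w
    have seg: "w \<in> cball 0 R" if "w \<in> closed_segment p q" for w
      using that pq convex_cball convex_contains_segment subsetD by metis
    have "norm (f p - f q) \<le> (C0 * norm b * norm (p - q)) * norm (p - q)"
    proof (rule differentiable_bound[of "closed_segment p q"])
      show "(f has_derivative (\<lambda>h. h \<bullet> Hgrad H b w - h \<bullet> Hgrad H b q)) (at w within closed_segment p q)" for w
        unfolding f_def[abs_def]
        by (intro has_derivative_diff has_derivative_at_withinI[OF Hgrad_derivative[OF assms]]
            bounded_linear_imp_has_derivative bounded_linear_inner_left)
      show "onorm (\<lambda>h. h \<bullet> Hgrad H b w - h \<bullet> Hgrad H b q) \<le> C0 * norm b * norm (p - q)"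
        if w: "w \<in> closed_segment p q" for w
      proof (rule onorm_le)
        fix h
        have "norm (h \<bullet> Hgrad H b w - h \<bullet> Hgrad H b q) \<le> norm h * norm (Hgrad H b w - Hgrad H b q)"
          using Cauchy_Schwarz_ineq2 by (simp add: inner_diff_right[symmetric])
        also have "\<dots> \<le> norm h * (C0 * norm b * norm (w - q))" using seg[OF w] pq by (intro mult_left_mono hl) auto
        also have "\<dots> \<le> norm h * (C0 * norm b * norm (p - q))"
          using C0 segment_bound(2)[OF w] by (intro mult_left_mono mult_nonneg_nonneg) (auto simp: norm_minus_commute)
        finally show "norm (h \<bullet> Hgrad H b w - h \<bullet> Hgrad H b q) \<le> C0 * norm b * norm (p - q) * norm h" by (simp add: mult.commute)
      qed
    qed auto
    then show ?thesis by (simp add: f_def inner_diff_left power2_eq_square mult_ac algebra_simps)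
  qed
  have "C1_fun H" using assms unfolding C2_fun_def C1_fun_def
    by (meson C1_fun_continuous C1_fun_def)
  then obtain C1 where C1: "0 \<le> C1" "\<And>p. p \<in> cball 0 R \<Longrightarrow> norm (H p) \<le> C1"
    using C1_fun_lipschitz_on_cball by blast
  define C where "C = max C0 C1"
  have le: "C0 * norm b \<le> C * norm b" for b :: "real^'m" by (auto simp: C_def intro!: mult_right_mono)
  show ?thesis
  proof (rule that[of C])
    show "0 \<le> C" using C0 by (simp add: C_def)
    show "norm (H p) \<le> C" if "p \<in> cball 0 R" for p using C1(2)[OF that] by (simp add: C_def)
    show "norm (Hgrad H b p) \<le> C * norm b" if "p \<in> cball 0 R" for p b using hb[OF that, of b] le[of b] by linarith
    show "norm (Hgrad H b p - Hgrad H b q) \<le> C * norm b * norm (p - q)" if "p \<in> cball 0 R" "q \<in> cball 0 R" for p q b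
      using hl[OF that, of b] mult_right_mono[OF le[of b], of "norm (p - q)"] by simp
    show "\<bar>H p \<bullet> b - H q \<bullet> b - (p - q) \<bullet> Hgrad H b q\<bar> \<le> C * norm b * (norm (p - q))\<^sup>2" if "p \<in> cball 0 R" "q \<in> cball 0 R" for p q b
      using ht[OF that, of b] mult_right_mono[OF le[of b], of "(norm (p - q))\<^sup>2"] by simp
  qed
qed

section \<open>Testing with smooth solutions\<close>

text \<open>The sines keep the gradient bounded, so that the characteristics stay diffeomorphic to the identity for
  short times, without changing the 2-jet at \<open>0\<close>.\<close>

definition test_fun :: "real^'d \<Rightarrow> real^'d^'d \<Rightarrow> real^'d \<Rightarrow> real" where
  "test_fun P X k = (\<Sum>i\<in>UNIV. P $ i * k $ i) + (\<Sum>i\<in>UNIV. \<Sum>j\<in>UNIV. X $ i $ j * (sin (k $ i) * sin (k $ j))) / 2"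

definition test_grad :: "real^'d \<Rightarrow> real^'d^'d \<Rightarrow> real^'d \<Rightarrow> real^'d" where
  "test_grad P X k = (\<chi> i. P $ i + cos (k $ i) * (\<Sum>j\<in>UNIV. X $ i $ j * sin (k $ j)))"

lemma test_fun_derivative:
  fixes P :: "real^'d"
  assumes X: "transpose X = X"
  shows "(test_fun P X has_derivative (\<lambda>h. h \<bullet> test_grad P X k)) (at k)"
proof -
  have sym: "X $ i $ j = X $ j $ i" for i j using X by (metis transpose_def vec_lambda_beta)
  have nth: "((\<lambda>k. k $ i) has_derivative (\<lambda>h. h $ i)) (at k)" for i and k :: "real^'d"
    by (rule bounded_linear_imp_has_derivative[OF bounded_linear_vec_nth])
  have "(test_fun P X has_derivative (\<lambda>h. (\<Sum>i\<in>UNIV. P $ i * h $ i) +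
     (\<Sum>i\<in>UNIV. \<Sum>j\<in>UNIV. X $ i $ j * (sin (k $ i) * (h $ j * cos (k $ j)) + (h $ i * cos (k $ i)) * sin (k $ j))) / 2)) (at k)"
    unfolding test_fun_def[abs_def]
    by (intro has_derivative_add has_derivative_sum has_derivative_mult_right bounded_linear.has_derivative[OF bounded_linear_divide]
        has_derivative_mult has_derivative_sin nth)
  moreover have "(\<Sum>i\<in>UNIV. P $ i * h $ i) +
     (\<Sum>i\<in>UNIV. \<Sum>j\<in>UNIV. X $ i $ j * (sin (k $ i) * (h $ j * cos (k $ j)) + (h $ i * cos (k $ i)) * sin (k $ j))) / 2
     = h \<bullet> test_grad P X k" for h
  proof -
    define S where "S = (\<Sum>i\<in>UNIV. \<Sum>j\<in>UNIV. X $ i $ j * ((h $ i * cos (k $ i)) * sin (k $ j)))"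
    have "(\<Sum>i\<in>UNIV. \<Sum>j\<in>UNIV. X $ i $ j * (sin (k $ i) * (h $ j * cos (k $ j)))) = S"
      unfolding S_def by (subst sum.swap) (intro sum.cong refl, subst sym, simp add: mult_ac)
    then have "(\<Sum>i\<in>UNIV. \<Sum>j\<in>UNIV. X $ i $ j * (sin (k $ i) * (h $ j * cos (k $ j)) + (h $ i * cos (k $ i)) * sin (k $ j))) = 2 * S"
      by (simp add: distrib_left sum.distrib S_def)
    moreover have "h \<bullet> test_grad P X k = (\<Sum>i\<in>UNIV. P $ i * h $ i) + S"
      by (simp add: test_grad_def inner_vec_def S_def distrib_left sum.distrib sum_distrib_left mult_ac)
    ultimately show ?thesis by simp
  qed
  ultimately show ?thesis by simp
qed

lemma C1_fun_nth: "C1_fun (\<lambda>k. k $ i)"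
  by (rule C1_fun_bounded_linear[OF bounded_linear_vec_nth])

lemma C1_fun_mult_real:
  fixes f g :: "'a::real_normed_vector \<Rightarrow> real"
  shows "C1_fun f \<Longrightarrow> C1_fun g \<Longrightarrow> C1_fun (\<lambda>x. f x * g x)"
  using C1_fun_scaleR[of f g] by simp

lemma C1_fun_sin: "C1_fun (sin :: real \<Rightarrow> real)" and C1_fun_cos: "C1_fun (cos :: real \<Rightarrow> real)"
  by (rule C1_fun_real[OF DERIV_sin], intro continuous_intros)
    (rule C1_fun_real[OF DERIV_cos], intro continuous_intros)

lemma C1_test_grad: "C1_fun (test_grad P X)"
proof (rule C1_fun_vec)
  fix i
  show "C1_fun (\<lambda>k. test_grad P X k $ i)" unfolding test_grad_def vec_lambda_beta
    by (intro C1_fun_add C1_fun_const C1_fun_mult_real C1_fun_sum C1_fun_compose[OF C1_fun_sin] C1_fun_compose[OF C1_fun_cos] C1_fun_nth)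
qed

lemma abs_sin_diff_le: "\<bar>sin x - sin y\<bar> \<le> \<bar>x - y :: real\<bar>" and abs_cos_diff_le: "\<bar>cos x - cos y\<bar> \<le> \<bar>x - y :: real\<bar>"
proof -
  have "norm (sin x - sin y) \<le> 1 * norm (x - y)"
    by (rule field_differentiable_bound[of UNIV sin cos]) (auto intro: DERIV_sin)
  then show "\<bar>sin x - sin y\<bar> \<le> \<bar>x - y\<bar>" by simp
  have "norm (cos x - cos y) \<le> 1 * norm (x - y)"
    by (rule field_differentiable_bound[of UNIV cos "\<lambda>x. - sin x"]) (auto intro: DERIV_cos)
  then show "\<bar>cos x - cos y\<bar> \<le> \<bar>x - y\<bar>" by simp
qed

lemma test_grad_bounds:
  fixes P :: "real^'d" and X :: "real^'d^'d"
  defines "N \<equiv> \<Sum>i\<in>UNIV. \<Sum>j\<in>UNIV. \<bar>X $ i $ j\<bar>"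
  shows "norm (test_grad P X k) \<le> norm P + N" "(2 * N)-lipschitz_on UNIV (test_grad P X)"
proof -
  have N: "0 \<le> N" by (auto simp: N_def intro!: sum_nonneg)
  have "test_grad P X k = P + (\<chi> i. cos (k $ i) * (\<Sum>j\<in>UNIV. X $ i $ j * sin (k $ j)))"
    by (simp add: test_grad_def vec_eq_iff)
  moreover have "norm (\<chi> i. cos (k $ i) * (\<Sum>j\<in>UNIV. X $ i $ j * sin (k $ j))) \<le> N"
  proof (rule order_trans[OF norm_le_l1_cart])
    have "\<bar>cos (k $ i) * (\<Sum>j\<in>UNIV. X $ i $ j * sin (k $ j))\<bar> \<le> (\<Sum>j\<in>UNIV. \<bar>X $ i $ j\<bar>)" for i
    proof -
      have "\<bar>cos (k $ i) * (\<Sum>j\<in>UNIV. X $ i $ j * sin (k $ j))\<bar> \<le> 1 * \<bar>\<Sum>j\<in>UNIV. X $ i $ j * sin (k $ j)\<bar>"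
        unfolding abs_mult by (intro mult_right_mono) auto
      also have "\<dots> \<le> (\<Sum>j\<in>UNIV. \<bar>X $ i $ j * sin (k $ j)\<bar>)" by simp
      also have "\<dots> \<le> (\<Sum>j\<in>UNIV. \<bar>X $ i $ j\<bar>)" by (intro sum_mono) (simp add: abs_mult mult_left_le)
      finally show ?thesis .
    qed
    then show "(\<Sum>i\<in>UNIV. \<bar>(\<chi> i. cos (k $ i) * (\<Sum>j\<in>UNIV. X $ i $ j * sin (k $ j))) $ i\<bar>) \<le> N"
      unfolding N_def by (intro sum_mono) simp
  qed
  ultimately show "norm (test_grad P X k) \<le> norm P + N" using norm_triangle_mono[OF order_refl] by (metis (no_types))
  show "(2 * N)-lipschitz_on UNIV (test_grad P X)"
  proof (rule lipschitz_onI)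
    fix k l :: "real^'d"
    have c: "\<bar>k $ i - l $ i\<bar> \<le> norm (k - l)" for i
      using component_le_norm_cart[of "k - l" i] by (simp only: vector_minus_component)
    have "norm (test_grad P X k - test_grad P X l) \<le> (\<Sum>i\<in>UNIV. \<bar>(test_grad P X k - test_grad P X l) $ i\<bar>)"
      by (rule norm_le_l1_cart)
    also have "\<dots> \<le> (\<Sum>i\<in>UNIV. \<Sum>j\<in>UNIV. \<bar>X $ i $ j\<bar> * (2 * norm (k - l)))"
    proof (intro sum_mono)
      fix i
      have "(test_grad P X k - test_grad P X l) $ i = (\<Sum>j\<in>UNIV. X $ i $ j * (cos (k $ i) * sin (k $ j) - cos (l $ i) * sin (l $ j)))"
        by (simp add: test_grad_def sum_distrib_left sum_subtractf[symmetric] algebra_simps)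
      also have "\<bar>\<dots>\<bar> \<le> (\<Sum>j\<in>UNIV. \<bar>X $ i $ j * (cos (k $ i) * sin (k $ j) - cos (l $ i) * sin (l $ j))\<bar>)" by simp
      also have "\<dots> \<le> (\<Sum>j\<in>UNIV. \<bar>X $ i $ j\<bar> * (2 * norm (k - l)))"
        unfolding abs_mult
      proof (intro sum_mono mult_left_mono)
        fix j
        have "cos (k $ i) * sin (k $ j) - cos (l $ i) * sin (l $ j)
          = cos (k $ i) * (sin (k $ j) - sin (l $ j)) + (cos (k $ i) - cos (l $ i)) * sin (l $ j)" by (simp add: algebra_simps)
        also have "\<bar>\<dots>\<bar> \<le> \<bar>cos (k $ i)\<bar> * \<bar>sin (k $ j) - sin (l $ j)\<bar> + \<bar>cos (k $ i) - cos (l $ i)\<bar> * \<bar>sin (l $ j)\<bar>"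
          using abs_triangle_ineq by (metis abs_mult)
        also have "\<dots> \<le> 1 * norm (k - l) + norm (k - l) * 1"
          using order_trans[OF abs_sin_diff_le c] order_trans[OF abs_cos_diff_le c]
          by (intro add_mono mult_mono) auto
        finally show "\<bar>cos (k $ i) * sin (k $ j) - cos (l $ i) * sin (l $ j)\<bar> \<le> 2 * norm (k - l)" by simp
      qed auto
      finally show "\<bar>(test_grad P X k - test_grad P X l) $ i\<bar> \<le> (\<Sum>j\<in>UNIV. \<bar>X $ i $ j\<bar> * (2 * norm (k - l)))" .
    qed
    also have "\<dots> = 2 * N * norm (k - l)" by (simp add: N_def sum_distrib_right sum_distrib_left mult_ac)
    finally show "dist (test_grad P X k) (test_grad P X l) \<le> 2 * N * dist k l" by (simp add: dist_norm)
  qed (use N in simp)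
qed

lemma test_grad_derivative_0: "(test_grad P X has_derivative (\<lambda>h. X *v h)) (at 0)"
proof -
  have nth: "((\<lambda>k. k $ i) has_derivative (\<lambda>h. h $ i)) (at k)" for i and k :: "real^'d"
    by (rule bounded_linear_imp_has_derivative[OF bounded_linear_vec_nth])
  have D: "((\<lambda>k. P $ i + cos (k $ i) * (\<Sum>j\<in>UNIV. X $ i $ j * sin (k $ j))) has_derivative (\<lambda>h. (X *v h) $ i)) (at 0)" for i
  proof -
    have "((\<lambda>k. P $ i + cos (k $ i) * (\<Sum>j\<in>UNIV. X $ i $ j * sin (k $ j))) has_derivative
      (\<lambda>h. 0 + (cos (0 $ i) * (\<Sum>j\<in>UNIV. X $ i $ j * (h $ j * cos (0 $ j))) +
        h $ i * - sin (0 $ i) * (\<Sum>j\<in>UNIV. X $ i $ j * sin (0 $ j))))) (at 0)"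
      by (intro has_derivative_add has_derivative_const has_derivative_mult has_derivative_cos has_derivative_sum
        has_derivative_mult_right has_derivative_sin nth)
    then show ?thesis by (simp add: matrix_vector_mult_def)
  qed
  have ex: "v = (\<Sum>i\<in>UNIV. v $ i *\<^sub>R axis i 1)" for v :: "real^'d"
    by (simp add: basis_expansion scalar_mult_eq_scaleR[symmetric])
  have "((\<lambda>k. \<Sum>i\<in>UNIV. (P $ i + cos (k $ i) * (\<Sum>j\<in>UNIV. X $ i $ j * sin (k $ j))) *\<^sub>R axis i 1) has_derivative
     (\<lambda>h. \<Sum>i\<in>UNIV. ((X *v h) $ i) *\<^sub>R axis i (1::real))) (at 0)"
    by (intro has_derivative_sum has_derivative_scaleR_left D)
  moreover have "(\<lambda>k. \<Sum>i\<in>UNIV. (P $ i + cos (k $ i) * (\<Sum>j\<in>UNIV. X $ i $ j * sin (k $ j))) *\<^sub>R axis i 1) = test_grad P X"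
    using ex[of "test_grad P X _"] by (auto simp: test_grad_def fun_eq_iff)
  moreover have "(\<lambda>h. \<Sum>i\<in>UNIV. ((X *v h) $ i) *\<^sub>R axis i (1::real)) = (\<lambda>h. X *v h)" using ex by metis
  ultimately show ?thesis by simp
qed

lemma test_at_0 [simp]: "test_fun P X 0 = 0" "test_grad P X 0 = P"
  by (simp_all add: test_fun_def test_grad_def)

lemma test_fun_lower:
  fixes P :: "real^'d"
  assumes \<delta>: "0 < \<delta>"
  shows "\<exists>r>0. \<forall>k. norm k < r \<longrightarrow> test_fun P X k \<ge> P \<bullet> k + k \<bullet> (X *v k) / 2 - \<delta> * (norm k)\<^sup>2"
proof -
  define N where "N = (\<Sum>i\<in>UNIV. \<Sum>j\<in>UNIV. \<bar>X $ i $ j\<bar>)"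
  have N: "0 \<le> N" by (auto simp: N_def intro!: sum_nonneg)
  define e where "e = \<delta> / (N + 1)"
  have e: "0 < e" "N * e \<le> \<delta>" using N \<delta> by (auto simp: e_def field_simps)
  have "((sin :: real \<Rightarrow> real) has_derivative (*) 1) (at 0)"
    using DERIV_sin[of "0::real"] by (simp add: has_field_derivative_def)
  then obtain r where r: "0 < r" "\<And>t::real. \<bar>t\<bar> < r \<Longrightarrow> \<bar>sin t - t\<bar> \<le> e * \<bar>t\<bar>"
    using e(1) unfolding has_derivative_at_alt by (metis diff_zero mult_1 real_norm_def sin_zero)
  have "test_fun P X k \<ge> P \<bullet> k + k \<bullet> (X *v k) / 2 - \<delta> * (norm k)\<^sup>2" if k: "norm k < r" for k
  proof -
    have c: "\<bar>k $ i\<bar> \<le> norm k" for i by (rule component_le_norm_cart)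
    have s: "\<bar>sin (k $ i) - k $ i\<bar> \<le> e * norm k" for i
      using order_trans[OF r(2)[of "k $ i"] mult_left_mono[OF c]] c[of i] k e by (meson less_imp_le order_le_less_trans)
    have ss: "\<bar>sin (k $ i)\<bar> \<le> norm k" for i using order_trans[OF abs_sin_x_le_abs_x c] .
    have d: "\<bar>sin (k $ i) * sin (k $ j) - k $ i * k $ j\<bar> \<le> 2 * e * (norm k)\<^sup>2" for i j
    proof -
      have "sin (k $ i) * sin (k $ j) - k $ i * k $ j = (sin (k $ i) - k $ i) * sin (k $ j) + k $ i * (sin (k $ j) - k $ j)"
        by (simp add: algebra_simps)
      also have "\<bar>\<dots>\<bar> \<le> \<bar>sin (k $ i) - k $ i\<bar> * \<bar>sin (k $ j)\<bar> + \<bar>k $ i\<bar> * \<bar>sin (k $ j) - k $ j\<bar>"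
        using abs_triangle_ineq by (metis abs_mult)
      also have "\<dots> \<le> (e * norm k) * norm k + norm k * (e * norm k)"
        using s ss c e(1) by (intro add_mono mult_mono) auto
      finally show ?thesis by (simp add: power2_eq_square mult_ac)
    qed
    have q: "k \<bullet> (X *v k) = (\<Sum>i\<in>UNIV. \<Sum>j\<in>UNIV. X $ i $ j * (k $ i * k $ j))"
      by (simp add: inner_vec_def matrix_vector_mult_def sum_distrib_left mult_ac)
    have "\<bar>(\<Sum>i\<in>UNIV. \<Sum>j\<in>UNIV. X $ i $ j * (sin (k $ i) * sin (k $ j))) - k \<bullet> (X *v k)\<bar>
       = \<bar>\<Sum>i\<in>UNIV. \<Sum>j\<in>UNIV. X $ i $ j * (sin (k $ i) * sin (k $ j) - k $ i * k $ j)\<bar>"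
      unfolding q by (simp add: sum_subtractf[symmetric] right_diff_distrib)
    also have "\<dots> \<le> (\<Sum>i\<in>UNIV. \<Sum>j\<in>UNIV. \<bar>X $ i $ j\<bar> * (2 * e * (norm k)\<^sup>2))"
      using d by (intro order_trans[OF sum_abs] sum_mono) (auto simp: abs_mult intro!: mult_left_mono)
    also have "\<dots> = 2 * (N * e * (norm k)\<^sup>2)" by (simp add: N_def sum_distrib_right sum_distrib_left mult_ac)
    also have "\<dots> \<le> 2 * (\<delta> * (norm k)\<^sup>2)" using e(2) by (intro mult_left_mono mult_right_mono) auto
    finally show ?thesis by (simp add: test_fun_def inner_vec_def[of P] abs_le_iff)
  qed
  then show ?thesis using r(1) by blast
qed

lemma C1_Hgrad: "C2_fun H \<Longrightarrow> C1_fun (Hgrad H b)"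
  unfolding Hgrad_def[abs_def] by (intro C1_fun_sum C1_fun_scaleR C1_fun_const C2_fun_grad(1) C2_fun_component)

lemma Hgrad_0 [simp]: "Hgrad H 0 p = 0"
  by (simp add: Hgrad_def)

text \<open>Translates the definition into a condition in characteristic coordinates:
  \<open>x + k\<close> is where a characteristic of momentum \<open>Q\<close> starts at time
  \<open>s\<close>. Only \<open>norm (Q - P) \<le> M * norm k\<close> is retained of the test
  function, so whoever verifies \<open>touch\<close> need not know it. The term with \<delta> pays
  for replacing the 2-jet by \<open>test_fun\<close>.\<close>

lemma pathwise_subsolution_test:
  fixes H :: "real^'d \<Rightarrow> real^'m" and P x :: "real^'d"
  assumes H: "C2_fun H" and B: "continuous_on {0..} B" and sub: "pathwise_subsolution F H B u"
    and s: "0 < s" and X: "transpose X = X" and \<delta>: "0 < \<delta>"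
    and touch: "\<And>M. \<exists>r>0. \<forall>k s' Q. norm k < r \<and> \<bar>s' - s\<bar> < r \<and> norm (Q - P) \<le> M * norm k \<longrightarrow>
      u (x + k - Hgrad H (B s' - B s) Q, s') \<le> u (x, s) + P \<bullet> k + k \<bullet> (X *v k) / 2 - \<delta> * (norm k)\<^sup>2
        + (H Q \<bullet> (B s' - B s) - Q \<bullet> Hgrad H (B s' - B s) Q) + a * (s' - s) + c * (s' - s)\<^sup>2"
  shows "a \<le> F X P"
proof -
  define N where "N = (\<Sum>i\<in>UNIV. \<Sum>j\<in>UNIV. \<bar>X $ i $ j\<bar>)"
  have N: "0 \<le> N" by (auto simp: N_def intro!: sum_nonneg)
  define \<phi> where "\<phi> y = test_fun P X (y - x)" for y
  have D\<phi>: "(\<phi> has_derivative (\<lambda>h. h \<bullet> test_grad P X (y - x))) (at y)" for y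
    unfolding \<phi>_def[abs_def]
    using has_derivative_compose[OF has_derivative_diff[OF has_derivative_ident has_derivative_const] test_fun_derivative[OF X]]
    by simp
  have g\<phi>: "grad \<phi> = (\<lambda>y. test_grad P X (y - x))" using grad_eqI[OF D\<phi>] by auto
  have C1shift: "C1_fun (\<lambda>y. y - x)"
    using C1_fun_add[OF C1_fun_bounded_linear[OF bounded_linear_ident] C1_fun_const[of "- x"]] by simp
  have C1g: "C1_fun (grad \<phi>)" unfolding g\<phi> by (rule C1_fun_compose[OF C1_test_grad C1shift])
  have C2: "C2_fun \<phi>" unfolding C2_fun_def
  proof (intro exI conjI allI)
    show "(\<phi> has_derivative blinfun_apply (blinfun_inner_left (grad \<phi> y))) (at y)" for y
      using D\<phi> by (simp add: g\<phi>)
    show "C1_fun (\<lambda>y. blinfun_inner_left (grad \<phi> y))"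
      by (rule C1_fun_compose[OF C1_fun_bounded_linear[OF bounded_linear_blinfun_inner_left] C1g])
  qed
  define R where "R = norm P + N"
  have gR: "test_grad P X k \<in> cball 0 R" for k using test_grad_bounds(1)[of P X k] by (simp add: R_def N_def)
  obtain C where C: "0 \<le> C"
    "\<And>p b. p \<in> cball 0 R \<Longrightarrow> norm (Hgrad H b p) \<le> C * norm b"
    "\<And>p q b. p \<in> cball 0 R \<Longrightarrow> q \<in> cball 0 R \<Longrightarrow> norm (Hgrad H b p - Hgrad H b q) \<le> C * norm b * norm (p - q)"
    using Hgrad_bounds[OF H, of R] by metis
  define G where "G t y = Hgrad H (B t - B s) (grad \<phi> y)" for t y
  have X_G: "char_X H B s \<phi> y t = y - G t y" for y t by (simp add: char_X_Hgrad G_def)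
  have Gb: "norm (G t y) \<le> C * norm (B t - B s)" for t y using C(2)[OF gR] by (simp add: G_def g\<phi>)
  have Glip: "(C * norm (B t - B s) * (2 * N))-lipschitz_on UNIV (G t)" for t
  proof (rule lipschitz_onI)
    fix y z
    have "norm (G t y - G t z) \<le> C * norm (B t - B s) * norm (grad \<phi> y - grad \<phi> z)"
      using C(3)[OF gR gR] by (simp add: G_def g\<phi>)
    also have "norm (grad \<phi> y - grad \<phi> z) \<le> 2 * N * norm (y - z)"
      using lipschitz_onD[OF test_grad_bounds(2)[where P = P and X = X], of "y - x" "z - x"] by (simp add: g\<phi> dist_norm N_def)
    finally show "dist (G t y) (G t z) \<le> C * norm (B t - B s) * (2 * N) * dist y z"
      using C(1) by (simp add: dist_norm mult_left_mono mult.assoc)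
  qed (use C N in simp)
  have C1G: "C1_fun (G t)" for t unfolding G_def[abs_def] by (rule C1_fun_compose[OF C1_Hgrad[OF H] C1g])
  have contB: "isCont B s"
    using continuous_on_subset[OF B, of "{0<..}"] s
    by (simp add: continuous_on_eq_continuous_at subset_iff)
  have Bsmall: "\<exists>h>0. \<forall>t. \<bar>t - s\<bar> < h \<longrightarrow> norm (B t - B s) < e" if "0 < e" for e
    using contB that unfolding continuous_at_eps_delta by (auto simp: dist_norm)
  \<comment> \<open>For noise increments below this, the displacement \<open>G t\<close> is
    1/2-Lipschitz, so the characteristics form a diffeomorphism.\<close>
  define e0 where "e0 = 1 / (2 * (C * (2 * N) + 1))"
  have CN: "0 \<le> C * (2 * N)" using C(1) N by simp
  have e0: "0 < e0" "C * (2 * N) * e0 \<le> 1 / 2" using CN by (auto simp: e0_def field_simps)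
  obtain h0 where h0: "0 < h0" "\<And>t. \<bar>t - s\<bar> < h0 \<Longrightarrow> norm (B t - B s) < e0" using Bsmall[OF e0(1)] by blast
  define h where "h = min h0 s"
  have h: "0 < h" "h \<le> s" using h0 s by (auto simp: h_def)
  have diffeo: "C1_diffeomorphism (\<lambda>y. char_X H B s \<phi> y t)" if t: "t \<in> {s - h<..<s + h}" for t
    unfolding X_G
  proof (rule C1_diffeomorphism_contraction_perturbation[OF C1G])
    have "norm (B t - B s) < e0" using t by (intro h0(2)) (auto simp: h_def)
    then have "C * (2 * N) * norm (B t - B s) \<le> C * (2 * N) * e0" using CN by (intro mult_left_mono) auto
    then have "C * norm (B t - B s) * (2 * N) \<le> 1 / 2" using e0(2) by (simp add: mult_ac)
    then show "(1/2)-lipschitz_on UNIV (G t)" by (rule lipschitz_on_mono[OF Glip order_refl])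
  qed
  define Y where "Y t = inv (\<lambda>y. char_X H B s \<phi> y t)" for t
  define \<Phi> where "\<Phi> = (\<lambda>(x', t). char_U H B s \<phi> (Y t x') t)"
  have YX: "Y t (char_X H B s \<phi> y t) = y" and XY: "char_X H B s \<phi> (Y t x') t = x'" if "t \<in> {s - h<..<s + h}" for t y x'
  proof -
    have "bij (\<lambda>y. char_X H B s \<phi> y t)" using diffeo[OF that] by (simp add: C1_diffeomorphism_def)
    then show "Y t (char_X H B s \<phi> y t) = y" "char_X H B s \<phi> (Y t x') t = x'"
      unfolding Y_def by (simp_all add: bij_is_inj bij_is_surj inv_f_f[of "\<lambda>y. char_X H B s \<phi> y t"] surj_f_inv_f[of "\<lambda>y. char_X H B s \<phi> y t"])
  qed
  have smooth: "smooth_solution H B s h \<Phi>"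
    unfolding smooth_solution_def using h C2 diffeo YX by (auto simp: \<Phi>_def intro!: exI[of _ \<phi>])
  have \<Phi>s: "\<Phi> (y, s) = \<phi> y" for y
  proof -
    have "char_X H B s \<phi> y s = y" by (simp add: char_X_Hgrad)
    then have "Y s y = y" using YX[of s y] h by simp
    then show ?thesis by (simp add: \<Phi>_def char_U_Hgrad)
  qed
  \<comment> \<open>Only the slope \<open>a\<close> at time \<open>s\<close> matters in the
    viscosity inequality; the square absorbs second-order errors in time.\<close>
  define \<psi> where "\<psi> t = a * (t - s) + c * (t - s)\<^sup>2" for t
  have D\<psi>: "(\<psi> has_field_derivative a + c * (2 * (t - s))) (at t)" for t
    unfolding \<psi>_def[abs_def] by (auto intro!: derivative_eq_intros)
  have C1\<psi>: "\<psi> C1_differentiable_on {0<..}"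
    unfolding C1_differentiable_on_def
    by (intro exI[of _ "\<lambda>t. a + c * (2 * (t - s))"] conjI ballI continuous_intros)
      (use D\<psi> in \<open>simp add: has_real_derivative_iff_has_vector_derivative\<close>)
  have d\<psi>: "deriv \<psi> s = a" using DERIV_imp_deriv[OF D\<psi>[of s]] by simp
  obtain r1 where r1: "0 < r1" "\<And>k s' Q. norm k < r1 \<Longrightarrow> \<bar>s' - s\<bar> < r1 \<Longrightarrow> norm (Q - P) \<le> 2 * N * norm k \<Longrightarrow>
      u (x + k - Hgrad H (B s' - B s) Q, s') \<le> u (x, s) + P \<bullet> k + k \<bullet> (X *v k) / 2 - \<delta> * (norm k)\<^sup>2
        + (H Q \<bullet> (B s' - B s) - Q \<bullet> Hgrad H (B s' - B s) Q) + a * (s' - s) + c * (s' - s)\<^sup>2"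
    using touch[of "2 * N"] by metis
  obtain r2 where r2: "0 < r2" "\<And>k. norm k < r2 \<Longrightarrow> test_fun P X k \<ge> P \<bullet> k + k \<bullet> (X *v k) / 2 - \<delta> * (norm k)\<^sup>2"
    using test_fun_lower[OF \<delta>] by blast
  define r where "r = min r1 r2"
  have r: "0 < r" using r1 r2 by (simp add: r_def)
  \<comment> \<open>In this time the noise moves points by at most r / 2, so characteristics through
    points within r / 2 of \<open>x\<close> start within r of it.\<close>
  obtain h3 where h3: "0 < h3" "\<And>t. \<bar>t - s\<bar> < h3 \<Longrightarrow> norm (B t - B s) < r / (2 * (C + 1))"
    using Bsmall[of "r / (2 * (C + 1))"] r C(1) by auto
  define \<eta> where "\<eta> = min (min (r / 2) h3) (min h r1)"
  have \<eta>: "0 < \<eta>" using r h3 h r1 by (simp add: \<eta>_def)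
  have lm: "local_max_at (\<lambda>(x, t). u (x, t) - \<Phi> (x, t) - \<psi> t) (x, s)"
    unfolding local_max_at_def eventually_nhds_metric
  proof (intro exI[of _ \<eta>] conjI allI impI \<eta>)
    fix w assume w: "dist w (x, s) < \<eta>"
    obtain x' s' where ws: "w = (x', s')" by (cases w)
    have x': "norm (x' - x) < \<eta>" using w dist_fst_le[of w "(x, s)"] by (simp add: ws dist_norm)
    have s': "\<bar>s' - s\<bar> < \<eta>" using w dist_snd_le[of w "(x, s)"] by (simp add: ws dist_real_def)
    have t: "s' \<in> {s - h<..<s + h}" using s' by (auto simp: \<eta>_def abs_less_iff)
    \<comment> \<open>The start at time \<open>s\<close>, relative to \<open>x\<close>, of the
      characteristic that reaches x' at time s'. In this coordinate \<Phi> is explicit.\<close>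
    define k where "k = Y s' x' - x"
    define Q where "Q = test_grad P X k"
    have Yk: "Y s' x' = x + k" by (simp add: k_def)
    have gQ: "grad \<phi> (x + k) = Q" by (simp add: g\<phi> Q_def)
    have x'k: "x' = x + k - Hgrad H (B s' - B s) Q" using XY[OF t, of x'] by (simp add: Yk char_X_Hgrad gQ)
    have "norm (G s' (x + k)) \<le> r / 2"
    proof -
      have "C * norm (B s' - B s) \<le> C * (r / (2 * (C + 1)))"
        using h3(2)[of s'] s' C(1) by (intro mult_left_mono) (auto simp: \<eta>_def)
      also have "\<dots> \<le> r / 2" using C(1) r by (simp add: field_simps)
      finally show ?thesis using Gb[of s' "x + k"] by linarith
    qed
    moreover have "k = (x' - x) + G s' (x + k)" using x'k by (simp add: G_def gQ)
    ultimately have nk: "norm k < r"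
      using norm_triangle_ineq[of "x' - x" "G s' (x + k)"] x' by (simp add: \<eta>_def)
    have QP: "norm (Q - P) \<le> 2 * N * norm k"
      using lipschitz_onD[OF test_grad_bounds(2)[where P = P and X = X], of k 0] by (simp add: Q_def dist_norm N_def)
    have "u (x', s') \<le> u (x, s) + P \<bullet> k + k \<bullet> (X *v k) / 2 - \<delta> * (norm k)\<^sup>2
        + (H Q \<bullet> (B s' - B s) - Q \<bullet> Hgrad H (B s' - B s) Q) + \<psi> s'"
      using r1(2)[OF _ _ QP, of s'] nk s' by (simp add: x'k r_def \<eta>_def \<psi>_def)
    moreover have "\<Phi> (x', s') = test_fun P X k + (H Q \<bullet> (B s' - B s) - Q \<bullet> Hgrad H (B s' - B s) Q)"
      by (simp add: \<Phi>_def Yk char_U_Hgrad gQ \<phi>_def inner_commute)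
    moreover have "test_fun P X k \<ge> P \<bullet> k + k \<bullet> (X *v k) / 2 - \<delta> * (norm k)\<^sup>2" using r2(2) nk by (simp add: r_def)
    ultimately show "(case w of (x, t) \<Rightarrow> u (x, t) - \<Phi> (x, t) - \<psi> t) \<le> (case (x, s) of (x, t) \<Rightarrow> u (x, t) - \<Phi> (x, t) - \<psi> t)"
      by (simp add: ws \<Phi>s \<phi>_def \<psi>_def)
  qed
  have "deriv \<psi> s \<le> F (hess (\<lambda>x. \<Phi> (x, s)) x) (grad (\<lambda>x. \<Phi> (x, s)) x)"
    using sub C1\<psi> s smooth lm unfolding pathwise_subsolution_def by blast
  moreover have "hess \<phi> x = X"
  proof (rule hess_eqI)
    have "(test_grad P X has_derivative (\<lambda>h. X *v h)) (at (x - x))" using test_grad_derivative_0 by simp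
    from has_derivative_compose[OF has_derivative_diff[OF has_derivative_ident has_derivative_const] this]
    show "(grad \<phi> has_derivative (\<lambda>h. X *v h)) (at x)" unfolding g\<phi> by simp
  qed
  moreover have "grad \<phi> x = P" by (simp add: g\<phi>)
  ultimately show ?thesis by (simp add: d\<psi> \<Phi>s[abs_def])
qed

section \<open>Exchanging sub- and supersolutions by reflection\<close>

lemma grad_uminus:
  assumes "\<phi> differentiable (at x)"
  shows "grad (\<lambda>y. - \<phi> y) x = - grad \<phi> x"
  using has_derivative_minus[OF grad_works[OF assms]] by (intro grad_eqI) simp

lemma uminus_matrix_vector_mult: "(- A) *v x = - (A *v x)" for A :: "real^'n^'m"
  by (simp add: matrix_vector_mult_def vec_eq_iff sum_negf)

lemma hess_uminus:
  assumes "C2_fun \<phi>"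
  shows "hess (\<lambda>y. - \<phi> y) x = - hess \<phi> x"
proof -
  have g: "grad (\<lambda>y. - \<phi> y) = (\<lambda>y. - grad \<phi> y)"
    using grad_uminus C2_fun_grad(2)[OF assms] differentiableI by blast
  have "grad \<phi> differentiable (at x)"
    using C2_fun_grad(1)[OF assms] by (auto simp: C1_fun_def differentiable_def)
  then have "(grad \<phi> has_derivative (\<lambda>h. hess \<phi> x *v h)) (at x)"
    by (simp add: jacobian_works hess_def)
  moreover have "(\<lambda>h. - (hess \<phi> x *v h)) = (\<lambda>h. (- hess \<phi> x) *v h)"
    by (simp add: uminus_matrix_vector_mult)
  ultimately have "((\<lambda>y. - grad \<phi> y) has_derivative (\<lambda>h. (- hess \<phi> x) *v h)) (at x)"
    using has_derivative_minus by metis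
  then show ?thesis by (intro hess_eqI) (simp add: g)
qed

lemma C2_fun_reflect:
  assumes "C2_fun H"
  shows "C2_fun (\<lambda>p. - H (- p))"
proof -
  obtain H' where H: "\<And>x. (H has_derivative blinfun_apply (H' x)) (at x)" "C1_fun H'"
    using assms unfolding C2_fun_def by blast
  show ?thesis unfolding C2_fun_def
  proof (intro exI conjI allI)
    show "((\<lambda>p. - H (- p)) has_derivative blinfun_apply (H' (- p))) (at p)" for p
      using has_derivative_minus[OF has_derivative_compose[OF has_derivative_minus[OF has_derivative_ident] H(1)], of p UNIV]
      by (simp add: blinfun.minus_right)
    show "C1_fun (\<lambda>p. H' (- p))"
      by (intro C1_fun_compose[OF H(2)] C1_fun_bounded_linear bounded_linear_minus bounded_linear_ident)
  qed
qed

lemma Hgrad_reflect: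
  assumes "C2_fun H"
  shows "Hgrad (\<lambda>p. - H (- p)) b p = Hgrad H b (- p)"
proof -
  have "grad (\<lambda>q. (- H (- q)) $ i) p = grad (\<lambda>q. H q $ i) (- p)" for i
  proof (rule grad_eqI)
    have "((\<lambda>q. H q $ i) has_derivative (\<lambda>h. h \<bullet> grad (\<lambda>q. H q $ i) (- p))) (at (- p))"
      by (rule C2_fun_grad(2)[OF C2_fun_component[OF assms]])
    from has_derivative_minus[OF has_derivative_compose[OF has_derivative_minus[OF has_derivative_ident] this]]
    show "((\<lambda>q. (- H (- q)) $ i) has_derivative (\<lambda>h. h \<bullet> grad (\<lambda>q. H q $ i) (- p))) (at p)"
      by simp
  qed
  then show ?thesis by (simp add: Hgrad_def)
qed

text \<open>The equation is invariant under \<open>u \<mapsto> - u\<close>, \<open>H \<mapsto> - H(- \<cdot>)\<close>, \<open>F \<mapsto> - F(- \<cdot>, - \<cdot>)\<close>, which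
  exchanges sub- and supersolutions.\<close>

lemma pathwise_supersolution_imp_subsolution_uminus:
  assumes H: "C2_fun H" and super: "pathwise_supersolution F H B v"
  shows "pathwise_subsolution (\<lambda>X p. - F (- X) (- p)) (\<lambda>p. - H (- p)) B (\<lambda>z. - v z)"
  unfolding pathwise_subsolution_def
proof (intro conjI allI impI)
  have "BUC (UNIV \<times> {0..}) v" using super by (simp add: pathwise_supersolution_def)
  then show "BUC (UNIV \<times> {0..}) (\<lambda>z. - v z)"
    by (auto simp: BUC_def uniformly_continuous_on_minus bounded_uminus image_image[of uminus v, symmetric])
next
  fix \<psi> \<Phi> h x0 t0
  assume A: "\<psi> C1_differentiable_on {0<..} \<and> 0 < t0 \<and> smooth_solution (\<lambda>p. - H (- p)) B t0 h \<Phi> \<and>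
    local_max_at (\<lambda>(x, t). - v (x, t) - \<Phi> (x, t) - \<psi> t) (x0, t0)"
  then obtain \<phi> where h: "0 < h" "h \<le> t0" and C2: "C2_fun \<phi>"
    and diffeo: "\<And>t. t \<in> {t0-h<..<t0+h} \<Longrightarrow> C1_diffeomorphism (\<lambda>x. char_X (\<lambda>p. - H (- p)) B t0 \<phi> x t)"
    and val: "\<And>t x. t \<in> {t0-h<..<t0+h} \<Longrightarrow>
      \<Phi> (char_X (\<lambda>p. - H (- p)) B t0 \<phi> x t, t) = char_U (\<lambda>p. - H (- p)) B t0 \<phi> x t"
    unfolding smooth_solution_def by blast
  have dif: "\<phi> differentiable (at x)" for x using C2_fun_grad(2)[OF C2] by (rule differentiableI)
  \<comment> \<open>The characteristics of \<open>H\<close> started from - \<phi> are those of the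
    reflected Hamiltonian started from \<phi>, and the transported values are opposite; hence
    negation maps smooth solutions to smooth solutions.\<close>
  have cX: "char_X H B t0 (\<lambda>y. - \<phi> y) x t = char_X (\<lambda>p. - H (- p)) B t0 \<phi> x t" for x t
    by (simp add: char_X_Hgrad Hgrad_reflect[OF H] grad_uminus[OF dif])
  have cU: "char_U H B t0 (\<lambda>y. - \<phi> y) x t = - char_U (\<lambda>p. - H (- p)) B t0 \<phi> x t" for x t
    by (simp add: char_U_Hgrad Hgrad_reflect[OF H] grad_uminus[OF dif])
  have C2': "C2_fun (\<lambda>y. - \<phi> y)"
    by (rule C2_fun_bounded_linear_compose[OF bounded_linear_minus[OF bounded_linear_ident] C2])
  have "smooth_solution H B t0 h (\<lambda>z. - \<Phi> z)"
    unfolding smooth_solution_def using h C2' diffeo val by (auto simp: cX cU intro!: exI[of _ "\<lambda>y. - \<phi> y"])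
  moreover have C1: "(\<lambda>t. - \<psi> t) C1_differentiable_on {0<..}"
  proof -
    obtain D where D: "\<forall>x\<in>{0<..}. (\<psi> has_vector_derivative D x) (at x)" "continuous_on {0<..} D"
      using A unfolding C1_differentiable_on_def by blast
    show ?thesis unfolding C1_differentiable_on_def
      using D by (intro exI[of _ "\<lambda>t. - D t"]) (auto intro: has_vector_derivative_minus continuous_on_minus)
  qed
  moreover have "local_min_at (\<lambda>(x, t). v (x, t) - (- \<Phi> (x, t)) - (- \<psi> t)) (x0, t0)"
    using A unfolding local_max_at_def local_min_at_def by (auto elim!: eventually_mono)
  ultimately have "deriv (\<lambda>t. - \<psi> t) t0 \<ge> F (hess (\<lambda>x. - \<Phi> (x, t0)) x0) (grad (\<lambda>x. - \<Phi> (x, t0)) x0)"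
    using super A unfolding pathwise_supersolution_def by blast
  moreover have "\<Phi> (x, t0) = \<phi> x" for x
    using val[of t0 x] h by (simp add: char_X_Hgrad char_U_Hgrad)
  moreover have "deriv (\<lambda>t. - \<psi> t) t0 = - deriv \<psi> t0"
  proof -
    obtain D where "(\<psi> has_vector_derivative D) (at t0)"
      using A unfolding C1_differentiable_on_def by auto
    then have D: "(\<psi> has_field_derivative D) (at t0)" by (simp add: has_real_derivative_iff_has_vector_derivative)
    show ?thesis using DERIV_imp_deriv[OF D] DERIV_imp_deriv[OF DERIV_minus[OF D]] by simp
  qed
  ultimately show "deriv \<psi> t0 \<le> - F (- hess (\<lambda>x. \<Phi> (x, t0)) x0) (- grad (\<lambda>x. \<Phi> (x, t0)) x0)"
    by (simp add: hess_uminus[OF C2] grad_uminus[OF dif])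
qed

section \<open>Noise-adapted sup-convolutions\<close>

text \<open>The truncated Hamiltonian \<open>p \<mapsto> |p|\<^sup>2 / 2\<Lambda> - H(p) \<bullet> \<beta>\<close> on \<open>|p| \<le> R\<close> and its Legendre transform: along
  \<open>\<beta> = B t - B t0\<close> this is the (locally) smooth solution started from \<open>\<Lambda> |z|\<^sup>2 / 2\<close> at \<open>t0\<close>.\<close>

definition kin :: "(real^'d \<Rightarrow> real^'m) \<Rightarrow> real \<Rightarrow> real^'m \<Rightarrow> real^'d \<Rightarrow> real^'d \<Rightarrow> real" where
  "kin H \<Lambda> \<beta> z p = p \<bullet> z - (norm p)\<^sup>2 / (2 * \<Lambda>) + H p \<bullet> \<beta>"

definition legendre :: "(real^'d \<Rightarrow> real^'m) \<Rightarrow> real \<Rightarrow> real \<Rightarrow> real^'m \<Rightarrow> real^'d \<Rightarrow> real" where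
  "legendre H \<Lambda> R \<beta> z = (SUP p\<in>cball 0 R. kin H \<Lambda> \<beta> z p)"

text \<open>The ball of momenta is symmetric, so the reflected Hamiltonian satisfies the same bounds
  with the same constants, and the bounds do not involve \<Lambda>; the locale is instantiated for
  \<open>H\<close>, for its reflection and with \<Lambda> / 2.\<close>

locale hamiltonian =
  fixes H :: "real^'d \<Rightarrow> real^'m" and \<Lambda> R C :: real
  assumes C2H: "C2_fun H" and \<Lambda>: "0 < \<Lambda>" and R: "0 < R" and C: "0 \<le> C"
    and H_bound: "\<And>p. p \<in> cball 0 R \<Longrightarrow> norm (H p) \<le> C"
    and Hgrad_bound: "\<And>p b. p \<in> cball 0 R \<Longrightarrow> norm (Hgrad H b p) \<le> C * norm b"
    and H_Taylor: "\<And>p q b. p \<in> cball 0 R \<Longrightarrow> q \<in> cball 0 R \<Longrightarrow>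
      \<bar>H p \<bullet> b - H q \<bullet> b - (p - q) \<bullet> Hgrad H b q\<bar> \<le> C * norm b * (norm (p - q))\<^sup>2"
begin

abbreviation "\<Phi> \<equiv> legendre H \<Lambda> R"

lemma H_cont: "continuous_on S H"
  using C2H unfolding C2_fun_def
  by (meson continuous_at_imp_continuous_on has_derivative_continuous)

lemma legendre_attained: "\<exists>P\<in>cball 0 R. \<Phi> \<beta> z = kin H \<Lambda> \<beta> z P \<and> (\<forall>p\<in>cball 0 R. kin H \<Lambda> \<beta> z p \<le> kin H \<Lambda> \<beta> z P)"
proof -
  have "continuous_on (cball 0 R) (kin H \<Lambda> \<beta> z)"
    unfolding kin_def[abs_def] using \<Lambda> by (intro continuous_intros H_cont) auto
  then obtain P where P: "P \<in> cball 0 R" "\<forall>p\<in>cball 0 R. kin H \<Lambda> \<beta> z p \<le> kin H \<Lambda> \<beta> z P"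
    using continuous_attains_sup[of "cball (0::real^'d) R"] R by (metis cball_eq_empty compact_cball less_imp_le not_le)
  then have "\<Phi> \<beta> z = kin H \<Lambda> \<beta> z P" unfolding legendre_def by (intro cSup_eq_maximum) auto
  then show ?thesis using P by blast
qed

lemma legendre_ge: "p \<in> cball 0 R \<Longrightarrow> kin H \<Lambda> \<beta> z p \<le> \<Phi> \<beta> z"
  using legendre_attained[of \<beta> z] by auto

lemma legendre_le: "(\<And>p. p \<in> cball 0 R \<Longrightarrow> kin H \<Lambda> \<beta> z p \<le> c) \<Longrightarrow> \<Phi> \<beta> z \<le> c"
  using legendre_attained[of \<beta> z] by auto

lemma H_inner_bound: "p \<in> cball 0 R \<Longrightarrow> \<bar>H p \<bullet> b\<bar> \<le> C * norm b"
  using Cauchy_Schwarz_ineq2[of "H p" b] mult_right_mono[OF H_bound, of p "norm b"] by simp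

lemma legendre_lipschitz: "\<bar>\<Phi> \<beta> z - \<Phi> \<beta>' z'\<bar> \<le> R * norm (z - z') + C * norm (\<beta> - \<beta>')"
proof -
  have "\<Phi> \<beta> z \<le> \<Phi> \<beta>' z' + (R * norm (z - z') + C * norm (\<beta> - \<beta>'))" for \<beta> \<beta>' z z'
  proof (rule legendre_le)
    fix p :: "real^'d" assume p: "p \<in> cball 0 R"
    have "kin H \<Lambda> \<beta> z p = kin H \<Lambda> \<beta>' z' p + p \<bullet> (z - z') + H p \<bullet> (\<beta> - \<beta>')"
      by (simp add: kin_def inner_diff_right)
    moreover have "p \<bullet> (z - z') \<le> R * norm (z - z')"
      using norm_cauchy_schwarz[of p "z - z'"] mult_right_mono[of "norm p" R "norm (z - z')"] p by simp
    moreover have "H p \<bullet> (\<beta> - \<beta>') \<le> C * norm (\<beta> - \<beta>')" using H_inner_bound[OF p, of "\<beta> - \<beta>'"] by simp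
    ultimately show "kin H \<Lambda> \<beta> z p \<le> \<Phi> \<beta>' z' + (R * norm (z - z') + C * norm (\<beta> - \<beta>'))"
      using legendre_ge[OF p, of \<beta>' z'] by linarith
  qed
  from this[of \<beta> z \<beta>' z'] this[of \<beta>' z' \<beta> z] show ?thesis by (simp add: norm_minus_commute abs_le_iff)
qed

lemma legendre_lower: "\<Phi> \<beta> z \<ge> - (C * norm \<beta>)"
  using legendre_ge[of 0 \<beta> z] H_inner_bound[of 0 \<beta>] R by (simp add: kin_def)

lemma legendre_at_0: "\<Phi> \<beta> 0 \<le> C * norm \<beta>"
proof (rule legendre_le)
  fix p :: "real^'d" assume "p \<in> cball 0 R"
  moreover have "0 \<le> (norm p)\<^sup>2 / (2 * \<Lambda>)" using \<Lambda> by simp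
  ultimately show "kin H \<Lambda> \<beta> 0 p \<le> C * norm \<beta>" using H_inner_bound[of p \<beta>] by (simp add: kin_def)
qed

text \<open>At an interior maximum the linear part of \<open>kin\<close> vanishes. Of the concave
  term with coefficient 1/(2\<Lambda>), the Taylor error of the noise consumes at most half, which
  leaves quadratic decay away from \<open>P\<close>.\<close>

lemma interior_maximizer:
  assumes P: "P \<in> ball 0 R" "\<And>p. p \<in> cball 0 R \<Longrightarrow> kin H \<Lambda> \<beta> z p \<le> kin H \<Lambda> \<beta> z P"
    and \<beta>: "C * norm \<beta> \<le> 1 / (4 * \<Lambda>)" and p: "p \<in> cball 0 R"
  shows "kin H \<Lambda> \<beta> z p \<le> \<Phi> \<beta> z - (norm (p - P))\<^sup>2 / (4 * \<Lambda>)"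
proof -
  have PR: "P \<in> cball 0 R" using P(1) by auto
  have quad: "(norm q)\<^sup>2 = (norm P)\<^sup>2 + 2 * (P \<bullet> (q - P)) + (norm (q - P))\<^sup>2" for q
    using dot_norm[of P "q - P"] by (simp add: field_simps)
  \<comment> \<open>The gradient of \<open>kin\<close> in the momentum at \<open>P\<close>.\<close>
  define v where "v = z - (1 / \<Lambda>) *\<^sub>R P + Hgrad H \<beta> P"
  have ex: "\<bar>kin H \<Lambda> \<beta> z q - kin H \<Lambda> \<beta> z P - v \<bullet> (q - P) + (norm (q - P))\<^sup>2 / (2 * \<Lambda>)\<bar> \<le> C * norm \<beta> * (norm (q - P))\<^sup>2"
    if "q \<in> cball 0 R" for q
  proof -
    have "kin H \<Lambda> \<beta> z q - kin H \<Lambda> \<beta> z P - v \<bullet> (q - P) + (norm (q - P))\<^sup>2 / (2 * \<Lambda>)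
       = H q \<bullet> \<beta> - H P \<bullet> \<beta> - (q - P) \<bullet> Hgrad H \<beta> P"
      unfolding kin_def quad[of q] v_def using \<Lambda>
      by (simp add: inner_diff_right inner_diff_left inner_add_left add_divide_distrib diff_divide_distrib
          inner_commute[of q] inner_commute[of P z] inner_commute[of P "Hgrad H \<beta> P"])
    then show ?thesis using H_Taylor[OF that PR, of \<beta>] by simp
  qed
  have "v = 0"
  proof (rule eq_0_if_inner_le_square)
    have "\<forall>\<^sub>F q in nhds P. q \<in> ball 0 R" using P(1) by (intro eventually_nhds_in_open) auto
    then show "\<forall>\<^sub>F q in nhds P. v \<bullet> (q - P) \<le> (C * norm \<beta> + 1 / (2 * \<Lambda>)) * (norm (q - P))\<^sup>2"
    proof eventually_elim
      case (elim q)
      then have "q \<in> cball 0 R" by auto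
      then show ?case using ex[of q] P(2)[of q] by (simp add: distrib_right abs_le_iff)
    qed
  qed
  then have "kin H \<Lambda> \<beta> z p \<le> kin H \<Lambda> \<beta> z P - (norm (p - P))\<^sup>2 / (2 * \<Lambda>) + C * norm \<beta> * (norm (p - P))\<^sup>2"
    using ex[OF p] by (simp add: abs_le_iff)
  also have "C * norm \<beta> * (norm (p - P))\<^sup>2 \<le> 1 / (4 * \<Lambda>) * (norm (p - P))\<^sup>2" using \<beta> by (intro mult_right_mono) auto
  also have "kin H \<Lambda> \<beta> z P - (norm (p - P))\<^sup>2 / (2 * \<Lambda>) + 1 / (4 * \<Lambda>) * (norm (p - P))\<^sup>2
    = kin H \<Lambda> \<beta> z P - (norm (p - P))\<^sup>2 / (4 * \<Lambda>)" using \<Lambda> by (simp add: field_simps)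
  finally show ?thesis using legendre_ge[OF PR, of \<beta> z] by linarith
qed

text \<open>Duality: quadratic decay in the momentum turns, by Young's inequality, into an upper
  paraboloid in space. Since the kernel is subtracted in the sup-convolution, this is the source of
  semiconvexity.\<close>

lemma legendre_upper_paraboloid:
  assumes P: "P \<in> ball 0 R" "\<And>p. p \<in> cball 0 R \<Longrightarrow> kin H \<Lambda> \<beta> z p \<le> kin H \<Lambda> \<beta> z P"
    and \<beta>: "C * norm \<beta> \<le> 1 / (4 * \<Lambda>)"
  shows "\<Phi> \<beta> z' \<le> \<Phi> \<beta> z + P \<bullet> (z' - z) + \<Lambda> * (norm (z' - z))\<^sup>2"
proof (rule legendre_le)
  fix p :: "real^'d" assume p: "p \<in> cball 0 R"
  have "(p - P) \<bullet> (z' - z) \<le> (norm (p - P))\<^sup>2 / (4 * \<Lambda>) + \<Lambda> * (norm (z' - z))\<^sup>2"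
  proof -
    have "0 \<le> (norm (p - P) / (2 * sqrt \<Lambda>) - sqrt \<Lambda> * norm (z' - z))\<^sup>2" by simp
    also have "\<dots> = (norm (p - P))\<^sup>2 / (4 * \<Lambda>) + \<Lambda> * (norm (z' - z))\<^sup>2 - norm (p - P) * norm (z' - z)"
      using \<Lambda> by (simp add: power2_diff power_divide power_mult_distrib)
    finally show ?thesis using norm_cauchy_schwarz[of "p - P" "z' - z"] by linarith
  qed
  moreover have "kin H \<Lambda> \<beta> z' p = kin H \<Lambda> \<beta> z p + (p - P) \<bullet> (z' - z) + P \<bullet> (z' - z)"
    by (simp add: kin_def inner_diff_left inner_diff_right)
  ultimately show "kin H \<Lambda> \<beta> z' p \<le> \<Phi> \<beta> z + P \<bullet> (z' - z) + \<Lambda> * (norm (z' - z))\<^sup>2"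
    using interior_maximizer[OF P \<beta> p] by linarith
qed

text \<open>Moving along the characteristic of slope \<open>Q\<close>, which need not be the slope \<open>P\<close> of the solution, costs
  only a small multiple of \<open>|Q - P|\<^sup>2\<close>.\<close>

lemma legendre_along_characteristic:
  assumes P: "P \<in> ball 0 R" "\<And>p. p \<in> cball 0 R \<Longrightarrow> kin H \<Lambda> \<beta> z p \<le> kin H \<Lambda> \<beta> z P"
    and \<beta>: "C * norm \<beta> \<le> 1 / (4 * \<Lambda>)" and Q: "Q \<in> cball 0 R" and b: "2 * (C * norm b) \<le> 1 / (4 * \<Lambda>)"
  shows "\<Phi> (\<beta> + b) (z - Hgrad H b Q) \<le> \<Phi> \<beta> z + (H Q \<bullet> b - Q \<bullet> Hgrad H b Q) + 2 * (C * norm b) * (norm (Q - P))\<^sup>2"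
proof (rule legendre_le)
  fix p :: "real^'d" assume p: "p \<in> cball 0 R"
  have "kin H \<Lambda> (\<beta> + b) (z - Hgrad H b Q) p = kin H \<Lambda> \<beta> z p + (H p \<bullet> b - p \<bullet> Hgrad H b Q)"
    by (simp add: kin_def inner_diff_right inner_add_right)
  moreover have "H p \<bullet> b - p \<bullet> Hgrad H b Q \<le> (H Q \<bullet> b - Q \<bullet> Hgrad H b Q) + C * norm b * (norm (p - Q))\<^sup>2"
    using H_Taylor[OF p Q, of b] by (simp add: inner_diff_left abs_le_iff)
  moreover have "C * norm b * (norm (p - Q))\<^sup>2 \<le> (norm (p - P))\<^sup>2 / (4 * \<Lambda>) + 2 * (C * norm b) * (norm (Q - P))\<^sup>2"
  proof -
    have "norm (p - Q) \<le> norm (p - P) + norm (Q - P)"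
      using norm_triangle_ineq4[of "p - P" "Q - P"] by simp
    then have "(norm (p - Q))\<^sup>2 \<le> (norm (p - P) + norm (Q - P))\<^sup>2" by (intro power_mono) auto
    also have "\<dots> \<le> 2 * (norm (p - P))\<^sup>2 + 2 * (norm (Q - P))\<^sup>2"
      using sum_squares_bound[of "norm (p - P)" "norm (Q - P)"] by (simp add: power2_sum)
    finally have "C * norm b * (norm (p - Q))\<^sup>2 \<le> C * norm b * (2 * (norm (p - P))\<^sup>2 + 2 * (norm (Q - P))\<^sup>2)"
      using C by (intro mult_left_mono) auto
    also have "\<dots> = 2 * (C * norm b) * (norm (p - P))\<^sup>2 + 2 * (C * norm b) * (norm (Q - P))\<^sup>2" by (simp add: algebra_simps)
    also have "2 * (C * norm b) * (norm (p - P))\<^sup>2 \<le> 1 / (4 * \<Lambda>) * (norm (p - P))\<^sup>2" using b by (intro mult_right_mono) auto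
    finally show ?thesis by simp
  qed
  ultimately show "kin H \<Lambda> (\<beta> + b) (z - Hgrad H b Q) p
      \<le> \<Phi> \<beta> z + (H Q \<bullet> b - Q \<bullet> Hgrad H b Q) + 2 * (C * norm b) * (norm (Q - P))\<^sup>2"
    using interior_maximizer[OF P \<beta> p] by linarith
qed

text \<open>Ensures that truncating momenta is harmless wherever the kernel matters: a bounded value
  forces a small \<open>z\<close>, and up to the small noise the maximiser is \<Lambda> z, well
  inside the ball.\<close>

lemma legendre_bounded_imp_interior:
  assumes K: "0 \<le> K" and R2: "R\<^sup>2 = 8 * \<Lambda> * (K + 1)" and \<beta>: "C * norm \<beta> \<le> 1 / 16"
    and le: "\<Phi> \<beta> z \<le> 2 * K + 1"
    and P: "P \<in> cball 0 R" "\<And>p. p \<in> cball 0 R \<Longrightarrow> kin H \<Lambda> \<beta> z p \<le> kin H \<Lambda> \<beta> z P"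
  shows "norm z \<le> 3 * R / (4 * \<Lambda>)" "P \<in> ball 0 R"
proof -
  show z: "norm z \<le> 3 * R / (4 * \<Lambda>)"
  proof (cases "z = 0")
    case True
    then show ?thesis using R \<Lambda> by simp
  next
    case False
    \<comment> \<open>The boundary momentum in the direction of \<open>z\<close> gives the growth of
      the kernel; \<open>R2\<close> makes \<open>2 * (K + 1)\<close> equal to
      \<open>R\<^sup>2 / (4 * \<Lambda>)\<close>, which leads to the factor 3/4.\<close>
    define p where "p = (R / norm z) *\<^sub>R z"
    have p: "p \<in> cball 0 R" "norm p = R" "p \<bullet> z = R * norm z"
      using False R by (auto simp: p_def dot_square_norm power2_eq_square)
    have "R * norm z - R\<^sup>2 / (2 * \<Lambda>) + H p \<bullet> \<beta> \<le> 2 * K + 1"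
      using order_trans[OF legendre_ge[OF p(1)] le] p by (simp add: kin_def)
    then have "R * norm z \<le> R\<^sup>2 / (2 * \<Lambda>) + 2 * (K + 1)" using H_inner_bound[OF p(1), of \<beta>] \<beta> by (simp add: abs_le_iff)
    also have "2 * (K + 1) = R\<^sup>2 / (4 * \<Lambda>)" using R2 \<Lambda> by simp
    also have "R\<^sup>2 / (2 * \<Lambda>) + R\<^sup>2 / (4 * \<Lambda>) = R * (3 * R / (4 * \<Lambda>))" using \<Lambda> by (simp add: field_simps power2_eq_square)
    finally show ?thesis using R by (metis mult_le_cancel_left_pos)
  qed
  have l: "norm (\<Lambda> *\<^sub>R z) \<le> 3 * R / 4" using z \<Lambda> by (simp add: field_simps)
  then have lR: "\<Lambda> *\<^sub>R z \<in> cball 0 R" using R by simp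
  \<comment> \<open>Completing the square: without noise \<open>kin\<close> is maximal at \<Lambda>
    z. The two noise terms move \<open>P\<close> by less than R / 4, which together with 3R / 4
    stays below \<open>R\<close>.\<close>
  have "(norm (P - \<Lambda> *\<^sub>R z))\<^sup>2 / (2 * \<Lambda>) = kin H \<Lambda> \<beta> z (\<Lambda> *\<^sub>R z) - kin H \<Lambda> \<beta> z P + (H P \<bullet> \<beta> - H (\<Lambda> *\<^sub>R z) \<bullet> \<beta>)"
  proof -
    have "(norm (P - \<Lambda> *\<^sub>R z))\<^sup>2 = (norm P)\<^sup>2 - 2 * \<Lambda> * (P \<bullet> z) + \<Lambda>\<^sup>2 * (norm z)\<^sup>2"
      unfolding power2_norm_eq_inner
      by (simp add: inner_diff_left inner_diff_right inner_commute[of z P] power2_eq_square algebra_simps)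
    then show ?thesis using \<Lambda>
      by (simp add: kin_def dot_square_norm power_mult_distrib) (simp add: field_simps power2_eq_square)
  qed
  also have "\<dots> \<le> 0 + (C * norm \<beta> + C * norm \<beta>)"
    using P(2)[OF lR] H_inner_bound[OF lR, of \<beta>] H_inner_bound[OF P(1), of \<beta>] by (simp add: abs_le_iff)
  also have "\<dots> \<le> (K + 1) / 8" using \<beta> K by simp
  also have "\<dots> = (R / 8)\<^sup>2 / \<Lambda>" using R2 \<Lambda> by (simp add: power_divide field_simps)
  finally have "(norm (P - \<Lambda> *\<^sub>R z))\<^sup>2 \<le> 2 * (R / 8)\<^sup>2" using \<Lambda> by (simp add: field_simps)
  also have "\<dots> < (R / 4)\<^sup>2" using R by (simp add: power_divide)
  finally have "norm (P - \<Lambda> *\<^sub>R z) < R / 4"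
    by (rule power_less_imp_less_base) (use R in simp)
  then show "P \<in> ball 0 R" using l norm_triangle_sub[of P "\<Lambda> *\<^sub>R z"] by simp
qed

end

text \<open>The sizes keep maximisers off the boundary of the domain: 3R / (4\<Lambda>) is the
  largest spatial displacement and \<open>r\<close> exceeds it by more than \<open>h\<close>, while
  the condition on \<epsilon> keeps the maximising time within h / 2 of the base time.\<close>

locale sup_convolution = hamiltonian H \<Lambda> R C
  for H :: "real^'d \<Rightarrow> real^'m" and \<Lambda> R C +
  fixes B :: "real \<Rightarrow> real^'m" and u :: "(real^'d) \<times> real \<Rightarrow> real" and K :: real
    and \<xi>0 :: "real^'d" and t0 r h \<epsilon> :: real
  assumes contB: "continuous_on {0..} B"
    and K: "0 \<le> K" and u_bound: "\<And>x t. 0 \<le> t \<Longrightarrow> \<bar>u (x, t)\<bar> \<le> K"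
    and contu: "continuous_on (UNIV \<times> {0..}) u"
    and R2: "R\<^sup>2 = 8 * \<Lambda> * (K + 1)"
    and h: "0 < h" "h < t0"
    and Bsmall: "\<And>s. \<bar>s - t0\<bar> \<le> h \<Longrightarrow> C * norm (B s - B t0) \<le> 1 / 16 \<and> C * norm (B s - B t0) \<le> 1 / (4 * \<Lambda>)"
    and r: "3 * R / (4 * \<Lambda>) + h < r"
    and \<epsilon>: "0 < \<epsilon>" "2 * \<epsilon> * (2 * K + 2) < (h / 2)\<^sup>2"
begin

definition D :: "((real^'d) \<times> real) set" where
  "D = cball \<xi>0 r \<times> cball t0 h"

text \<open>The noise is read at the time of \<open>y\<close>, not of \<open>w\<close>: the base
  point enters only through the spatial argument of the kernel and a quadratic in time. This gives
  semiconvexity in \<open>w\<close> for a path that is only continuous.\<close>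

definition obj :: "(real^'d) \<times> real \<Rightarrow> (real^'d) \<times> real \<Rightarrow> real" where
  "obj w y = u y - \<Phi> (B (snd y) - B t0) (fst y - fst w) - (snd w - snd y)\<^sup>2 / (2 * \<epsilon>)"

definition sconv :: "(real^'d) \<times> real \<Rightarrow> real" where
  "sconv w = (SUP y\<in>D. obj w y)"

lemma legendre_cont: "continuous_on UNIV (\<lambda>q. \<Phi> (fst q) (snd q))"
proof (rule lipschitz_on_continuous_on[where L = "R + C"], rule lipschitz_onI)
  fix q q' :: "(real^'m) \<times> (real^'d)"
  have "\<bar>\<Phi> (fst q) (snd q) - \<Phi> (fst q') (snd q')\<bar> \<le> R * dist (snd q) (snd q') + C * dist (fst q) (fst q')"
    using legendre_lipschitz by (simp add: dist_norm)
  also have "\<dots> \<le> R * dist q q' + C * dist q q'"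
    using R C dist_snd_le[of q q'] dist_fst_le[of q q'] by (intro add_mono mult_left_mono) auto
  finally show "dist (\<Phi> (fst q) (snd q)) (\<Phi> (fst q') (snd q')) \<le> (R + C) * dist q q'"
    by (simp add: dist_real_def distrib_right)
qed (use R C in auto)

lemma D_nonneg: "(x, s) \<in> D \<Longrightarrow> 0 \<le> s"
  using h by (auto simp: D_def dist_real_def)

lemma sconv_attained: "\<exists>y\<in>D. sconv w = obj w y \<and> (\<forall>y'\<in>D. obj w y' \<le> obj w y)"
proof -
  have D0: "D \<subseteq> UNIV \<times> {0..}" using D_nonneg by auto
  have cB: "continuous_on D (\<lambda>y. B (snd y))"
    using D0 by (intro continuous_on_compose2[OF contB] continuous_intros) auto
  have "continuous_on D (obj w)"
    unfolding obj_def[abs_def] using \<epsilon>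
    by (intro continuous_intros continuous_on_subset[OF contu D0] cB
        continuous_on_compose2[OF legendre_cont, where f = "\<lambda>y. (B (snd y) - B t0, fst y - fst w)", simplified]) auto
  moreover have "compact D" "D \<noteq> {}" using r h R \<Lambda> by (auto simp: D_def compact_Times not_less intro: add_nonneg_nonneg)
     (smt (verit) divide_nonneg_pos mult_nonneg_nonneg)
  ultimately obtain y where y: "y \<in> D" "\<forall>y'\<in>D. obj w y' \<le> obj w y"
    using continuous_attains_sup by metis
  then have "sconv w = obj w y" unfolding sconv_def by (intro cSup_eq_maximum) auto
  then show ?thesis using y by blast
qed

lemma sconv_ge: "y \<in> D \<Longrightarrow> obj w y \<le> sconv w"
  using sconv_attained[of w] by auto

definition maximizer :: "(real^'d) \<times> real \<Rightarrow> real^'d \<Rightarrow> real \<Rightarrow> real^'d \<Rightarrow> bool" where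
  "maximizer w x s P \<longleftrightarrow> norm (x - \<xi>0) < r \<and> \<bar>s - t0\<bar> < h \<and> (snd w - s)\<^sup>2 \<le> 2 * \<epsilon> * (2 * K + 2) \<and>
     sconv w = obj w (x, s) \<and> P \<in> ball 0 R \<and>
     (\<forall>p\<in>cball 0 R. kin H \<Lambda> (B s - B t0) (x - fst w) p \<le> kin H \<Lambda> (B s - B t0) (x - fst w) P)"

text \<open>Comparison with \<open>y = w\<close>, where both penalties nearly vanish, bounds the
  penalties at the maximum by the oscillation of \<open>u\<close>. The bound keeps the time and the
  point interior and, through \<open>legendre_bounded_imp_interior\<close>, the momentum as
  well.\<close>

lemma maximizer_exists:
  assumes w: "w \<in> cball (\<xi>0, t0) (h / 2)"
  shows "\<exists>x s P. maximizer w x s P"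
proof -
  obtain \<xi> t where wt: "w = (\<xi>, t)" by (cases w)
  have \<xi>: "norm (\<xi> - \<xi>0) \<le> h / 2" and t: "\<bar>t - t0\<bar> \<le> h / 2"
    using w dist_fst_le[of "(\<xi>0, t0)" w] dist_snd_le[of "(\<xi>0, t0)" w]
    by (auto simp: wt dist_norm norm_minus_commute dist_real_def abs_minus_commute)
  obtain x s where y: "(x, s) \<in> D" "sconv w = obj w (x, s)" "\<forall>y'\<in>D. obj w y' \<le> obj w (x, s)"
    using sconv_attained[of w] by auto
  have s: "\<bar>s - t0\<bar> \<le> h" using y(1) by (simp add: D_def dist_real_def abs_minus_commute)
  have R0: "0 \<le> 3 * R / (4 * \<Lambda>)" using R \<Lambda> by simp
  have "(\<xi>, t) \<in> D" using \<xi> t h r R0 by (auto simp: D_def dist_norm norm_minus_commute dist_real_def abs_minus_commute)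
  then have "obj w (\<xi>, t) \<le> obj w (x, s)" using y(3) by blast
  moreover have "\<Phi> (B t - B t0) 0 \<le> 1 / 16"
    using legendre_at_0[of "B t - B t0"] Bsmall[of t] t h by auto
  moreover have "0 \<le> t" "0 \<le> s" using t s h by linarith+
  then have "\<bar>u (\<xi>, t)\<bar> \<le> K" "\<bar>u (x, s)\<bar> \<le> K" using u_bound by auto
  ultimately have le: "\<Phi> (B s - B t0) (x - \<xi>) + (t - s)\<^sup>2 / (2 * \<epsilon>) \<le> 2 * K + 1 / 16"
    by (simp add: obj_def wt)
  have "\<Phi> (B s - B t0) (x - \<xi>) \<ge> - (1 / 16)"
    using legendre_lower[of "B s - B t0" "x - \<xi>"] Bsmall[OF s] by linarith
  then have "(t - s)\<^sup>2 / (2 * \<epsilon>) \<le> 2 * K + 2" using le by linarith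
  then have ts: "(t - s)\<^sup>2 \<le> 2 * \<epsilon> * (2 * K + 2)" using \<epsilon> by (simp add: field_simps)
  then have "\<bar>t - s\<bar> < h / 2" using \<epsilon>(2) h by (intro power2_less_imp_less[of "\<bar>t - s\<bar>"]) auto
  then have s': "\<bar>s - t0\<bar> < h" using t by linarith
  obtain P where P: "P \<in> cball 0 R" "\<And>p. p \<in> cball 0 R \<Longrightarrow> kin H \<Lambda> (B s - B t0) (x - \<xi>) p \<le> kin H \<Lambda> (B s - B t0) (x - \<xi>) P"
    using legendre_attained by blast
  have "0 \<le> (t - s)\<^sup>2 / (2 * \<epsilon>)" using \<epsilon> by simp
  then have \<Phi>le: "\<Phi> (B s - B t0) (x - \<xi>) \<le> 2 * K + 1" using le by linarith
  have int: "norm (x - \<xi>) \<le> 3 * R / (4 * \<Lambda>)" "P \<in> ball 0 R"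
    using legendre_bounded_imp_interior[OF K R2 _ \<Phi>le P] Bsmall[OF s] by auto
  have "norm (x - \<xi>0) < r" using norm_triangle_ineq[of "x - \<xi>" "\<xi> - \<xi>0"] int(1) \<xi> r h by simp
  then have "maximizer w x s P"
    unfolding maximizer_def wt fst_conv snd_conv using s' ts y(2)[unfolded wt] int(2) P(2) by blast
  then show ?thesis by blast
qed

lemma maximizer_D: "maximizer w x s P \<Longrightarrow> (x, s) \<in> D"
  by (auto simp: maximizer_def D_def dist_norm norm_minus_commute dist_real_def abs_minus_commute)

text \<open>The maximiser for \<open>w\<close> is kept as a competitor for \<open>w'\<close>, so the
  upper paraboloid of the kernel becomes a lower paraboloid of \<open>sconv\<close>.\<close>

lemma maximizer_paraboloid:
  assumes m: "maximizer w x s P"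
  shows "sconv w' \<ge> sconv w + (P, (s - snd w) / \<epsilon>) \<bullet> (w' - w) - \<Lambda> * (norm (fst w' - fst w))\<^sup>2 - (snd w' - snd w)\<^sup>2 / (2 * \<epsilon>)"
proof -
  have \<beta>: "C * norm (B s - B t0) \<le> 1 / (4 * \<Lambda>)" using m Bsmall[of s] by (auto simp: maximizer_def)
  have "\<Phi> (B s - B t0) (x - fst w') \<le> \<Phi> (B s - B t0) (x - fst w) + P \<bullet> ((x - fst w') - (x - fst w)) + \<Lambda> * (norm ((x - fst w') - (x - fst w)))\<^sup>2"
    using m \<beta> by (intro legendre_upper_paraboloid) (auto simp: maximizer_def)
  then have 1: "\<Phi> (B s - B t0) (x - fst w') \<le> \<Phi> (B s - B t0) (x - fst w) - P \<bullet> (fst w' - fst w) + \<Lambda> * (norm (fst w' - fst w))\<^sup>2"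
    by (simp add: inner_diff_right norm_minus_commute)
  have 2: "(snd w' - s)\<^sup>2 / (2 * \<epsilon>) = (snd w - s)\<^sup>2 / (2 * \<epsilon>) - (s - snd w) / \<epsilon> * (snd w' - snd w) + (snd w' - snd w)\<^sup>2 / (2 * \<epsilon>)"
    using \<epsilon> by (simp add: field_simps power2_eq_square)
  have "obj w' (x, s) \<le> sconv w'" by (rule sconv_ge[OF maximizer_D[OF m]])
  moreover have "sconv w = obj w (x, s)" using m by (simp add: maximizer_def)
  ultimately show ?thesis using 1 2 by (simp add: obj_def inner_prod_def)
qed

lemma sconv_semiconvex:
  assumes "z \<in> cball (\<xi>0, t0) (h / 2)"
  shows "\<exists>p. \<forall>w. sconv w \<ge> sconv z + p \<bullet> (w - z) - (\<Lambda> + 1 / (2 * \<epsilon>)) * (norm (w - z))\<^sup>2"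
proof -
  obtain x s P where m: "maximizer z x s P" using maximizer_exists[OF assms] by blast
  have "\<Lambda> * (norm (fst w - fst z))\<^sup>2 + (snd w - snd z)\<^sup>2 / (2 * \<epsilon>) \<le> (\<Lambda> + 1 / (2 * \<epsilon>)) * (norm (w - z))\<^sup>2" for w
  proof -
    have n: "(norm (w - z))\<^sup>2 = (norm (fst w - fst z))\<^sup>2 + (snd w - snd z)\<^sup>2"
      by (simp add: norm_prod_def)
    have "\<Lambda> * (norm (fst w - fst z))\<^sup>2 \<le> \<Lambda> * (norm (w - z))\<^sup>2" using \<Lambda> n by (intro mult_left_mono) auto
    moreover have "1 / (2 * \<epsilon>) * (snd w - snd z)\<^sup>2 \<le> 1 / (2 * \<epsilon>) * (norm (w - z))\<^sup>2" using \<epsilon> n by (intro mult_left_mono) auto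
    ultimately show ?thesis by (simp add: distrib_right)
  qed
  then show ?thesis using maximizer_paraboloid[OF m]
    by (intro exI[of _ "(P, (s - snd z) / \<epsilon>)"] allI) (smt (verit, best))
qed

lemma sconv_cont: "continuous_on (cball (\<xi>0, t0) (h / 2)) sconv"
proof (rule lipschitz_on_continuous_on[where L = "R + 4 * h / (2 * \<epsilon>)"], rule lipschitz_onI)
  have le: "sconv w \<le> sconv w' + (R + 4 * h / (2 * \<epsilon>)) * dist w w'"
    if w: "w \<in> cball (\<xi>0, t0) (h / 2)" "w' \<in> cball (\<xi>0, t0) (h / 2)" for w w'
  proof -
    obtain x s where y: "(x, s) \<in> D" "sconv w = obj w (x, s)" using sconv_attained[of w] by auto
    have "\<bar>snd w - t0\<bar> \<le> h / 2" "\<bar>snd w' - t0\<bar> \<le> h / 2" "\<bar>s - t0\<bar> \<le> h"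
      using w y(1) dist_snd_le[of "(\<xi>0, t0)" w] dist_snd_le[of "(\<xi>0, t0)" w']
      by (auto simp: D_def dist_real_def abs_minus_commute)
    then have b: "\<bar>snd w + snd w' - 2 * s\<bar> \<le> 4 * h" by linarith
    have "(snd w' - s)\<^sup>2 - (snd w - s)\<^sup>2 = (snd w' - snd w) * (snd w + snd w' - 2 * s)"
      by (simp add: power2_eq_square algebra_simps)
    also have "\<dots> \<le> \<bar>snd w' - snd w\<bar> * \<bar>snd w + snd w' - 2 * s\<bar>" by (metis abs_ge_self abs_mult)
    also have "\<dots> \<le> dist w w' * (4 * h)"
      using b dist_snd_le[of w w'] by (intro mult_mono) (auto simp: dist_real_def abs_minus_commute)
    finally have "((snd w' - s)\<^sup>2 - (snd w - s)\<^sup>2) / (2 * \<epsilon>) \<le> dist w w' * (4 * h) / (2 * \<epsilon>)"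
      using \<epsilon> by (intro divide_right_mono) auto
    moreover have "\<Phi> (B s - B t0) (x - fst w') - \<Phi> (B s - B t0) (x - fst w) \<le> R * dist w w'"
    proof -
      have "\<Phi> (B s - B t0) (x - fst w') - \<Phi> (B s - B t0) (x - fst w) \<le> R * norm ((x - fst w') - (x - fst w))"
        using legendre_lipschitz[of "B s - B t0" "x - fst w'" "B s - B t0" "x - fst w"] by simp
      also have "\<dots> \<le> R * dist w w'" using R dist_fst_le[of w w'] by (intro mult_left_mono) (auto simp: dist_norm)
      finally show ?thesis .
    qed
    moreover have "obj w' (x, s) \<le> sconv w'" by (rule sconv_ge[OF y(1)])
    moreover have "dist w w' * (4 * h) / (2 * \<epsilon>) = 4 * h / (2 * \<epsilon>) * dist w w'" by simp
    ultimately show ?thesis using y(2)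
      unfolding obj_def distrib_right diff_divide_distrib fst_conv snd_conv by linarith
  qed
  fix w w' assume w: "w \<in> cball (\<xi>0, t0) (h / 2)" "w' \<in> cball (\<xi>0, t0) (h / 2)"
  show "dist (sconv w) (sconv w') \<le> (R + 4 * h / (2 * \<epsilon>)) * dist w w'"
    using le[OF w] le[OF w(2,1)] by (simp add: dist_real_def abs_le_iff dist_commute)
qed (use R h \<epsilon> in auto)

text \<open>The multiple of the identity absorbs the mixed space-time part of the expansion and the error of
  moving along characteristics.\<close>

lemma sconv_subsolution:
  fixes A :: "(real^'d) \<times> real \<Rightarrow> (real^'d) \<times> real"
  assumes sub: "pathwise_subsolution F H B u" and z: "z \<in> cball (\<xi>0, t0) (h / 2)"
    and so: "second_order_at sconv z p A"
  shows "\<exists>X. transpose X = X \<and> (\<forall>k. k \<bullet> (X *v k) = A (k, 0) \<bullet> (k, 0)) \<and>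
    (\<forall>k. k \<bullet> (X *v k) \<ge> - (2 * \<Lambda>) * (norm k)\<^sup>2) \<and> norm (fst p) < R \<and>
    (\<forall>\<delta>>0. snd p \<le> F (X + \<delta> *\<^sub>R mat 1) (fst p))"
proof -
  note A = second_order_atD(1)[OF so] and expn = second_order_atD(2)[OF so]
  obtain x s P where m: "maximizer z x s P" using maximizer_exists[OF z] by blast
  obtain \<xi> t where zt: "z = (\<xi>, t)" by (cases z)
  obtain c where c: "0 < c" "\<And>w. norm (A w) \<le> norm w * c"
    using bounded_linear.pos_bounded[OF linear_conv_bounded_linear[THEN iffD1, OF A]] by blast
  have Aq: "\<bar>A w \<bullet> v\<bar> \<le> c * norm w * norm v" for w v
    using Cauchy_Schwarz_ineq2[of "A w" v] mult_right_mono[OF c(2)[of w], of "norm v"] by (simp add: mult_ac)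
  define a where "a = (s - t) / \<epsilon>"
  \<comment> \<open>The expansion bounds \<open>sconv\<close> from above to first order, the
    paraboloid of the maximiser from below, so the slopes agree.\<close>
  have "(P, a) - p = 0"
  proof (rule eq_0_if_inner_le_square)
    show "\<forall>\<^sub>F w in nhds z. ((P, a) - p) \<bullet> (w - z) \<le> ((\<Lambda> + 1 / (2 * \<epsilon>)) + c / 2 + 1) * (norm (w - z))\<^sup>2"
      using expn[OF zero_less_one]
    proof eventually_elim
      case (elim w)
      have n: "(norm (w - z))\<^sup>2 = (norm (fst w - fst z))\<^sup>2 + (snd w - snd z)\<^sup>2"
        by (simp add: norm_prod_def)
      have "\<Lambda> * (norm (fst w - fst z))\<^sup>2 \<le> \<Lambda> * (norm (w - z))\<^sup>2" using \<Lambda> n by (intro mult_left_mono) auto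
      moreover have "(snd w - snd z)\<^sup>2 / (2 * \<epsilon>) \<le> 1 / (2 * \<epsilon>) * (norm (w - z))\<^sup>2"
        using \<epsilon> n mult_left_mono[of "(snd w - snd z)\<^sup>2" "(norm (w - z))\<^sup>2" "1 / (2 * \<epsilon>)"] by auto
      moreover have "A (w - z) \<bullet> (w - z) / 2 \<le> c / 2 * (norm (w - z))\<^sup>2"
        using Aq[of "w - z" "w - z"] by (simp add: power2_eq_square abs_le_iff)
      ultimately show ?case
        using elim maximizer_paraboloid[OF m, of w]
        by (simp add: a_def zt inner_diff_left distrib_right abs_le_iff)
    qed
  qed
  then have p: "p = (P, a)" by simp
  \<comment> \<open>The symmetrised spatial block of \<open>A\<close>.\<close>
  define X :: "real^'d^'d" where "X = (\<chi> i j. (A (axis i 1, 0) \<bullet> (axis j 1, 0) + A (axis j 1, 0) \<bullet> (axis i 1, 0)) / 2)"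
  have symX: "transpose X = X" by (simp add: X_def transpose_def vec_eq_iff add.commute)
  have qX: "k \<bullet> (X *v k) = A (k, 0) \<bullet> (k, 0)" for k
  proof -
    have kk: "(k, 0) = (\<Sum>i\<in>UNIV. k $ i *\<^sub>R (axis i 1, 0 :: real))"
    proof -
      have "(\<Sum>i\<in>UNIV. k $ i *\<^sub>R (axis i 1 :: real^'d, 0 :: real)) = (\<Sum>i\<in>UNIV. k $ i *\<^sub>R axis i 1, 0)"
        by (simp add: sum_prod prod_eq_iff fst_sum snd_sum)
      moreover have "(\<Sum>i\<in>UNIV. k $ i *\<^sub>R axis i 1) = k"
        by (simp add: basis_expansion[of k, unfolded scalar_mult_eq_scaleR])
      ultimately show ?thesis by simp
    qed
    define S where "S = (\<Sum>i\<in>UNIV. \<Sum>j\<in>UNIV. k $ i * (k $ j * (A (axis i 1, 0) \<bullet> (axis j 1, 0))))"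
    have 1: "A (k, 0) \<bullet> (k, 0) = S"
      by (subst (1 2) kk) (simp add: linear_sum[OF A] linear_scale[OF A] inner_sum_left inner_sum_right S_def mult_ac
          del: scaleR_Pair, subst sum.swap, simp add: mult_ac sum_distrib_left)
    have 2: "S = (\<Sum>i\<in>UNIV. \<Sum>j\<in>UNIV. k $ i * (k $ j * (A (axis j 1, 0) \<bullet> (axis i 1, 0))))"
      unfolding S_def by (subst sum.swap) (simp add: mult_ac)
    have "k \<bullet> (X *v k) = (\<Sum>i\<in>UNIV. \<Sum>j\<in>UNIV. k $ i * (k $ j * (A (axis i 1, 0) \<bullet> (axis j 1, 0))) / 2
       + k $ i * (k $ j * (A (axis j 1, 0) \<bullet> (axis i 1, 0))) / 2)"
      by (simp add: inner_vec_def matrix_vector_mult_def X_def sum_distrib_left field_simps)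
    also have "\<dots> = S / 2 + S / 2" unfolding sum.distrib sum_divide_distrib[symmetric] S_def[symmetric] 2[symmetric] ..
    finally show ?thesis using 1 by simp
  qed
  \<comment> \<open>Purely spatial increments do not feel the time penalty, so this bound is free of
    \<epsilon>.\<close>
  have lowX: "k \<bullet> (X *v k) \<ge> - (2 * \<Lambda>) * (norm k)\<^sup>2" for k
  proof -
    have "- (2 * \<Lambda>) * (norm k)\<^sup>2 \<le> k \<bullet> (X *v k) + 2 * e * (norm k)\<^sup>2" if e: "0 < e" for e
    proof -
      obtain d where d: "0 < d" "\<And>w. dist w z < d \<Longrightarrow>
          \<bar>sconv w - sconv z - p \<bullet> (w - z) - A (w - z) \<bullet> (w - z) / 2\<bar> \<le> e * (norm (w - z))\<^sup>2"
        using expn[OF e] unfolding eventually_nhds_metric by blast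
      define \<tau> where "\<tau> = d / (norm k + 1)"
      have \<tau>: "0 < \<tau>" "\<tau> * norm k < d"
      proof -
        have "0 < norm k + 1" by (simp add: add_nonneg_pos)
        then show "0 < \<tau>" "\<tau> * norm k < d"
          using d(1) by (simp_all add: \<tau>_def pos_divide_less_eq distrib_left)
      qed
      define w where "w = (\<xi> + \<tau> *\<^sub>R k, t)"
      have wz: "w - z = \<tau> *\<^sub>R (k, 0)" "fst w - fst z = \<tau> *\<^sub>R k" "snd w - snd z = 0" by (auto simp: w_def zt)
      have "dist w z < d" using \<tau> by (simp add: dist_norm wz norm_Pair)
      then have "sconv w \<le> sconv z + p \<bullet> (w - z) + A (w - z) \<bullet> (w - z) / 2 + e * (norm (w - z))\<^sup>2"
        using d(2)[of w] by (simp add: abs_le_iff)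
      moreover have "sconv w \<ge> sconv z + p \<bullet> (w - z) - \<Lambda> * (norm (\<tau> *\<^sub>R k))\<^sup>2"
        using maximizer_paraboloid[OF m, of w] by (simp add: p a_def zt w_def)
      ultimately have "- \<Lambda> * (norm (\<tau> *\<^sub>R k))\<^sup>2 \<le> A (w - z) \<bullet> (w - z) / 2 + e * (norm (w - z))\<^sup>2" by simp
      also have "\<dots> = \<tau>\<^sup>2 * (k \<bullet> (X *v k) / 2 + e * (norm k)\<^sup>2)"
        unfolding wz linear_scale[OF A] qX
        by (simp add: norm_Pair power_mult_distrib power2_eq_square algebra_simps del: scaleR_Pair)
      finally have "\<tau>\<^sup>2 * (- \<Lambda> * (norm k)\<^sup>2) \<le> \<tau>\<^sup>2 * (k \<bullet> (X *v k) / 2 + e * (norm k)\<^sup>2)"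
        by (simp add: power_mult_distrib mult_ac)
      then have "- \<Lambda> * (norm k)\<^sup>2 \<le> k \<bullet> (X *v k) / 2 + e * (norm k)\<^sup>2"
        using mult_le_cancel_left_pos[of "\<tau>\<^sup>2"] \<tau>(1) zero_less_power by blast
      then show ?thesis by simp
    qed
    then have ev: "\<forall>\<^sub>F e in at_right 0. - (2 * \<Lambda>) * (norm k)\<^sup>2 \<le> k \<bullet> (X *v k) + 2 * e * (norm k)\<^sup>2"
      using eventually_at_right_real[of 0 1] by (auto elim!: eventually_mono)
    have "- (2 * \<Lambda>) * (norm k)\<^sup>2 \<le> k \<bullet> (X *v k) + 2 * 0 * (norm k)\<^sup>2"
      by (rule tendsto_le[OF trivial_limit_at_right_real _ tendsto_const ev]) (intro tendsto_intros)
    then show ?thesis by simp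
  qed
  have PR: "norm P < R" using m by (simp add: maximizer_def)
  have s: "\<bar>s - t0\<bar> < h" "norm (x - \<xi>0) < r" using m by (auto simp: maximizer_def)
  have s0: "0 < s" using s h by linarith
  have \<beta>s: "C * norm (B s - B t0) \<le> 1 / (4 * \<Lambda>)" using Bsmall[of s] s by auto
  have contBs: "isCont B s"
    using continuous_on_subset[OF contB, of "{0<..}"] s0 by (simp add: continuous_on_eq_continuous_at subset_iff)
  \<comment> \<open>Raising the Hessian by \<delta> gains \<delta>/2, of which \<delta>/4 goes to
    the test lemma. The other \<delta>/4 pays three errors of \<delta>/16: the expansion, the mixed
    block of \<open>A\<close> by Young's inequality, and the kernel along characteristics. The
    constant in time collects the time block, the other half of Young's inequality and the
    expansion.\<close>
  have test: "a \<le> F (X + \<delta> *\<^sub>R mat 1) P" if \<delta>: "0 < \<delta>" for \<delta>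
  proof (rule pathwise_subsolution_test[OF C2H contB sub s0, where \<delta> = "\<delta> / 4" and x = x
        and c = "c / 2 + 4 * c\<^sup>2 / \<delta> + \<delta> / 16"])
    show "transpose (X + \<delta> *\<^sub>R mat 1) = X + \<delta> *\<^sub>R mat 1"
      using symX by (simp add: transpose_def vec_eq_iff mat_def)
    show "0 < \<delta> / 4" using \<delta> by simp
    fix M :: real
    define M' where "M' = \<bar>M\<bar> + 1"
    have M': "0 < M'" "M \<le> M'" by (auto simp: M'_def)
    obtain d where d: "0 < d" "\<And>w. dist w z < d \<Longrightarrow>
        \<bar>sconv w - sconv z - p \<bullet> (w - z) - A (w - z) \<bullet> (w - z) / 2\<bar> \<le> \<delta> / 16 * (norm (w - z))\<^sup>2"
      using expn[of "\<delta> / 16"] \<delta> unfolding eventually_nhds_metric by auto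
    \<comment> \<open>In turn: what \<open>legendre_along_characteristic\<close> asks of the noise,
      the bound that makes its slope error at most \<delta>/16 times the square of
      \<open>norm k\<close>, and room for the displaced point inside \<open>D\<close>.\<close>
    define b0 where "b0 = min (1 / (8 * \<Lambda>)) (min (\<delta> / (32 * M'\<^sup>2)) ((r - norm (x - \<xi>0)) / 2))"
    have b0: "0 < b0" using \<Lambda> \<delta> M' s by (simp add: b0_def)
    obtain d2 where d2: "0 < d2" "\<And>s'. \<bar>s' - s\<bar> < d2 \<Longrightarrow> C * norm (B s' - B s) < b0"
    proof -
      have "0 < b0 / (C + 1)" using b0 C by simp
      then obtain d2 where d2: "0 < d2" "\<And>s'. \<bar>s' - s\<bar> < d2 \<Longrightarrow> norm (B s' - B s) < b0 / (C + 1)"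
        using contBs unfolding continuous_at_eps_delta by (auto simp: dist_norm)
      have "C * norm (B s' - B s) < b0" if "\<bar>s' - s\<bar> < d2" for s'
      proof -
        have "C * norm (B s' - B s) \<le> C * (b0 / (C + 1))" using d2(2)[OF that] C by (intro mult_left_mono) auto
        also have "\<dots> < b0" using b0 C by (simp add: field_simps)
        finally show ?thesis .
      qed
      then show ?thesis using that d2(1) by blast
    qed
    define \<rho> where "\<rho> = min (min (d / 2) d2) (min (h - \<bar>s - t0\<bar>) (min ((r - norm (x - \<xi>0)) / 2) ((R - norm P) / M')))"
    have \<rho>: "0 < \<rho>" using d d2 s PR M' by (simp add: \<rho>_def)
    show "\<exists>r>0. \<forall>k s' Q. norm k < r \<and> \<bar>s' - s\<bar> < r \<and> norm (Q - P) \<le> M * norm k \<longrightarrow>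
      u (x + k - Hgrad H (B s' - B s) Q, s') \<le> u (x, s) + P \<bullet> k + k \<bullet> ((X + \<delta> *\<^sub>R mat 1) *v k) / 2 - \<delta> / 4 * (norm k)\<^sup>2
        + (H Q \<bullet> (B s' - B s) - Q \<bullet> Hgrad H (B s' - B s) Q) + a * (s' - s) + (c / 2 + 4 * c\<^sup>2 / \<delta> + \<delta> / 16) * (s' - s)\<^sup>2"
    proof (intro exI[of _ \<rho>] conjI allI impI \<rho>, elim conjE)
      fix k Q :: "real^'d" and s' :: real assume k: "norm k < \<rho>" and s': "\<bar>s' - s\<bar> < \<rho>" and QP: "norm (Q - P) \<le> M * norm k"
      define b where "b = B s' - B s"
      define \<tau> where "\<tau> = s' - s"
      have QP': "norm (Q - P) \<le> M' * norm k" using QP M'(2) mult_right_mono[OF M'(2), of "norm k"] by simp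
      have Cb: "C * norm b < b0" using d2(2)[of s'] s' by (simp add: \<rho>_def b_def)
      have "M' * norm k \<le> M' * ((R - norm P) / M')" using k M' by (intro mult_left_mono) (auto simp: \<rho>_def)
      then have "norm (Q - P) \<le> R - norm P" using QP' M' by simp
      then have Q: "Q \<in> cball 0 R" using norm_triangle_ineq[of "Q - P" P] by simp
      define x' where "x' = x + k - Hgrad H b Q"
      have "norm (x' - \<xi>0) \<le> norm (x - \<xi>0) + norm k + norm (Hgrad H b Q)"
        using norm_triangle_ineq4[of "(x - \<xi>0) + k" "Hgrad H b Q"] norm_triangle_ineq[of "x - \<xi>0" k]
        by (simp add: x'_def algebra_simps)
      also have "\<dots> \<le> r" using Hgrad_bound[OF Q, of b] Cb k by (simp add: b0_def \<rho>_def)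
      finally have "(x', s') \<in> D" using s' by (auto simp: D_def dist_norm norm_minus_commute dist_real_def \<rho>_def)
      \<comment> \<open>The base point moves by the same k and \<tau> as the test point. The time
        penalty is then unchanged, and the argument of the kernel changes by the noise displacement
        alone.\<close>
      define w where "w = (\<xi> + k, t + \<tau>)"
      have wz: "w - z = (k, \<tau>)" by (simp add: w_def zt)
      have nw: "(norm (w - z))\<^sup>2 = (norm k)\<^sup>2 + \<tau>\<^sup>2" by (simp add: wz norm_Pair)
      have "norm (w - z) \<le> norm k + \<bar>\<tau>\<bar>" using norm_triangle_ineq[of "(k, 0)" "(0, \<tau>)"] by (simp add: wz norm_Pair)
      then have "dist w z < d" using k s' by (simp add: dist_norm \<rho>_def \<tau>_def)
      from d(2)[OF this]
      have "\<bar>sconv w - sconv z - (P \<bullet> k + a * \<tau>) - A (k, \<tau>) \<bullet> (k, \<tau>) / 2\<bar> \<le> \<delta> / 16 * ((norm k)\<^sup>2 + \<tau>\<^sup>2)"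
        unfolding nw unfolding wz by (simp add: p)
      then have 1: "sconv w \<le> sconv z + (P \<bullet> k + a * \<tau>) + A (k, \<tau>) \<bullet> (k, \<tau>) / 2 + \<delta> / 16 * ((norm k)\<^sup>2 + \<tau>\<^sup>2)"
        unfolding abs_le_iff by linarith
      have 2: "A (k, \<tau>) \<bullet> (k, \<tau>) / 2 \<le> k \<bullet> (X *v k) / 2 + (\<delta> / 16 * (norm k)\<^sup>2 + 4 * c\<^sup>2 / \<delta> * \<tau>\<^sup>2) + c / 2 * \<tau>\<^sup>2"
      proof -
        have sp: "(k, \<tau>) = (k, 0) + (0, \<tau>)" by simp
        have "A (k, \<tau>) \<bullet> (k, \<tau>) = A (k, 0) \<bullet> (k, 0) + A (k, 0) \<bullet> (0, \<tau>) + A (0, \<tau>) \<bullet> (k, 0) + A (0, \<tau>) \<bullet> (0, \<tau>)"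
          unfolding sp linear_add[OF A] inner_add_left inner_add_right by simp
        moreover have "\<bar>A (k, 0) \<bullet> (0, \<tau>)\<bar> \<le> c * norm k * \<bar>\<tau>\<bar>" "\<bar>A (0, \<tau>) \<bullet> (k, 0)\<bar> \<le> c * norm k * \<bar>\<tau>\<bar>"
          "\<bar>A (0, \<tau>) \<bullet> (0, \<tau>)\<bar> \<le> c * \<tau>\<^sup>2"
          using Aq[of "(k, 0)" "(0, \<tau>)"] Aq[of "(0, \<tau>)" "(k, 0)"] Aq[of "(0, \<tau>)" "(0, \<tau>)"]
          by (simp_all add: norm_Pair mult_ac power2_eq_square)
        moreover have "c * norm k * \<bar>\<tau>\<bar> \<le> \<delta> / 16 * (norm k)\<^sup>2 + 4 * c\<^sup>2 / \<delta> * \<tau>\<^sup>2"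
        proof -
          have "0 \<le> (sqrt \<delta> / 4 * norm k - 2 * c / sqrt \<delta> * \<bar>\<tau>\<bar>)\<^sup>2" by simp
          also have "\<dots> = \<delta> / 16 * (norm k)\<^sup>2 + 4 * c\<^sup>2 / \<delta> * \<tau>\<^sup>2 - c * norm k * \<bar>\<tau>\<bar>"
            using \<delta> by (simp add: power2_diff power_divide power_mult_distrib)
          finally show ?thesis by simp
        qed
        ultimately show ?thesis unfolding qX by linarith
      qed
      have 3: "\<Phi> (B s' - B t0) (x' - fst w) \<le> \<Phi> (B s - B t0) (x - \<xi>) + (H Q \<bullet> b - Q \<bullet> Hgrad H b Q) + \<delta> / 16 * (norm k)\<^sup>2"
      proof -
        have "\<Phi> ((B s - B t0) + b) ((x - \<xi>) - Hgrad H b Q) \<le> \<Phi> (B s - B t0) (x - \<xi>) + (H Q \<bullet> b - Q \<bullet> Hgrad H b Q) + 2 * (C * norm b) * (norm (Q - P))\<^sup>2"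
        proof (rule legendre_along_characteristic[OF _ _ \<beta>s Q])
          have "2 * (1 / (8 * \<Lambda>)) = 1 / (4 * \<Lambda>)" using \<Lambda> by (simp add: field_simps)
          then show "2 * (C * norm b) \<le> 1 / (4 * \<Lambda>)" using Cb by (simp add: b0_def)
        qed (use m in \<open>auto simp: maximizer_def zt\<close>)
        moreover have "2 * (C * norm b) * (norm (Q - P))\<^sup>2 \<le> \<delta> / 16 * (norm k)\<^sup>2"
        proof -
          have "2 * (C * norm b) * (norm (Q - P))\<^sup>2 \<le> 2 * (\<delta> / (32 * M'\<^sup>2)) * (M' * norm k)\<^sup>2"
            using Cb C QP' \<delta> by (intro mult_mono power_mono) (auto simp: b0_def)
          also have "\<dots> = \<delta> / 16 * (norm k)\<^sup>2" using M' by (simp add: power_mult_distrib)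
          finally show ?thesis .
        qed
        moreover have "(B s - B t0) + b = B s' - B t0" "(x - \<xi>) - Hgrad H b Q = x' - fst w"
          by (auto simp: b_def x'_def w_def)
        ultimately show ?thesis by simp
      qed
      have "snd w - s' = t - s" by (simp add: w_def \<tau>_def)
      then have 4: "u (x', s') \<le> sconv w + \<Phi> (B s' - B t0) (x' - fst w) + (t - s)\<^sup>2 / (2 * \<epsilon>)"
        using sconv_ge[OF \<open>(x', s') \<in> D\<close>, of w] by (simp add: obj_def)
      have 5: "sconv z = u (x, s) - \<Phi> (B s - B t0) (x - \<xi>) - (t - s)\<^sup>2 / (2 * \<epsilon>)"
        using m by (simp add: maximizer_def obj_def zt)
      have 6: "k \<bullet> ((X + \<delta> *\<^sub>R mat 1) *v k) = k \<bullet> (X *v k) + \<delta> * (norm k)\<^sup>2"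
        by (simp add: matrix_vector_mult_add_rdistrib scaleR_matrix_vector_assoc[symmetric] inner_add_right dot_square_norm)
      have "0 \<le> \<delta> * (norm k)\<^sup>2" using \<delta> by simp
      then have "u (x', s') \<le> u (x, s) + P \<bullet> k + k \<bullet> ((X + \<delta> *\<^sub>R mat 1) *v k) / 2 - \<delta> / 4 * (norm k)\<^sup>2
        + (H Q \<bullet> b - Q \<bullet> Hgrad H b Q) + a * \<tau> + (c / 2 + 4 * c\<^sup>2 / \<delta> + \<delta> / 16) * \<tau>\<^sup>2"
        using 1 2 3 4 5 unfolding 6 by (simp add: distrib_left distrib_right add_divide_distrib)
      then show "u (x + k - Hgrad H (B s' - B s) Q, s') \<le> u (x, s) + P \<bullet> k + k \<bullet> ((X + \<delta> *\<^sub>R mat 1) *v k) / 2 - \<delta> / 4 * (norm k)\<^sup>2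
        + (H Q \<bullet> (B s' - B s) - Q \<bullet> Hgrad H (B s' - B s) Q) + a * (s' - s) + (c / 2 + 4 * c\<^sup>2 / \<delta> + \<delta> / 16) * (s' - s)\<^sup>2"
        by (simp add: x'_def b_def \<tau>_def)
    qed
  qed
  show ?thesis using symX qX lowX PR test by (intro exI[of _ X]) (auto simp: p)
qed

end

section \<open>Comparison\<close>

text \<open>Polarisation: basis vectors control the diagonal, and sums of two of them, with form at
  most 4c, control the other entries by 3c.\<close>

lemma norm_symmetric_matrix_le:
  fixes Y :: "real^'n^'n"
  assumes Y: "transpose Y = Y" and q: "\<And>k. \<bar>k \<bullet> (Y *v k)\<bar> \<le> c * (norm k)\<^sup>2"
  shows "norm Y \<le> real CARD('n) * (real CARD('n) * (3 * c))"
proof -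
  have sym: "Y $ i $ j = Y $ j $ i" for i j using Y by (metis transpose_def vec_lambda_beta)
  have ent: "axis i 1 \<bullet> (Y *v axis j 1) = Y $ i $ j" for i j
    by (simp add: inner_axis' matrix_vector_mul_component inner_axis)
  have c0: "0 \<le> c" using q[of "axis undefined 1"] by (simp add: norm_axis_1 order_trans[OF abs_ge_zero])
  have "\<bar>Y $ i $ j\<bar> \<le> 3 * c" for i j
  proof -
    define k :: "real^'n" where "k = axis i 1 + axis j 1"
    have "k \<bullet> (Y *v k) = Y $ i $ i + Y $ j $ j + 2 * Y $ i $ j"
      using sym[of i j] by (simp add: k_def matrix_vector_right_distrib inner_add_left inner_add_right ent)
    moreover have "\<bar>Y $ i $ i\<bar> \<le> c" "\<bar>Y $ j $ j\<bar> \<le> c"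
      using q[of "axis i 1"] q[of "axis j 1"] by (simp_all add: ent norm_axis_1)
    moreover have "\<bar>k \<bullet> (Y *v k)\<bar> \<le> 4 * c"
    proof -
      have "norm k \<le> 2" using norm_triangle_ineq[of "axis i (1::real)" "axis j 1"] by (simp add: k_def norm_axis_1)
      then have "(norm k)\<^sup>2 \<le> 2\<^sup>2" by (intro power_mono) auto
      then show ?thesis using q[of k] mult_left_mono[OF _ c0, of "(norm k)\<^sup>2" 4] by simp
    qed
    ultimately show ?thesis by linarith
  qed
  then have row: "norm (Y $ i) \<le> real CARD('n) * (3 * c)" for i
    using order_trans[OF norm_le_l1_cart sum_bounded_above[of UNIV "\<lambda>j. \<bar>Y $ i $ j\<bar>" "3 * c"]] by simp
  have "norm Y \<le> (\<Sum>i\<in>UNIV. norm (Y $ i))" unfolding norm_vec_def by (rule L2_set_le_sum) simp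
  also have "\<dots> \<le> (\<Sum>i\<in>(UNIV :: 'n set). real CARD('n) * (3 * c))" using row by (intro sum_mono) simp
  finally show ?thesis by simp
qed

text \<open>Bounded quadratic forms and bounded momenta leave a compact set of symmetric matrices
  and vectors, on which \<open>F\<close> is uniformly continuous. This stands in for a structure
  condition on \<open>F\<close>.\<close>

lemma elliptic_operator_uniform_on_bounded:
  fixes F :: "real^'d^'d \<Rightarrow> real^'d \<Rightarrow> real"
  assumes F: "continuous_on (sym_matrices \<times> UNIV) (\<lambda>(X, p). F X p)" and \<eta>: "0 < \<eta>"
  shows "\<exists>d>0. \<forall>Y p q e. transpose Y = Y \<and> (\<forall>k. \<bar>k \<bullet> (Y *v k)\<bar> \<le> c * (norm k)\<^sup>2) \<and>
    norm p \<le> R \<and> norm q \<le> R \<and> norm (p - q) \<le> d \<and> \<bar>e\<bar> \<le> d \<longrightarrow> \<bar>F (Y + e *\<^sub>R mat 1) p - F Y q\<bar> < \<eta>"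
proof -
  define I where "I = (mat 1 :: real^'d^'d)"
  define N where "N = real CARD('d) * (real CARD('d) * (3 * c)) + norm I + 1"
  define S where "S = ((sym_matrices :: (real^'d^'d) set) \<inter> cball 0 N) \<times> cball (0::real^'d) R"
  have "closed (sym_matrices :: (real^'d^'d) set)"
  proof -
    have eq: "sym_matrices = (\<Inter>i. \<Inter>j. {A :: real^'d^'d. A $ j $ i = A $ i $ j})"
      by (auto simp: sym_matrices_def transpose_def vec_eq_iff)
    show ?thesis unfolding eq by (intro closed_INT ballI closed_Collect_eq continuous_intros)
  qed
  then have "compact S" unfolding S_def by (intro compact_Times closed_Int_compact) auto
  moreover have "continuous_on S (\<lambda>(X, p). F X p)" by (rule continuous_on_subset[OF F]) (auto simp: S_def)
  ultimately have "uniformly_continuous_on S (\<lambda>(X, p). F X p)" by (rule compact_uniformly_continuous[rotated])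
  then obtain d where d: "0 < d" "\<And>a b. a \<in> S \<Longrightarrow> b \<in> S \<Longrightarrow> dist b a < d \<Longrightarrow> dist ((\<lambda>(X, p). F X p) b) ((\<lambda>(X, p). F X p) a) < \<eta>"
    using \<eta> unfolding uniformly_continuous_on_def by metis
  define d' where "d' = min 1 (d / (2 * (norm I + 1)))"
  have I1: "0 < norm I + 1" by (simp add: add_nonneg_pos)
  have d': "0 < d'" "d' * norm I + d' < d"
  proof -
    show "0 < d'" using d I1 by (simp add: d'_def)
    have "d' * (norm I + 1) \<le> d / (2 * (norm I + 1)) * (norm I + 1)" using I1 by (intro mult_right_mono) (auto simp: d'_def)
    also have "\<dots> = d / 2" using I1 by (simp add: field_simps)
    finally show "d' * norm I + d' < d" using d(1) by (simp add: distrib_left)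
  qed
  have "\<bar>F (Y + e *\<^sub>R mat 1) p - F Y q\<bar> < \<eta>"
    if Y: "transpose Y = Y" "\<And>k. \<bar>k \<bullet> (Y *v k)\<bar> \<le> c * (norm k)\<^sup>2"
      and pq: "norm p \<le> R" "norm q \<le> R" "norm (p - q) \<le> d'" and e: "\<bar>e\<bar> \<le> d'" for Y p q e
  proof -
    have eI: "norm (e *\<^sub>R I) \<le> d' * norm I" using e by (simp add: mult_right_mono)
    have "d' * norm I \<le> 1 * norm I" by (intro mult_right_mono) (auto simp: d'_def)
    then have n: "norm Y \<le> N" "norm (Y + e *\<^sub>R I) \<le> N"
      using norm_symmetric_matrix_le[OF Y] eI norm_triangle_ineq[of Y "e *\<^sub>R I"] norm_ge_zero[of I] unfolding N_def by linarith+
    have "transpose (Y + e *\<^sub>R I) = Y + e *\<^sub>R I"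
      using Y(1) by (simp add: transpose_def vec_eq_iff mat_def I_def)
    then have "(Y + e *\<^sub>R I, p) \<in> S" "(Y, q) \<in> S" using n pq Y by (auto simp: S_def sym_matrices_def)
    moreover have "dist (Y + e *\<^sub>R I, p) (Y, q) < d"
    proof -
      have "dist (Y + e *\<^sub>R I, p) (Y, q) \<le> norm (e *\<^sub>R I) + norm (p - q)"
        using norm_triangle_ineq[of "(e *\<^sub>R I, 0)" "(0, p - q)"] by (simp add: dist_norm norm_Pair)
      then show ?thesis using eI pq(3) d'(2) by linarith
    qed
    ultimately show ?thesis using d(2) by (fastforce simp: dist_real_def I_def)
  qed
  then show ?thesis using d'(1) by blast
qed

section \<open>Doubling the variables\<close>

lemma hamiltonian_reflect:
  assumes "hamiltonian H \<Lambda> R C"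
  shows "hamiltonian (\<lambda>p. - H (- p)) \<Lambda> R C"
proof -
  interpret hamiltonian H \<Lambda> R C by fact
  show ?thesis
  proof
    show "C2_fun (\<lambda>p. - H (- p))" by (rule C2_fun_reflect[OF C2H])
    show "norm (- H (- p)) \<le> C" if "p \<in> cball 0 R" for p using H_bound[of "- p"] that by simp
    show "norm (Hgrad (\<lambda>p. - H (- p)) b p) \<le> C * norm b" if "p \<in> cball 0 R" for p b
      using Hgrad_bound[of "- p"] that by (simp add: Hgrad_reflect[OF C2H])
    show "\<bar>- H (- p) \<bullet> b - - H (- q) \<bullet> b - (p - q) \<bullet> Hgrad (\<lambda>p. - H (- p)) b q\<bar> \<le> C * norm b * (norm (p - q))\<^sup>2"
      if "p \<in> cball 0 R" "q \<in> cball 0 R" for p q b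
      using H_Taylor[of "- p" "- q" b] that
      by (simp add: Hgrad_reflect[OF C2H] inner_diff_left norm_minus_commute abs_le_iff algebra_simps)
  qed (rule \<Lambda> R C)+
qed

text \<open>The sum of the kernels dominates the noise-free kernel of size \<Lambda> / 2 at x - y up
  to \<kappa>/8, because the base point drops out and only the noise between the two maximising
  times remains. Equalising these times in \<open>v\<close>, and replacing the base time in the
  \<mu> term, costs \<kappa>/8 each.\<close>

lemma doubled_sup_convolution_bound:
  assumes H: "hamiltonian H \<Lambda> R C"
    and f: "sup_convolution H \<Lambda> R C B u K t0 r h \<epsilon>"
    and g: "sup_convolution (\<lambda>p. - H (- p)) \<Lambda> R C B (\<lambda>z. - v z) K t0 r h \<epsilon>"
    and w: "w \<in> cball (\<xi>0, t0) (h / 2)"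
    and \<tau>: "4 * (2 * \<epsilon> * (2 * K + 2)) \<le> \<tau>\<^sup>2" "0 < \<tau>" "\<mu> * \<tau> \<le> \<kappa> / 8" and \<mu>: "0 < \<mu>"
    and mod: "\<And>y s s'. \<bar>s - t0\<bar> \<le> h \<Longrightarrow> \<bar>s' - t0\<bar> \<le> h \<Longrightarrow> \<bar>s - s'\<bar> \<le> \<tau> \<Longrightarrow>
      \<bar>v (y, s) - v (y, s')\<bar> \<le> \<kappa> / 8 \<and> C * norm (B s - B s') \<le> \<kappa> / 8"
    and bnd: "\<And>x y s. 0 \<le> s \<Longrightarrow> u (x, s) - v (y, s) - legendre H (\<Lambda> / 2) R 0 (x - y) - \<mu> * s \<le> S"
    and \<kappa>: "0 < \<kappa>"
  shows "sup_convolution.sconv H \<Lambda> R B u \<xi>0 t0 r h \<epsilon> w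
    + (sup_convolution.sconv (\<lambda>p. - H (- p)) \<Lambda> R B (\<lambda>z. - v z) \<xi>0 t0 r h \<epsilon> w - \<mu> * snd w) \<le> S + \<kappa> / 2"
proof -
  interpret f: sup_convolution H \<Lambda> R C B u K \<xi>0 t0 r h \<epsilon> by fact
  interpret g: sup_convolution "\<lambda>p. - H (- p)" \<Lambda> R C B "\<lambda>z. - v z" K \<xi>0 t0 r h \<epsilon> by fact
  interpret half: hamiltonian H "\<Lambda> / 2" R C
    using f.\<Lambda> by unfold_locales (auto intro: f.C2H f.R f.C f.H_bound f.Hgrad_bound f.H_Taylor)
  obtain x s P where m: "f.maximizer w x s P" using f.maximizer_exists[OF w] by blast
  obtain y \<sigma> P' where m': "g.maximizer w y \<sigma> P'" using g.maximizer_exists[OF w] by blast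
  \<comment> \<open>Both maximising times lie within \<tau>/2 of the common base time, hence within
    \<tau> of each other.\<close>
  have close: "\<bar>snd w - s'\<bar> \<le> \<tau> / 2" if "(snd w - s')\<^sup>2 \<le> 2 * \<epsilon> * (2 * K + 2)" for s'
  proof -
    have "\<bar>snd w - s'\<bar>\<^sup>2 \<le> (\<tau> / 2)\<^sup>2" using that \<tau>(1) by (simp add: power_divide)
    then show ?thesis using \<tau>(2) by (intro power2_le_imp_le[of "\<bar>snd w - s'\<bar>"]) auto
  qed
  have ts: "\<bar>snd w - s\<bar> \<le> \<tau> / 2" "\<bar>snd w - \<sigma>\<bar> \<le> \<tau> / 2"
    using m m' close by (auto simp: f.maximizer_def g.maximizer_def)
  have sh: "\<bar>s - t0\<bar> \<le> h" "\<bar>\<sigma> - t0\<bar> \<le> h" using m m' by (auto simp: f.maximizer_def g.maximizer_def)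
  have md: "\<bar>v (y, s) - v (y, \<sigma>)\<bar> \<le> \<kappa> / 8" "C * norm (B s - B \<sigma>) \<le> \<kappa> / 8" 
  proof -
    have "\<bar>s - \<sigma>\<bar> \<le> \<tau>" using ts by linarith
    then show "\<bar>v (y, s) - v (y, \<sigma>)\<bar> \<le> \<kappa> / 8" "C * norm (B s - B \<sigma>) \<le> \<kappa> / 8" using mod[OF sh] by auto
  qed
  obtain p where p: "p \<in> cball 0 R" "legendre H (\<Lambda> / 2) R 0 (x - y) = kin H (\<Lambda> / 2) 0 (x - y) p"
    using half.legendre_attained by blast
  have "- p \<in> cball 0 R" using p(1) by simp
  \<comment> \<open>The cancellation: momentum \<open>p\<close> in the first kernel and
    \<open>- p\<close> in the reflected one. The linear terms combine to x - y, the quadratic terms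
    add up to the one for \<Lambda> / 2, and \<open>H p\<close> meets only
    \<open>B s - B \<sigma>\<close>.\<close>
  have "kin H (\<Lambda> / 2) 0 (x - y) p + H p \<bullet> (B s - B \<sigma>)
     = kin H \<Lambda> (B s - B t0) (x - fst w) p + kin (\<lambda>p. - H (- p)) \<Lambda> (B \<sigma> - B t0) (y - fst w) (- p)"
    using f.\<Lambda> by (simp add: kin_def inner_diff_right field_simps)
  also have "\<dots> \<le> legendre H \<Lambda> R (B s - B t0) (x - fst w) + legendre (\<lambda>p. - H (- p)) \<Lambda> R (B \<sigma> - B t0) (y - fst w)"
    by (intro add_mono f.legendre_ge g.legendre_ge) (use p(1) in auto)
  finally have "legendre H \<Lambda> R (B s - B t0) (x - fst w) + legendre (\<lambda>p. - H (- p)) \<Lambda> R (B \<sigma> - B t0) (y - fst w)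
      \<ge> legendre H (\<Lambda> / 2) R 0 (x - y) - \<kappa> / 8"
    using f.H_inner_bound[OF p(1), of "B s - B \<sigma>"] md(2) p(2) by (simp add: abs_le_iff)
  moreover have "f.sconv w \<le> u (x, s) - legendre H \<Lambda> R (B s - B t0) (x - fst w)"
    using m f.\<epsilon> by (simp add: f.maximizer_def f.obj_def)
  moreover have "g.sconv w \<le> - v (y, \<sigma>) - legendre (\<lambda>p. - H (- p)) \<Lambda> R (B \<sigma> - B t0) (y - fst w)"
    using m' g.\<epsilon> by (simp add: g.maximizer_def g.obj_def)
  moreover have "\<mu> * s - \<mu> * snd w \<le> \<kappa> / 8"
  proof -
    have "\<mu> * (s - snd w) \<le> \<mu> * \<tau>" using ts \<tau>(2) \<mu> by (intro mult_left_mono) linarith+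
    then show ?thesis using \<tau>(3) by (simp add: right_diff_distrib)
  qed
  moreover have "0 \<le> s" using sh f.h by linarith
  then have "u (x, s) - v (y, s) - legendre H (\<Lambda> / 2) R 0 (x - y) - \<mu> * s \<le> S" by (rule bnd)
  ultimately show ?thesis using md(1) \<kappa> unfolding abs_le_iff by linarith
qed

text \<open>At time t0 there is no noise increment, and from the midpoint each kernel is at most
  half of the doubled penalty, so taking x and y as competitors loses nothing.\<close>

lemma doubled_sup_convolution_center:
  assumes f: "sup_convolution H \<Lambda> R C B u K t0 r h \<epsilon>"
    and g: "sup_convolution (\<lambda>p. - H (- p)) \<Lambda> R C B (\<lambda>z. - v z) K t0 r h \<epsilon>"
    and \<xi>0: "\<xi>0 = (1/2) *\<^sub>R (x + y)" and xy: "norm (x - y) \<le> 2 * r"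
  shows "u (x, t0) - v (y, t0) - legendre H (\<Lambda> / 2) R 0 (x - y) \<le> sup_convolution.sconv H \<Lambda> R B u \<xi>0 t0 r h \<epsilon> (\<xi>0, t0)
    + sup_convolution.sconv (\<lambda>p. - H (- p)) \<Lambda> R B (\<lambda>z. - v z) \<xi>0 t0 r h \<epsilon> (\<xi>0, t0)"
proof -
  interpret f: sup_convolution H \<Lambda> R C B u K \<xi>0 t0 r h \<epsilon> by fact
  interpret g: sup_convolution "\<lambda>p. - H (- p)" \<Lambda> R C B "\<lambda>z. - v z" K \<xi>0 t0 r h \<epsilon> by fact
  interpret half: hamiltonian H "\<Lambda> / 2" R C
    using f.\<Lambda> by unfold_locales (auto intro: f.C2H f.R f.C f.H_bound f.Hgrad_bound f.H_Taylor)
  have e: "x - \<xi>0 = (1/2) *\<^sub>R (x - y)" "y - \<xi>0 = - (1/2) *\<^sub>R (x - y)"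
    by (simp_all add: \<xi>0 algebra_simps scaleR_half_double[symmetric] flip: scaleR_add_left)
  have ep: "p \<bullet> (x - \<xi>0) = p \<bullet> (x - y) / 2" "p \<bullet> (y - \<xi>0) = - (p \<bullet> (x - y) / 2)" for p
    unfolding e by simp_all
  have D: "(x, t0) \<in> f.D" "(y, t0) \<in> g.D"
  proof -
    have "norm (x - \<xi>0) = norm (x - y) / 2" "norm (y - \<xi>0) = norm (x - y) / 2" unfolding e by simp_all
    then have "dist \<xi>0 x \<le> r" "dist \<xi>0 y \<le> r" using xy by (simp_all add: dist_norm norm_minus_commute)
    then show "(x, t0) \<in> f.D" "(y, t0) \<in> g.D" using f.h by (auto simp: f.D_def g.D_def)
  qed
  have "legendre H \<Lambda> R 0 (x - \<xi>0) \<le> legendre H (\<Lambda> / 2) R 0 (x - y) / 2"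
  proof (rule f.legendre_le)
    fix p :: "real^'a" assume "p \<in> cball 0 R"
    from half.legendre_ge[OF this, of 0 "x - y"]
    show "kin H \<Lambda> 0 (x - \<xi>0) p \<le> legendre H (\<Lambda> / 2) R 0 (x - y) / 2"
      using f.\<Lambda> unfolding kin_def ep by (simp add: field_simps)
  qed
  moreover have "legendre (\<lambda>p. - H (- p)) \<Lambda> R 0 (y - \<xi>0) \<le> legendre H (\<Lambda> / 2) R 0 (x - y) / 2"
  proof (rule g.legendre_le)
    fix p :: "real^'a" assume "p \<in> cball 0 R"
    then have "- p \<in> cball 0 R" by simp
    from half.legendre_ge[OF this, of 0 "x - y"]
    show "kin (\<lambda>p. - H (- p)) \<Lambda> 0 (y - \<xi>0) p \<le> legendre H (\<Lambda> / 2) R 0 (x - y) / 2"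
      using f.\<Lambda> unfolding kin_def ep by (simp add: field_simps)
  qed
  moreover have "u (x, t0) - legendre H \<Lambda> R 0 (x - \<xi>0) \<le> f.sconv (\<xi>0, t0)"
    using f.sconv_ge[OF D(1), of "(\<xi>0, t0)"] by (simp add: f.obj_def)
  moreover have "- v (y, t0) - legendre (\<lambda>p. - H (- p)) \<Lambda> R 0 (y - \<xi>0) \<le> g.sconv (\<xi>0, t0)"
    using g.sconv_ge[OF D(2), of "(\<xi>0, t0)"] by (simp add: g.obj_def)
  ultimately show ?thesis by linarith
qed

theorem theorem8p3:
  fixes H :: "real^'d \<Rightarrow> real^'m"
    and B :: "real \<Rightarrow> real^'m"
    and F :: "real^'d^'d \<Rightarrow> real^'d \<Rightarrow> real"
    and u v :: "(real^'d) \<times> real \<Rightarrow> real"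
    and t :: real
  assumes "C2_fun H"
    and "continuous_on {0..} B" and "B 0 = 0"
    and "continuous_on (sym_matrices \<times> UNIV) (\<lambda>(X, p). F X p)"
    and "degenerate_elliptic F"
    and "BUC (UNIV \<times> {0..}) u" and "BUC (UNIV \<times> {0..}) v"
    and "pathwise_subsolution F H B u"
    and "pathwise_supersolution F H B v"
    and "t \<ge> 0"
  shows "(SUP x. u (x, t) - v (x, t)) \<le> (SUP x. u (x, 0) - v (x, 0))"
proof (rule ccontr)
  note C2H = assms(1) and contB = assms(2) and contF = assms(4) and ell = assms(5)
  let ?Hm = "\<lambda>p. - H (- p)"
  define M0 where "M0 = (SUP x. u (x, 0) - v (x, 0))"
  obtain Ku where Ku: "\<And>z. z \<in> UNIV \<times> {0..} \<Longrightarrow> \<bar>u z\<bar> \<le> Ku"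
    using assms(6) unfolding BUC_def bounded_iff by auto
  obtain Kv where Kv: "\<And>z. z \<in> UNIV \<times> {0..} \<Longrightarrow> \<bar>v z\<bar> \<le> Kv"
    using assms(7) unfolding BUC_def bounded_iff by auto
  define K where "K = max 0 (max Ku Kv)"
  have K: "0 \<le> K" by (simp add: K_def)
  have uK: "\<bar>u (x, s)\<bar> \<le> K" and vK: "\<bar>v (x, s)\<bar> \<le> K" if "0 \<le> s" for x s
    using Ku[of "(x, s)"] Kv[of "(x, s)"] that by (auto simp: K_def)
  have bdd: "bdd_above (range (\<lambda>x. u (x, s) - v (x, s)))" if "0 \<le> s" for s
  proof (rule bdd_aboveI2)
    show "u (x, s) - v (x, s) \<le> 2 * K" for x using uK[OF that, of x] vK[OF that, of x] by linarith
  qed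
  have M0: "u (x, 0) - v (x, 0) \<le> M0" for x unfolding M0_def by (rule cSUP_upper[OF _ bdd]) auto
  have M0K: "- (2 * K) \<le> M0" using M0[of 0] uK[of 0 0] vK[of 0 0] by linarith
  assume "\<not> ?thesis"
  then have "M0 < (SUP x. u (x, t) - v (x, t))" by (simp add: M0_def)
  then obtain x1 where x1: "M0 < u (x1, t) - v (x1, t)"
    using less_cSUP_iff[OF _ bdd[OF assms(10)]] by auto
  \<comment> \<open>Of the gap 4\<gamma>, one \<gamma> pays for \<open>\<mu> * t\<close> and one
    remains after the near-maximum and the comparison with time 0.\<close>
  define \<gamma> where "\<gamma> = (u (x1, t) - v (x1, t) - M0) / 4"
  have \<gamma>: "0 < \<gamma>" using x1 by (simp add: \<gamma>_def)
  define \<mu> where "\<mu> = \<gamma> / (t + 1)"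
  have \<mu>: "0 < \<mu>" "\<mu> * t \<le> \<gamma>" using \<gamma> assms(10) by (auto simp: \<mu>_def field_simps)
  have ucu: "uniformly_continuous_on (UNIV \<times> {0..}) u" and ucv: "uniformly_continuous_on (UNIV \<times> {0..}) v"
    using assms(6,7) by (auto simp: BUC_def)
  obtain d1 where d1: "0 < d1" "\<And>z w. z \<in> UNIV \<times> {0..} \<Longrightarrow> w \<in> UNIV \<times> {0..} \<Longrightarrow> dist w z < d1 \<Longrightarrow> dist (u w) (u z) < \<gamma> / 2"
    using ucu \<gamma> unfolding uniformly_continuous_on_def by (metis half_gt_zero)
  obtain d2 where d2: "0 < d2" "\<And>z w. z \<in> UNIV \<times> {0..} \<Longrightarrow> w \<in> UNIV \<times> {0..} \<Longrightarrow> dist w z < d2 \<Longrightarrow> dist (v w) (v z) < \<gamma> / 2"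
    using ucv \<gamma> unfolding uniformly_continuous_on_def by (metis half_gt_zero)
  \<comment> \<open>Halved because a time and a spatial increment are moved together.\<close>
  define \<eta> where "\<eta> = min d1 d2 / 2"
  have \<eta>: "0 < \<eta>" using d1 d2 by (simp add: \<eta>_def)
  \<comment> \<open>Chosen so that \<open>\<Lambda> * \<eta>\<^sup>2\<close> is 16(K + 1), which
    makes \<theta> at least 4(K + 1) beyond \<eta>, more than \<open>u\<close>, \<open>v\<close> and
    M0 together allow.\<close>
  define \<Lambda> where "\<Lambda> = 16 * (K + 1) / \<eta>\<^sup>2"
  have \<Lambda>: "0 < \<Lambda>" using K \<eta> by (simp add: \<Lambda>_def)
  define R where "R = sqrt (8 * \<Lambda> * (K + 1))"
  have R: "0 < R" using \<Lambda> K by (simp add: R_def)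
  have R2: "R\<^sup>2 = 8 * \<Lambda> * (K + 1)" using \<Lambda> K by (simp add: R_def)
  have \<Lambda>\<eta>: "\<Lambda> * \<eta>\<^sup>2 = 16 * (K + 1)" using \<eta> by (simp add: \<Lambda>_def)
  have "(\<Lambda> * \<eta> / 2)\<^sup>2 = \<Lambda> * (\<Lambda> * \<eta>\<^sup>2) / 4" by (simp add: power2_eq_square)
  also have "\<dots> = 4 * \<Lambda> * (K + 1)" unfolding \<Lambda>\<eta> by simp
  also have "\<dots> \<le> R\<^sup>2" using R2 \<Lambda> K by simp
  finally have \<Lambda>\<eta>R: "\<Lambda> * \<eta> / 2 \<le> R" by (rule power2_le_imp_le) (use R in simp)
  obtain C where C: "0 \<le> C"
    "\<And>p. p \<in> cball 0 R \<Longrightarrow> norm (H p) \<le> C"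
    "\<And>p b. p \<in> cball 0 R \<Longrightarrow> norm (Hgrad H b p) \<le> C * norm b"
    "\<And>p q b. p \<in> cball 0 R \<Longrightarrow> q \<in> cball 0 R \<Longrightarrow>
      \<bar>H p \<bullet> b - H q \<bullet> b - (p - q) \<bullet> Hgrad H b q\<bar> \<le> C * norm b * (norm (p - q))\<^sup>2"
    using Hgrad_bounds[OF C2H, of R] by metis
  have hamH: "hamiltonian H \<Lambda> R C" using C2H \<Lambda> R C by unfold_locales
  have hamHm: "hamiltonian ?Hm \<Lambda> R C" by (rule hamiltonian_reflect[OF hamH])
  interpret half: hamiltonian H "\<Lambda> / 2" R C using C2H \<Lambda> R C by unfold_locales auto
  define \<theta> where "\<theta> = legendre H (\<Lambda> / 2) R 0"
  have \<theta>0: "\<theta> 0 \<le> 0" "\<theta> z \<ge> 0" for z using half.legendre_at_0[of 0] half.legendre_lower[of 0 z] by (auto simp: \<theta>_def)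
  have \<theta>big: "\<theta> z \<ge> 4 * (K + 1)" if z: "\<eta> \<le> norm z" for z
  proof -
    \<comment> \<open>A momentum of length \<Lambda>\<eta>/2, the optimal one for distance \<eta>
      and within the truncation radius.\<close>
    define p where "p = (\<Lambda> * \<eta> / (2 * norm z)) *\<^sub>R z"
    have nz: "0 < norm z" using z \<eta> by linarith
    have np: "norm p = \<Lambda> * \<eta> / 2" using nz \<Lambda> \<eta> by (simp add: p_def)
    have pz: "p \<bullet> z = \<Lambda> * \<eta> / 2 * norm z" using nz by (simp add: p_def dot_square_norm power2_eq_square)
    have "p \<in> cball 0 R" using np \<Lambda>\<eta>R by simp
    from half.legendre_ge[OF this, of 0 z] have "\<theta> z \<ge> \<Lambda> * \<eta> / 2 * norm z - (\<Lambda> * \<eta> / 2)\<^sup>2 / \<Lambda>"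
      by (simp add: kin_def pz np \<theta>_def)
    moreover have "\<Lambda> * \<eta> / 2 * norm z \<ge> \<Lambda> * \<eta> / 2 * \<eta>" using z \<Lambda> \<eta> by (intro mult_left_mono) auto
    moreover have "(\<Lambda> * \<eta> / 2)\<^sup>2 / \<Lambda> = \<Lambda> * \<eta>\<^sup>2 / 4" using \<Lambda> by (simp add: power2_eq_square)
    moreover have "\<Lambda> * \<eta> / 2 * \<eta> = \<Lambda> * \<eta>\<^sup>2 / 2" by (simp add: power2_eq_square)
    ultimately show ?thesis using \<Lambda>\<eta> by linarith
  qed
  define N where "N = (\<lambda>(x, y, s). u (x, s) - v (y, s) - \<theta> (x - y) - \<mu> * s)"
  have NK: "N (x, y, s) \<le> 2 * K - \<mu> * s" if "0 \<le> s" for x y s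
    using uK[OF that, of x] vK[OF that, of y] \<theta>0(2)[of "x - y"] by (simp add: N_def)
  \<comment> \<open>Near-maximal points have times bounded above and away from 0: the initial
    comparison excludes small times, \<mu> large ones. All sizes up to \<kappa> can therefore be
    fixed before the point is chosen.\<close>
  have Nbig: "\<eta> \<le> s \<and> s \<le> 4 * K / \<mu> \<and> norm (x - y) < \<eta>" if N: "M0 + \<gamma> < N (x, y, s)" and s: "0 \<le> s" for x y s
  proof (intro conjI)
    show xy: "norm (x - y) < \<eta>"
    proof (rule ccontr)
      assume "\<not> norm (x - y) < \<eta>"
      then have "4 * (K + 1) \<le> \<theta> (x - y)" using \<theta>big by simp
      then have "N (x, y, s) \<le> 2 * K - 4 * (K + 1)"
        using uK[OF s, of x] vK[OF s, of y] mult_nonneg_nonneg[OF less_imp_le[OF \<mu>(1)] s] by (simp add: N_def)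
      then have "N (x, y, s) \<le> - (2 * K) - 4" by simp
      then show False using N M0K \<gamma> by linarith
    qed
    have "\<mu> * s \<le> 4 * K" using NK[OF s, of x y] N M0K \<gamma> by linarith
    then show "s \<le> 4 * K / \<mu>" using \<mu>(1) by (simp add: pos_le_divide_eq mult.commute)
    show "\<eta> \<le> s"
    proof (rule ccontr)
      assume "\<not> \<eta> \<le> s"
      then have s\<eta>: "s < \<eta>" by simp
      have "dist (u (x, s)) (u (x, 0)) < \<gamma> / 2"
        using s s\<eta> \<eta> by (intro d1(2)) (auto simp: dist_norm norm_Pair \<eta>_def)
      moreover have "dist (v (y, s)) (v (x, 0)) < \<gamma> / 2"
      proof (rule d2(2))
        have "norm ((y, s) - (x, 0)) \<le> norm (y - x) + \<bar>s\<bar>"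
          using norm_triangle_ineq[of "(y - x, 0)" "(0, s)"] by (simp add: norm_Pair)
        then show "dist (y, s) (x, 0) < d2" using xy s s\<eta> by (simp add: dist_norm norm_minus_commute \<eta>_def)
      qed (use s in auto)
      ultimately have "u (x, s) - v (y, s) < M0 + \<gamma>" using M0[of x] unfolding dist_real_def abs_less_iff by linarith
      then show False using N \<theta>0(2)[of "x - y"] mult_nonneg_nonneg[OF less_imp_le[OF \<mu>(1)] s] by (simp add: N_def)
    qed
  qed
  define T where "T = 4 * K / \<mu> + 1"
  have N1: "M0 + 3 * \<gamma> \<le> N (x1, x1, t)"
  proof -
    have "4 * \<gamma> = u (x1, t) - v (x1, t) - M0" by (simp add: \<gamma>_def)
    moreover have "N (x1, x1, t) = u (x1, t) - v (x1, t) - \<theta> 0 - \<mu> * t" by (simp add: N_def)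
    ultimately show ?thesis using \<mu>(2) \<theta>0(1) by linarith
  qed
  define S where "S = Sup (N ` (UNIV \<times> UNIV \<times> {0..}))"
  have bddN: "bdd_above (N ` (UNIV \<times> UNIV \<times> {0..}))"
  proof (rule bdd_aboveI2)
    fix z :: "(real^'d) \<times> (real^'d) \<times> real" assume "z \<in> UNIV \<times> UNIV \<times> {0..}"
    then obtain x y s where z: "z = (x, y, s)" "0 \<le> s" by auto
    then show "N z \<le> 2 * K" using NK[OF z(2), of x y] mult_nonneg_nonneg[OF less_imp_le[OF \<mu>(1)] z(2)] by simp
  qed
  have NS: "N (x, y, s) \<le> S" if "0 \<le> s" for x y s
    unfolding S_def by (rule cSup_upper[OF _ bddN]) (use that in auto)
  have S3: "M0 + 3 * \<gamma> \<le> S" using N1 NS[OF assms(10), of x1 x1] by linarith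
  define \<omega> where "\<omega> = min (1 / 16) (1 / (4 * \<Lambda>)) / (C + 1)"
  have \<omega>: "0 < \<omega>" "C * \<omega> \<le> 1 / 16" "C * \<omega> \<le> 1 / (4 * \<Lambda>)"
  proof -
    show "0 < \<omega>" using \<Lambda> C(1) by (simp add: \<omega>_def)
    have "C * \<omega> \<le> (C + 1) * \<omega>" using \<open>0 < \<omega>\<close> by (simp add: distrib_right)
    also have "\<dots> = min (1 / 16) (1 / (4 * \<Lambda>))" using C(1) by (simp add: \<omega>_def)
    finally show "C * \<omega> \<le> 1 / 16" "C * \<omega> \<le> 1 / (4 * \<Lambda>)" by simp_all
  qed
  have "uniformly_continuous_on {0..T + 1} B"
    by (rule compact_uniformly_continuous[OF continuous_on_subset[OF contB]]) auto
  then have ucB: "\<exists>d>0. \<forall>s\<in>{0..T + 1}. \<forall>s'\<in>{0..T + 1}. \<bar>s' - s\<bar> < d \<longrightarrow> norm (B s' - B s) < e" if "0 < e" for e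
    using that unfolding uniformly_continuous_on_def dist_norm real_norm_def by blast
  obtain h0 where h0: "0 < h0" "\<And>s s'. s \<in> {0..T + 1} \<Longrightarrow> s' \<in> {0..T + 1} \<Longrightarrow> \<bar>s' - s\<bar> < h0 \<Longrightarrow> norm (B s' - B s) < \<omega>"
    using ucB[OF \<omega>(1)] by blast
  \<comment> \<open>Below \<eta>, hence below the time of any near-maximal point, and short enough
    for the noise bounds of the kernels.\<close>
  define h where "h = min (h0 / 2) (min (\<eta> / 2) 1)"
  have h: "0 < h" "h < h0" "h < \<eta>" "h \<le> 1" using h0 \<eta> by (auto simp: h_def)
  define \<rho> where "\<rho> = h / 6"
  have \<rho>: "0 < \<rho>" "3 * \<rho> = h / 2" using h by (auto simp: \<rho>_def)
  define r where "r = 3 * R / (4 * \<Lambda>) + h + \<eta>"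
  have r: "3 * R / (4 * \<Lambda>) + h < r" "\<eta> \<le> 2 * r" using \<eta> h R \<Lambda> by (auto simp: r_def add_nonneg_nonneg)
  \<comment> \<open>\<open>\<kappa> * c\<close> is the total Hessian defect: 4\<kappa>/\<rho>^2 from
    Jensen's argument plus \<kappa> from each of the two viscosity inequalities.\<close>
  define c where "c = 4 / \<rho>\<^sup>2 + 2"
  have c: "0 < c" by (simp add: c_def add_nonneg_pos)
  obtain \<kappa>0 where \<kappa>0: "0 < \<kappa>0" "\<And>Y p q e. transpose Y = Y \<Longrightarrow> (\<And>k. \<bar>k \<bullet> (Y *v k)\<bar> \<le> (2 * \<Lambda> + c) * (norm k)\<^sup>2) \<Longrightarrow>
      norm p \<le> R \<Longrightarrow> norm q \<le> R \<Longrightarrow> norm (p - q) \<le> \<kappa>0 \<Longrightarrow> \<bar>e\<bar> \<le> \<kappa>0 \<Longrightarrow> \<bar>F (Y + e *\<^sub>R mat 1) p - F Y q\<bar> < \<mu> / 2"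
    using elliptic_operator_uniform_on_bounded[OF contF, of "\<mu> / 2" "2 * \<Lambda> + c" R] \<mu>(1) by (metis half_gt_zero)
  \<comment> \<open>The slope error 5\<kappa>/\<rho> must stay within the continuity threshold
    \<kappa>0 and strictly below \<mu>/2, whence 11 rather than 10; \<open>\<kappa> * c\<close> must
    also stay within \<kappa>0. The bound 1 keeps the matrices in a set fixed beforehand, and
    \<gamma> keeps the point near-maximal.\<close>
  define \<kappa> where "\<kappa> = min (min 1 \<gamma>) (min (\<kappa>0 / c) (min (\<kappa>0 * \<rho> / 5) (\<mu> * \<rho> / 11)))"
  have \<kappa>: "0 < \<kappa>" "\<kappa> \<le> 1" "\<kappa> \<le> \<gamma>" "\<kappa> * c \<le> \<kappa>0" "5 * \<kappa> / \<rho> \<le> \<kappa>0" "5 * \<kappa> / \<rho> < \<mu> / 2"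
  proof -
    show "0 < \<kappa>" using \<gamma> \<kappa>0 c \<rho> \<mu> by (simp add: \<kappa>_def)
    show "\<kappa> \<le> 1" "\<kappa> \<le> \<gamma>" by (auto simp: \<kappa>_def)
    have "\<kappa> \<le> \<kappa>0 / c" "\<kappa> \<le> \<kappa>0 * \<rho> / 5" "\<kappa> \<le> \<mu> * \<rho> / 11"
      by (simp_all only: \<kappa>_def min_le_iff_disj order_refl simp_thms)
    then show "\<kappa> * c \<le> \<kappa>0" "5 * \<kappa> / \<rho> \<le> \<kappa>0" using c \<rho> by (auto simp: field_simps)
    have "10 * \<kappa> < \<mu> * \<rho>" using \<open>\<kappa> \<le> \<mu> * \<rho> / 11\<close> \<open>0 < \<kappa>\<close> by simp
    then show "5 * \<kappa> / \<rho> < \<mu> / 2" using \<rho>(1) by (simp add: field_simps)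
  qed
  \<comment> \<open>Space is unbounded, so a point within \<kappa>/2 of the supremum replaces a
    maximum; with the error \<kappa>/2 of the upper bound this makes the \<kappa> of Jensen's
    argument.\<close>
  have "S - \<kappa> / 2 < S" using \<kappa> by simp
  then have "\<exists>a\<in>N ` (UNIV \<times> UNIV \<times> {0..}). S - \<kappa> / 2 < a"
    unfolding S_def by (intro less_cSupD) (auto intro!: exI[of _ 0])
  then obtain x0 y0 t0 where z0: "0 \<le> t0" "S - \<kappa> / 2 < N (x0, y0, t0)" by auto
  have "M0 + \<gamma> < N (x0, y0, t0)" using z0(2) S3 \<kappa>(3) \<gamma> by linarith
  then have t0: "\<eta> \<le> t0" "t0 \<le> T - 1" "norm (x0 - y0) < \<eta>" using Nbig[OF _ z0(1)] by (auto simp: T_def)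
  have range: "s \<in> {0..T + 1}" if "\<bar>s - t0\<bar> \<le> h" for s using that t0 h by auto
  have Bsmall: "C * norm (B s - B t0) \<le> 1 / 16 \<and> C * norm (B s - B t0) \<le> 1 / (4 * \<Lambda>)" if "\<bar>s - t0\<bar> \<le> h" for s
  proof -
    have "norm (B s - B t0) \<le> \<omega>" using h0(2)[OF range range[OF that], of t0] that h by (simp add: less_imp_le)
    then have "C * norm (B s - B t0) \<le> C * \<omega>" using C(1) by (rule mult_left_mono)
    then show ?thesis using \<omega> by auto
  qed
  have \<kappa>8: "0 < \<kappa> / 8" using \<kappa> by simp
  obtain d3 where d3: "0 < d3" "\<And>z w. z \<in> UNIV \<times> {0..} \<Longrightarrow> w \<in> UNIV \<times> {0..} \<Longrightarrow> dist w z < d3 \<Longrightarrow> dist (v w) (v z) < \<kappa> / 8"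
    using ucv \<kappa>8 unfolding uniformly_continuous_on_def by metis
  have "0 < \<kappa> / 8 / (C + 1)" using \<kappa>8 C(1) by simp
  then obtain d4 where d4: "0 < d4" "\<And>s s'. s \<in> {0..T + 1} \<Longrightarrow> s' \<in> {0..T + 1} \<Longrightarrow> \<bar>s' - s\<bar> < d4 \<Longrightarrow> norm (B s' - B s) < \<kappa> / 8 / (C + 1)"
    using ucB by blast
  \<comment> \<open>The admissible distance between the two maximising times, for the moduli of
    \<open>v\<close> and \<open>B\<close> and for the \<mu> term.\<close>
  define \<tau> where "\<tau> = min (min (d3 / 2) (d4 / 2)) (min h (\<kappa> / 8 / \<mu>))"
  have \<tau>: "0 < \<tau>" "\<tau> < d3" "\<tau> < d4" "\<tau> \<le> h" "\<mu> * \<tau> \<le> \<kappa> / 8"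
  proof -
    show "0 < \<tau>" "\<tau> < d3" "\<tau> < d4" "\<tau> \<le> h" using d3 d4 h \<kappa>8 \<mu> by (auto simp: \<tau>_def)
    have "\<mu> * \<tau> \<le> \<mu> * (\<kappa> / 8 / \<mu>)" using \<mu>(1) by (intro mult_left_mono) (auto simp: \<tau>_def)
    then show "\<mu> * \<tau> \<le> \<kappa> / 8" using \<mu>(1) by simp
  qed
  have mod: "\<bar>v (y, s) - v (y, s')\<bar> \<le> \<kappa> / 8 \<and> C * norm (B s - B s') \<le> \<kappa> / 8"
    if s: "\<bar>s - t0\<bar> \<le> h" "\<bar>s' - t0\<bar> \<le> h" "\<bar>s - s'\<bar> \<le> \<tau>" for y s s'
  proof
    show "\<bar>v (y, s) - v (y, s')\<bar> \<le> \<kappa> / 8"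
      using d3(2)[of "(y, s')" "(y, s)"] range[OF s(1)] range[OF s(2)] s(3) \<tau>(2)
      by (auto simp: dist_norm norm_Pair)
    have "norm (B s - B s') \<le> \<kappa> / 8 / (C + 1)"
      using d4(2)[OF range[OF s(2)] range[OF s(1)]] s(3) \<tau>(3) by auto
    then have "C * norm (B s - B s') \<le> (C + 1) * (\<kappa> / 8 / (C + 1))" using C(1) by (intro mult_mono) auto
    moreover have "m * (\<kappa> / 8 / m) = \<kappa> / 8" if "0 < m" for m using that by simp
    from this[of "C + 1"] have "(C + 1) * (\<kappa> / 8 / (C + 1)) = \<kappa> / 8" using C(1) by linarith
    ultimately show "C * norm (B s - B s') \<le> \<kappa> / 8" by linarith
  qed
  \<comment> \<open>The penalty bound \<open>2 * \<epsilon> * (2 * K + 2)\<close> becomes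
    \<tau>^2/8, which is below both \<tau>^2/4 and h^2/4.\<close>
  define \<epsilon> where "\<epsilon> = \<tau>\<^sup>2 / (32 * (K + 1))"
  have \<epsilon>: "0 < \<epsilon>" "2 * \<epsilon> * (2 * K + 2) = \<tau>\<^sup>2 / 8"
  proof -
    show "0 < \<epsilon>" using \<tau>(1) K by (simp add: \<epsilon>_def)
    have "2 * \<epsilon> * (2 * K + 2) = 4 * (\<epsilon> * (K + 1))" by (simp add: algebra_simps)
    also have "\<epsilon> * (K + 1) = \<tau>\<^sup>2 / 32"
    proof -
      have "\<tau>\<^sup>2 / (32 * m) * m = \<tau>\<^sup>2 / 32" if "0 < m" for m using that by simp
      from this[of "K + 1"] show ?thesis using K unfolding \<epsilon>_def by linarith
    qed
    finally show "2 * \<epsilon> * (2 * K + 2) = \<tau>\<^sup>2 / 8" by simp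
  qed
  have \<epsilon>h: "2 * \<epsilon> * (2 * K + 2) < (h / 2)\<^sup>2"
  proof -
    have "\<tau>\<^sup>2 \<le> h\<^sup>2" using \<tau>(1,4) by (intro power_mono) auto
    moreover have "0 < h\<^sup>2" using h by simp
    ultimately have "\<tau>\<^sup>2 / 8 < h\<^sup>2 / 4" by linarith
    then show ?thesis unfolding \<epsilon>(2) by (simp add: power_divide)
  qed
  have scf: "sup_convolution H \<Lambda> R C B u K t0 r h \<epsilon>"
    using hamH contB K uK uniformly_continuous_imp_continuous[OF ucu] R2 h t0 Bsmall r \<epsilon> \<epsilon>h
    by (intro sup_convolution.intro sup_convolution_axioms.intro) auto
  have scg: "sup_convolution ?Hm \<Lambda> R C B (\<lambda>z. - v z) K t0 r h \<epsilon>"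
    using hamHm contB K vK uniformly_continuous_imp_continuous[OF ucv] R2 h t0 Bsmall r \<epsilon> \<epsilon>h
    by (intro sup_convolution.intro sup_convolution_axioms.intro) (auto intro: continuous_on_minus)
  define \<xi>0 where "\<xi>0 = (1/2) *\<^sub>R (x0 + y0)"
  interpret f: sup_convolution H \<Lambda> R C B u K \<xi>0 t0 r h \<epsilon> by (rule scf)
  interpret g: sup_convolution ?Hm \<Lambda> R C B "\<lambda>z. - v z" K \<xi>0 t0 r h \<epsilon> by (rule scg)
  define G where "G w = g.sconv w - \<mu> * snd w" for w
  have center: "S - \<kappa> / 2 \<le> f.sconv (\<xi>0, t0) + G (\<xi>0, t0)"
    using doubled_sup_convolution_center[OF scf scg \<xi>0_def] t0(3) r(2) z0(2) by (simp add: G_def N_def \<theta>_def)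
  have upper: "f.sconv w + G w \<le> S + \<kappa> / 2" if "w \<in> cball (\<xi>0, t0) (h / 2)" for w
    unfolding G_def
  proof (rule doubled_sup_convolution_bound[OF hamH scf scg that _ \<tau>(1,5) \<mu>(1) mod _ \<kappa>(1)])
    show "4 * (2 * \<epsilon> * (2 * K + 2)) \<le> \<tau>\<^sup>2" unfolding \<epsilon>(2) by simp
    show "u (x, s) - v (y, s) - legendre H (\<Lambda> / 2) R 0 (x - y) - \<mu> * s \<le> S" if "0 \<le> s" for x y s
      using NS[OF that, of x y] by (simp add: N_def \<theta>_def)
  qed
  have "\<exists>z\<in>ball (\<xi>0, t0) \<rho>. \<exists>p q A A'. second_order_at f.sconv z p A \<and> second_order_at G z q A' \<and>
     norm (p + q) \<le> 5 * \<kappa> / \<rho> \<and> (\<forall>h. A h \<bullet> h + A' h \<bullet> h \<le> 4 * \<kappa> / \<rho>\<^sup>2 * (norm h)\<^sup>2)"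
  proof (rule Jensen_approximate_max[OF \<rho>(1) _ \<kappa>(1), where C = "\<Lambda> + 1 / (2 * \<epsilon>)"], unfold \<rho>(2))
    show "0 \<le> \<Lambda> + 1 / (2 * \<epsilon>)" using \<Lambda> \<epsilon> by simp
    show "continuous_on (cball (\<xi>0, t0) (h / 2)) f.sconv" by (rule f.sconv_cont)
    show "continuous_on (cball (\<xi>0, t0) (h / 2)) G" unfolding G_def[abs_def]
      by (intro continuous_intros g.sconv_cont)
    show "\<exists>p. \<forall>w\<in>cball (\<xi>0, t0) (h / 2). f.sconv z + p \<bullet> (w - z) - (\<Lambda> + 1 / (2 * \<epsilon>)) * (norm (w - z))\<^sup>2 \<le> f.sconv w"
      if "z \<in> cball (\<xi>0, t0) (h / 2)" for z using f.sconv_semiconvex[OF that] by blast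
    show "\<exists>p. \<forall>w\<in>cball (\<xi>0, t0) (h / 2). G z + p \<bullet> (w - z) - (\<Lambda> + 1 / (2 * \<epsilon>)) * (norm (w - z))\<^sup>2 \<le> G w"
      if z: "z \<in> cball (\<xi>0, t0) (h / 2)" for z
    proof -
      obtain p where p: "\<And>w. g.sconv w \<ge> g.sconv z + p \<bullet> (w - z) - (\<Lambda> + 1 / (2 * \<epsilon>)) * (norm (w - z))\<^sup>2"
        using g.sconv_semiconvex[OF z] by blast
      have "G z + (p - (0, \<mu>)) \<bullet> (w - z) - (\<Lambda> + 1 / (2 * \<epsilon>)) * (norm (w - z))\<^sup>2 \<le> G w" for w
        using p[of w] by (simp add: G_def inner_diff_left[of p] inner_prod_def[of "(0, \<mu>)"] right_diff_distrib)
      then show ?thesis by blast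
    qed
    show "f.sconv z + G z \<le> f.sconv (\<xi>0, t0) + G (\<xi>0, t0) + \<kappa>" if "z \<in> cball (\<xi>0, t0) (h / 2)" for z
      using upper[OF that] center by linarith
  qed
  then obtain z p q A A' where z: "z \<in> ball (\<xi>0, t0) \<rho>"
    and exf: "second_order_at f.sconv z p A" and exG: "second_order_at G z q A'"
    and pq: "norm (p + q) \<le> 5 * \<kappa> / \<rho>" and AA: "\<And>h. A h \<bullet> h + A' h \<bullet> h \<le> 4 * \<kappa> / \<rho>\<^sup>2 * (norm h)\<^sup>2" by blast
  have zc: "z \<in> cball (\<xi>0, t0) (h / 2)" using z \<rho> by auto
  \<comment> \<open>Undoes the term - \<mu> t of \<open>G\<close>; here the strict gain \<mu> enters
    the time slopes.\<close>
  define q' where "q' = q + (0, \<mu>)"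
  have "g.sconv w - g.sconv z - q' \<bullet> (w - z) = G w - G z - q \<bullet> (w - z)" for w
    by (simp add: G_def q'_def inner_add_left inner_prod_def[of "(0, \<mu>)"] right_diff_distrib)
  then have exg: "second_order_at g.sconv z q' A'" using exG by (simp add: second_order_at_def)
  have subv: "pathwise_subsolution (\<lambda>X p. - F (- X) (- p)) ?Hm B (\<lambda>z. - v z)"
    by (rule pathwise_supersolution_imp_subsolution_uminus[OF C2H assms(9)])
  obtain X where X: "transpose X = X" "\<And>k. k \<bullet> (X *v k) = A (k, 0) \<bullet> (k, 0)"
    "\<And>k. k \<bullet> (X *v k) \<ge> - (2 * \<Lambda>) * (norm k)\<^sup>2" "norm (fst p) < R" "snd p \<le> F (X + \<kappa> *\<^sub>R mat 1) (fst p)"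
    using f.sconv_subsolution[OF assms(8) zc exf] \<kappa>(1) by blast
  obtain X' where X': "transpose X' = X'" "\<And>k. k \<bullet> (X' *v k) = A' (k, 0) \<bullet> (k, 0)"
    "\<And>k. k \<bullet> (X' *v k) \<ge> - (2 * \<Lambda>) * (norm k)\<^sup>2" "norm (fst q') < R"
    "snd q' \<le> - F (- (X' + \<kappa> *\<^sub>R mat 1)) (- fst q')"
    using g.sconv_subsolution[OF subv zc exg] \<kappa>(1) by blast
  \<comment> \<open>The Hessian at which the inequality for \<open>v\<close> holds, back in the
    original sign; the matching gradient is \<open>- fst q'\<close>.\<close>
  define Y where "Y = - (X' + \<kappa> *\<^sub>R mat 1)"
  have qm: "k \<bullet> ((Z + e *\<^sub>R mat 1) *v k) = k \<bullet> (Z *v k) + e * (norm k)\<^sup>2" for k :: "real^'d" and Z e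
    by (simp add: matrix_vector_mult_add_rdistrib scaleR_matrix_vector_assoc[symmetric] inner_add_right dot_square_norm)
  have sm: "transpose (Z + e *\<^sub>R mat 1) = Z + e *\<^sub>R mat 1" if "transpose Z = Z" for Z :: "real^'d^'d" and e
    using that by (simp add: transpose_def vec_eq_iff mat_def)
  have qY: "k \<bullet> (Y *v k) = - (k \<bullet> (X' *v k)) - \<kappa> * (norm k)\<^sup>2" for k
    unfolding Y_def uminus_matrix_vector_mult using qm[of k X' \<kappa>] by simp
  have symY: "transpose Y = Y"
  proof -
    have "transpose (- Z) = - transpose Z" for Z :: "real^'d^'d" by (simp add: transpose_def vec_eq_iff)
    then show ?thesis unfolding Y_def using sm[OF X'(1), of \<kappa>] by metis
  qed
  have XX': "k \<bullet> (X *v k) + k \<bullet> (X' *v k) \<le> 4 * \<kappa> / \<rho>\<^sup>2 * (norm k)\<^sup>2" for k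
    using AA[of "(k, 0)"] X(2) X'(2) by (simp add: norm_Pair)
  have \<kappa>c: "4 * \<kappa> / \<rho>\<^sup>2 * (norm k)\<^sup>2 + 2 * \<kappa> * (norm k)\<^sup>2 = \<kappa> * c * (norm k)\<^sup>2" for k :: "real^'d"
    by (simp add: c_def distrib_left distrib_right mult_ac)
  have ord: "loewner_le (X + \<kappa> *\<^sub>R mat 1) (Y + (\<kappa> * c) *\<^sub>R mat 1)"
    unfolding loewner_le_def qm qY
  proof
    fix k :: "real^'d"
    show "k \<bullet> (X *v k) + \<kappa> * (norm k)\<^sup>2 \<le> - (k \<bullet> (X' *v k)) - \<kappa> * (norm k)\<^sup>2 + \<kappa> * c * (norm k)\<^sup>2"
      using XX'[of k] \<kappa>c[of k] by linarith
  qed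
  have Ybd: "\<bar>k \<bullet> (Y *v k)\<bar> \<le> (2 * \<Lambda> + c) * (norm k)\<^sup>2" for k
  proof -
    have "\<kappa> * c * (norm k)\<^sup>2 \<le> 1 * c * (norm k)\<^sup>2" using \<kappa>(2) c by (intro mult_right_mono) auto
    moreover have "0 \<le> \<kappa> * (norm k)\<^sup>2" "0 \<le> c * (norm k)\<^sup>2" using \<kappa> c by auto
    ultimately show ?thesis using XX'[of k] \<kappa>c[of k] X(3)[of k] X'(3)[of k] unfolding qY abs_le_iff distrib_right by auto
  qed
  have "F (X + \<kappa> *\<^sub>R mat 1) (fst p) \<le> F (Y + (\<kappa> * c) *\<^sub>R mat 1) (fst p)"
    using ell ord sm[OF X(1)] sm[OF symY] unfolding degenerate_elliptic_def sym_matrices_def by blast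
  moreover have "\<bar>F (Y + (\<kappa> * c) *\<^sub>R mat 1) (fst p) - F Y (- fst q')\<bar> < \<mu> / 2"
  proof (rule \<kappa>0(2)[OF symY Ybd])
    have "norm (fst p + fst q') \<le> norm (p + q)"
      using dist_fst_le[of "p + q" 0] by (simp add: q'_def dist_norm)
    then show "norm (fst p - - fst q') \<le> \<kappa>0" using pq \<kappa>(5) by simp
  qed (use X(4) X'(4) \<kappa>(1,4) c in auto)
  \<comment> \<open>Adding the two viscosity inequalities bounds this sum of time slopes by a
    difference of values of \<open>F\<close> that is below \<mu>/2, whereas the left-hand side
    exceeds \<mu>/2.\<close>
  moreover have "\<mu> - 5 * \<kappa> / \<rho> \<le> snd p + snd q'"
  proof -
    have "\<bar>snd (p + q)\<bar> \<le> norm (p + q)" using dist_snd_le[of "p + q" 0] by (simp add: dist_norm)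
    then show ?thesis using pq by (simp add: q'_def)
  qed
  ultimately show False using X(5) X'(5) \<kappa>(6) unfolding Y_def by linarith
qed

end
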